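(* Let $(X,d)$ be a compact metric space with $\operatorname{diam}(X)<\pi/2$ that satisfies the following condition: for any $\{x_1,\dots,x_k\}\subset X$ and $\{t_1,\dots,t_n\}\subset(0,\pi/2)\cup(\pi/2,\pi)$ such that $x_l\ne x_m$ for $l\neq m$ and $t_i\ne t_j$ for $i\ne j$, there exists $x_o\in X$ such that all the numbers $$\tan(t_j)\cos(d(x_o,x_m)),\qquad 1\le m\le k,\ 1\le j\le n,$$ are different. Let $p>1$. Then the spherical suspension of $X$ is isometrically rigid with respect to $\mathbb{P}_p$.
   Context: The spherical suspension of $X$ (with $\operatorname{diam}(X)<\pi/2$) is $\operatorname{Susp}(X)=(X\times[0,\pi])/\sim$, where $(x,0)\sim(x',0)$ and $(x,\pi)\sim(x',\pi)$ for all $x,x'\in X$, with the metric $$d_{\operatorname{Susp}}([x,t],[y,s])=\cos^{-1}\left(\cos t\cos s+\sin t\sin s\cos(d(x,y))\right).$$ For a metric space $Z$ with metric $d_Z$ and $p\ge1$, $\mathbb{P}_p(Z)$ is the set of Borel probability measures on $Z$ with finite $p$-moment, with the metric $W_p(\mu,\nu)=\inf_\pi\left(\int_{Z\times Z}d_Z(x,y)^p\,d\pi(x,y)\right)^{1/p}$, where $\pi$ ranges over Borel probability measures on $Z\times Z$ with marginals $\mu$ and $\nu$. Isometries are surjective distance-preserving self-maps. $Z$ is isometrically rigid with respect to $\mathbb{P}_p$ if every isometry of $(\mathbb{P}_p(Z),W_p)$ is the push-forward map $\varphi_\#$ of some isometry $\varphi$ of $Z$. *)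

theory Defs
  imports "HOL-Probability.Probability"
begin

section \<open>Metric spaces on explicit carriers\<close>

definition mdiam :: "'a set \<Rightarrow> ('a \<Rightarrow> 'a \<Rightarrow> real) \<Rightarrow> real" where
  "mdiam X d = (if X = {} then 0 else (SUP (x, y) \<in> X \<times> X. d x y))"

definition is_isometry :: "'a set \<Rightarrow> ('a \<Rightarrow> 'a \<Rightarrow> real) \<Rightarrow> ('a \<Rightarrow> 'a) \<Rightarrow> bool" where
  "is_isometry Z d \<phi> \<longleftrightarrow> \<phi> ` Z = Z \<and> (\<forall>x\<in>Z. \<forall>y\<in>Z. d (\<phi> x) (\<phi> y) = d x y)"


section \<open>Wasserstein spaces\<close>

definition borel_of :: "'a topology \<Rightarrow> 'a measure" where
  "borel_of T = sigma (topspace T) {U. openin T U}"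

abbreviation mborel :: "'a set \<Rightarrow> ('a \<Rightarrow> 'a \<Rightarrow> real) \<Rightarrow> 'a measure" where
  "mborel Z d \<equiv> borel_of (Metric_space.mtopology Z d)"

definition prob_moment :: "real \<Rightarrow> 'a set \<Rightarrow> ('a \<Rightarrow> 'a \<Rightarrow> real) \<Rightarrow> 'a measure set" where
  "prob_moment p Z d =
     {\<mu>. prob_space \<mu> \<and> sets \<mu> = sets (mborel Z d) \<and>
         (\<exists>z\<^sub>0\<in>Z. integrable \<mu> (\<lambda>z. d z\<^sub>0 z powr p))}"

definition couplings ::
  "'a set \<Rightarrow> ('a \<Rightarrow> 'a \<Rightarrow> real) \<Rightarrow> 'a measure \<Rightarrow> 'a measure \<Rightarrow> ('a \<times> 'a) measure set" where
  "couplings Z d \<mu> \<nu> =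
     {\<gamma>. prob_space \<gamma> \<and>
         sets \<gamma> = sets (borel_of (prod_topology (Metric_space.mtopology Z d) (Metric_space.mtopology Z d))) \<and>
         distr \<gamma> (mborel Z d) fst = \<mu> \<and> distr \<gamma> (mborel Z d) snd = \<nu>}"

text \<open>
  If \<open>\<mu>\<close> and \<open>\<nu>\<close> have finite \<open>p\<close>-moments, \<open>d x y powr p\<close> is integrable with respect to every
  coupling, so the convention that non-integrable functions have integral \<open>0\<close> is never invoked
  on \<open>prob_moment p Z d\<close>.
\<close>
definition wasserstein ::
  "real \<Rightarrow> 'a set \<Rightarrow> ('a \<Rightarrow> 'a \<Rightarrow> real) \<Rightarrow> 'a measure \<Rightarrow> 'a measure \<Rightarrow> real" where
  "wasserstein p Z d \<mu> \<nu> =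
     (INF \<gamma> \<in> couplings Z d \<mu> \<nu>. (\<integral>z. d (fst z) (snd z) powr p \<partial>\<gamma>) powr (1 / p))"

definition isometrically_rigid :: "real \<Rightarrow> 'a set \<Rightarrow> ('a \<Rightarrow> 'a \<Rightarrow> real) \<Rightarrow> bool" where
  "isometrically_rigid p Z d \<longleftrightarrow>
     (\<forall>\<Phi>. is_isometry (prob_moment p Z d) (wasserstein p Z d) \<Phi> \<longrightarrow>
        (\<exists>\<phi>. is_isometry Z d \<phi> \<and>
             (\<forall>\<mu>\<in>prob_moment p Z d. \<Phi> \<mu> = distr \<mu> (mborel Z d) \<phi>)))"


section \<open>Spherical suspensions\<close>

definition susp_rel :: "'a set \<Rightarrow> (('a \<times> real) \<times> ('a \<times> real)) set" where
  "susp_rel X = {((x, t), (y, s)). x \<in> X \<and> y \<in> X \<and> t \<in> {0..pi} \<and> s \<in> {0..pi} \<and>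
      (x = y \<and> t = s \<or> t = 0 \<and> s = 0 \<or> t = pi \<and> s = pi)}"

definition susp :: "'a set \<Rightarrow> ('a \<times> real) set set" where
  "susp X = (X \<times> {0..pi}) // susp_rel X"

text \<open>
  The value does not depend on the representatives (lemma \<open>susp_dist_class\<close>). Outside the carrier
  it is \<open>0\<close> because \<^locale>\<open>Metric_space\<close> demands symmetry and non-negativity on the whole type.
\<close>
definition susp_dist ::
  "'a set \<Rightarrow> ('a \<Rightarrow> 'a \<Rightarrow> real) \<Rightarrow> ('a \<times> real) set \<Rightarrow> ('a \<times> real) set \<Rightarrow> real" where
  "susp_dist X d P Q =
     (if P \<in> susp X \<and> Q \<in> susp X then
        (THE r. \<exists>x t y s. (x, t) \<in> P \<and> (y, s) \<in> Q \<and>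
           r = arccos (cos t * cos s + sin t * sin s * cos (d x y)))
      else 0)"

lemma equiv_susp_rel: "equiv (X \<times> {0..pi}) (susp_rel X)"
  by (rule equivI) (auto simp: susp_rel_def refl_on_def sym_def trans_def)

lemma susp_dist_class:
  assumes "x \<in> X" "y \<in> X" "t \<in> {0..pi}" "s \<in> {0..pi}"
  shows "susp_dist X d (susp_rel X `` {(x, t)}) (susp_rel X `` {(y, s)}) =
    arccos (cos t * cos s + sin t * sin s * cos (d x y))"
proof -
  let ?P = "susp_rel X `` {(x, t)}" and ?Q = "susp_rel X `` {(y, s)}"
  have mem: "?P \<in> susp X" "?Q \<in> susp X"
    using assms by (auto simp: susp_def intro!: quotientI)
  have self: "(x, t) \<in> ?P" "(y, s) \<in> ?Q"
    using assms by (auto simp: susp_rel_def)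
  have "(THE r. \<exists>x' t' y' s'. (x', t') \<in> ?P \<and> (y', s') \<in> ?Q \<and>
      r = arccos (cos t' * cos s' + sin t' * sin s' * cos (d x' y'))) =
    arccos (cos t * cos s + sin t * sin s * cos (d x y))"
  proof (rule the_equality)
    show "\<exists>x' t' y' s'. (x', t') \<in> ?P \<and> (y', s') \<in> ?Q \<and>
      arccos (cos t * cos s + sin t * sin s * cos (d x y)) =
      arccos (cos t' * cos s' + sin t' * sin s' * cos (d x' y'))"
      using self by blast
  qed (auto simp: susp_rel_def)
  then show ?thesis
    using mem by (simp add: susp_dist_def)
qed

end

theory Submission
  imports Defs
begin

text \<open>
  The poles \<open>N\<close>, \<open>S\<close> of the suspension are the only points at distance \<open>pi\<close>, so an isometry \<open>\<Phi>\<close> of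
  the Wasserstein space preserves or swaps their Dirac measures; composing with the flip, assume
  that it fixes them. Then it fixes all measures on \<open>{N, S}\<close>, because for \<open>p > 1\<close> they are the
  measures maximising the sum of the two costs to the poles.

  The main tool is that the costs from all measures on a two-point set \<open>{a, b}\<close> to a measure \<open>\<mu>\<close>
  determine the law of \<open>d(a, -)^p - d(b, -)^p\<close> under \<open>\<mu>\<close>. With \<open>a = N\<close> and \<open>b = S\<close> this shows that
  \<open>\<Phi>\<close> preserves the law of the height. Suppose that \<open>\<Phi>\<close> maps a Dirac measure \<open>\<delta>\<close> to \<open>m\<close> and that
  \<open>0 < m(E) < 1\<close>. Sweeping the mass of \<open>m\<close> outside \<open>E\<close> to \<open>N\<close>, or sweeping the fraction \<open>1 - m(E)\<close>
  of \<open>m\<close> uniformly to \<open>N\<close>, gives two different measures, but both have to be the image of the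
  unique measure obtained by moving mass \<open>1 - m(E)\<close> of \<open>\<delta>\<close> to \<open>N\<close>. So Dirac measures go to Dirac measures,
  and after composing with an isometry of the suspension \<open>\<Phi>\<close> fixes all of them.

  Then \<open>\<Phi>\<close> also fixes all measures on \<open>{N, z}\<close> and on \<open>{S, z}\<close>, hence the finitely supported
  measures on a slice of constant height, and comparing with these shows that it does not move
  finitely supported measures off the meridians that carry them. Bisectors of \<open>N\<close> (or \<open>S\<close>) and a
  point of the meridian of \<open>x\<^sub>0\<close> are the level sets of the projection to this meridian, which
  takes \<open>[x, t]\<close> to the height with tangent \<open>tan t * cos (d x\<^sub>0 x)\<close>. By hypothesis some such
  projection separates the points of a given finite grid, so \<open>\<Phi>\<close> fixes finitely supported measures,
  and by density everything.
\<close>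

section \<open>Borel sets and couplings on compact metric spaces\<close>

lemma space_borel_of [simp]: "space (borel_of T) = topspace T"
  unfolding borel_of_def by (rule space_measure_of) (auto dest: openin_subset)

lemma sets_borel_of: "sets (borel_of T) = sigma_sets (topspace T) {U. openin T U}"
  unfolding borel_of_def by (rule sets_measure_of) (auto dest: openin_subset)

lemma openin_borel_of: "openin T U \<Longrightarrow> U \<in> sets (borel_of T)"
  by (simp add: sets_borel_of)

lemma closedin_borel_of: "closedin T U \<Longrightarrow> U \<in> sets (borel_of T)"
proof -
  assume *: "closedin T U"
  then have "topspace T - (topspace T - U) \<in> sets (borel_of T)"
    by (metis openin_borel_of closedin_def sets.compl_sets space_borel_of)
  with * show ?thesis
    by (simp add: closedin_def double_diff)
qed

lemma measurable_borel_ofI: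
  assumes "\<And>x. x \<in> space M \<Longrightarrow> f x \<in> topspace T"
    and "\<And>U. openin T U \<Longrightarrow> f -` U \<inter> space M \<in> sets M"
  shows "f \<in> M \<rightarrow>\<^sub>M borel_of T"
  unfolding borel_of_def by (rule measurable_measure_of) (use assms in \<open>auto dest: openin_subset\<close>)

lemma continuous_map_measurable:
  assumes "continuous_map S T f"
  shows "f \<in> borel_of S \<rightarrow>\<^sub>M borel_of T"
proof (rule measurable_borel_ofI)
  fix U assume "openin T U"
  then have "openin S {x \<in> topspace S. f x \<in> U}"
    using assms by (auto simp: continuous_map_def)
  moreover have "{x \<in> topspace S. f x \<in> U} = f -` U \<inter> space (borel_of S)" by auto
  ultimately show "f -` U \<inter> space (borel_of S) \<in> sets (borel_of S)"
    using openin_borel_of by metis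
qed (use assms in \<open>auto simp: continuous_map_def\<close>)

lemma borel_of_euclidean: "borel_of (euclidean :: 'b :: topological_space topology) = borel"
  by (simp add: borel_of_def borel_def)

lemma continuous_map_borel_measurable:
  fixes f :: "'a \<Rightarrow> real"
  assumes "continuous_map S euclideanreal f"
  shows "f \<in> borel_measurable (borel_of S)"
  using continuous_map_measurable[OF assms] by (simp add: borel_of_euclidean)

text \<open>The equality case of monotonicity of the integral: the recurring device for turning an
  equality of transport costs into a pointwise statement.\<close>

lemma (in prob_space) integral_eq_AE_eq:
  fixes f g :: "'a \<Rightarrow> real"
  assumes "integrable M f" "integrable M g" "AE x in M. f x \<le> g x"
    and "integral\<^sup>L M g \<le> integral\<^sup>L M f"
  shows "AE x in M. f x = g x"
proof -
  have i: "integrable M (\<lambda>x. g x - f x)" using assms by auto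
  have nn: "AE x in M. 0 \<le> g x - f x" using assms(3) by auto
  have "integral\<^sup>L M (\<lambda>x. g x - f x) = 0"
    using assms(1,2,4) integral_nonneg_AE[OF nn] by (simp add: Bochner_Integration.integral_diff)
  then have "AE x in M. g x - f x = 0"
    using integral_nonneg_eq_0_iff_AE[OF i nn] by simp
  then show ?thesis by auto
qed

locale compact_metric = Metric_space Z D for Z :: "'a set" and D :: "'a \<Rightarrow> 'a \<Rightarrow> real" +
  assumes compact: "compact_space mtopology"
begin

abbreviation B :: "'a measure" where "B \<equiv> mborel Z D"
abbreviation B2 :: "('a \<times> 'a) measure" where "B2 \<equiv> borel_of (prod_topology mtopology mtopology)"

lemma space_B [simp]: "space B = Z" by simp

lemma singleton_sets [simp, intro]: "a \<in> Z \<Longrightarrow> {a} \<in> sets B"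
  by (intro closedin_borel_of closedin_Hausdorff_singleton) (auto simp: Hausdorff_space_mtopology)

lemma mball_sets [simp, intro]: "mball a r \<in> sets B"
  by (simp add: openin_borel_of)

lemma finite_sets: "finite A \<Longrightarrow> A \<subseteq> Z \<Longrightarrow> A \<in> sets B"
  by (induction rule: finite_induct) (auto intro: sets.insert_in_sets)

lemma dist_continuous2: "continuous_map (prod_topology mtopology mtopology) euclideanreal (\<lambda>z. D (fst z) (snd z))"
  using continuous_map_mdist[of "prod_topology mtopology mtopology" Self fst snd]
  by (simp add: mtopology_of_def continuous_map_fst continuous_map_snd)

lemma dist_measurable2: "(\<lambda>z. D (fst z) (snd z)) \<in> borel_measurable B2"
  using dist_continuous2 by (rule continuous_map_borel_measurable)

lemma dist_measurable [measurable]: "a \<in> Z \<Longrightarrow> D a \<in> borel_measurable B"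
  by (rule continuous_map_borel_measurable) (use continuous_on_mdist[of _ Self] in \<open>simp add: mtopology_of_def\<close>)

text \<open>Total boundedness gives finite nets of radius \<open>1 / Suc n\<close>; the balls around
  all these net points form the base.\<close>

lemma countable_base:
  obtains \<B> where "countable \<B>" "\<And>V. V \<in> \<B> \<Longrightarrow> openin mtopology V"
    "\<And>U z. openin mtopology U \<Longrightarrow> z \<in> U \<Longrightarrow> \<exists>V\<in>\<B>. z \<in> V \<and> V \<subseteq> U"
proof -
  have "\<exists>K. finite K \<and> K \<subseteq> Z \<and> Z \<subseteq> (\<Union>x\<in>K. mball x (1 / Suc n))" for n
    using compact
    by (simp add: compact_space_eq_mcomplete_mtotally_bounded mtotally_bounded_def)
  then obtain K where K: "\<And>n. finite (K n) \<and> K n \<subseteq> Z \<and> Z \<subseteq> (\<Union>x\<in>K n. mball x (1 / Suc n))"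
    by metis
  define \<B> where "\<B> = (\<Union>n. (\<lambda>x. mball x (1 / Suc n)) ` K n)"
  show thesis
  proof
    show "countable \<B>" unfolding \<B>_def using K by (intro countable_UN countableI_type) (meson countable_finite finite_imageI)
    show "openin mtopology V" if "V \<in> \<B>" for V using that by (auto simp: \<B>_def)
    fix U z assume U: "openin mtopology U" "z \<in> U"
    then obtain r where r: "r > 0" "mball z r \<subseteq> U"
      by (auto simp: openin_mtopology)
    have z: "z \<in> Z" using U openin_subset by fastforce
    obtain n where n: "1 / Suc n < r / 2"
      using r(1) reals_Archimedean[of "r / 2"] by (auto simp: inverse_eq_divide)
    obtain x where x: "x \<in> K n" "z \<in> mball x (1 / Suc n)" using K[of n] z by auto
    have "mball x (1 / Suc n) \<subseteq> mball z r"
    proof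
      fix w assume "w \<in> mball x (1 / Suc n)"
      then have "D x w < r / 2" "D x z < r / 2" "w \<in> Z" "x \<in> Z" using x n by auto
      then show "w \<in> mball z r" using triangle[of z x w] z commute[of z x] by auto
    qed
    then show "\<exists>V\<in>\<B>. z \<in> V \<and> V \<subseteq> U" using x r by (auto simp: \<B>_def)
  qed
qed

text \<open>Couplings live on the Borel sets of the product topology, product measures on the
  product sigma-algebra. By second countability each open set of the product is a countable union of
  open rectangles, and this links the two.\<close>

lemma measurable_Pair_B2:
  assumes f: "f \<in> M \<rightarrow>\<^sub>M B" and g: "g \<in> M \<rightarrow>\<^sub>M B"
  shows "(\<lambda>x. (f x, g x)) \<in> M \<rightarrow>\<^sub>M B2"
proof (rule measurable_borel_ofI)
  fix x assume "x \<in> space M"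
  then show "(f x, g x) \<in> topspace (prod_topology mtopology mtopology)"
    using measurable_space[OF f] measurable_space[OF g] by auto
next
  fix U assume U: "openin (prod_topology mtopology mtopology) U"
  obtain \<B> where \<B>: "countable \<B>" "\<And>V. V \<in> \<B> \<Longrightarrow> openin mtopology V"
    "\<And>U z. openin mtopology U \<Longrightarrow> z \<in> U \<Longrightarrow> \<exists>V\<in>\<B>. z \<in> V \<and> V \<subseteq> U"
    using countable_base by blast
  define R where "R = {(V, W). V \<in> \<B> \<and> W \<in> \<B> \<and> V \<times> W \<subseteq> U}"
  have "countable R" by (rule countable_subset[of _ "\<B> \<times> \<B>"]) (use \<B> in \<open>auto simp: R_def\<close>)
  have sub: "U \<subseteq> (\<Union>(V, W)\<in>R. V \<times> W)"
  proof
    fix u assume u: "u \<in> U"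
    obtain a b where ab: "u = (a, b)" by (cases u)
    obtain V W where "openin mtopology V" "openin mtopology W" "a \<in> V" "b \<in> W" "V \<times> W \<subseteq> U"
      using U[unfolded openin_prod_topology_alt, rule_format, of a b] u ab by auto
    then obtain V' W' where "V' \<in> \<B>" "a \<in> V'" "V' \<subseteq> V" "W' \<in> \<B>" "b \<in> W'" "W' \<subseteq> W"
      using \<B>(3) by metis
    then have "(V', W') \<in> R" "u \<in> V' \<times> W'"
      using \<open>V \<times> W \<subseteq> U\<close> ab by (auto simp: R_def)
    then show "u \<in> (\<Union>(V, W)\<in>R. V \<times> W)" by blast
  qed
  have eq: "(\<lambda>x. (f x, g x)) -` U \<inter> space M = (\<Union>(V, W)\<in>R. (f -` V \<inter> space M) \<inter> (g -` W \<inter> space M))"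
  proof (intro set_eqI iffI)
    fix x assume x: "x \<in> (\<lambda>x. (f x, g x)) -` U \<inter> space M"
    then obtain V W where "(V, W) \<in> R" "f x \<in> V" "g x \<in> W" using sub by fast
    with x show "x \<in> (\<Union>(V, W)\<in>R. (f -` V \<inter> space M) \<inter> (g -` W \<inter> space M))" by auto
  qed (auto simp: R_def)
  show "(\<lambda>x. (f x, g x)) -` U \<inter> space M \<in> sets M"
    unfolding eq
  proof (rule sets.countable_UN'[OF \<open>countable R\<close>], clarsimp)
    show "f -` V \<inter> space M \<inter> (g -` W \<inter> space M) \<in> sets M" if "(V, W) \<in> R" for V W
      using that \<B>(2) f g by (auto simp: R_def intro!: sets.Int measurable_sets openin_borel_of)
  qed
qed

lemma dist_measurable_Pair [measurable (raw)]:
  "f \<in> M \<rightarrow>\<^sub>M B \<Longrightarrow> g \<in> M \<rightarrow>\<^sub>M B \<Longrightarrow> (\<lambda>x. D (f x) (g x)) \<in> borel_measurable M"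
  using measurable_compose[OF measurable_Pair_B2 dist_measurable2] by simp

lemma bounded_dist: obtains K where "K > 0" "\<And>x y. x \<in> Z \<Longrightarrow> y \<in> Z \<Longrightarrow> D x y \<le> K"
proof -
  have "mbounded Z" using compact compactin_imp_mbounded by (auto simp: compact_space_def)
  then obtain K where "\<And>x y. x \<in> Z \<Longrightarrow> y \<in> Z \<Longrightarrow> D x y \<le> K" by (auto simp: mbounded_alt)
  then show thesis using that[of "max 1 K"] by fastforce
qed

end

section \<open>Composition, inverses and continuity of isometries\<close>

lemma is_isometry_comp:
  "is_isometry A c f \<Longrightarrow> is_isometry A c g \<Longrightarrow> is_isometry A c (\<lambda>x. f (g x))"
proof -
  assume f: "is_isometry A c f" and g: "is_isometry A c g"
  then have "g x \<in> A" if "x \<in> A" for x using that by (auto simp: is_isometry_def)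
  with f g show ?thesis by (simp add: is_isometry_def image_image[symmetric, of f g])
qed

context Metric_space
begin

lemma isometry_inj: "is_isometry M d \<phi> \<Longrightarrow> inj_on \<phi> M"
  unfolding is_isometry_def by (intro inj_onI) (metis image_eqI zero)

lemma isometry_inv_into:
  assumes "is_isometry M d \<phi>"
  shows "is_isometry M d (inv_into M \<phi>)"
proof -
  have im: "\<phi> ` M = M" and eq: "\<And>x y. x \<in> M \<Longrightarrow> y \<in> M \<Longrightarrow> d (\<phi> x) (\<phi> y) = d x y"
    using assms by (auto simp: is_isometry_def)
  have "d (inv_into M \<phi> x) (inv_into M \<phi> y) = d x y" if "x \<in> M" "y \<in> M" for x y
    using that eq[of "inv_into M \<phi> x" "inv_into M \<phi> y"] im
    by (simp add: f_inv_into_f inv_into_into)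
  then show ?thesis
    using bij_betw_inv_into[of \<phi> M M] isometry_inj[OF assms] im
    by (simp add: is_isometry_def bij_betw_def)
qed

lemma isometry_continuous:
  assumes "is_isometry M d \<phi>"
  shows "continuous_map mtopology mtopology \<phi>"
  unfolding continuous_map_to_metric
proof (intro strip)
  fix x and e :: real assume "x \<in> topspace mtopology" "0 < e"
  then show "\<exists>U. openin mtopology U \<and> x \<in> U \<and> (\<forall>y\<in>U. \<phi> y \<in> mball (\<phi> x) e)"
    using assms by (intro exI[of _ "mball x e"]) (auto simp: is_isometry_def)
qed

end

section \<open>Wasserstein distances on compact metric spaces\<close>

locale compact_wasserstein = compact_metric +
  fixes p :: real
  assumes p_gt_1: "p > 1"
begin

abbreviation P :: "'a measure set" where "P \<equiv> prob_moment p Z D"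
abbreviation W :: "'a measure \<Rightarrow> 'a measure \<Rightarrow> real" where "W \<equiv> wasserstein p Z D"

lemma integrable_dist_powr:
  assumes "finite_measure M" "f \<in> M \<rightarrow>\<^sub>M B" "g \<in> M \<rightarrow>\<^sub>M B"
  shows "integrable M (\<lambda>x. D (f x) (g x) powr p)"
proof -
  interpret finite_measure M by fact
  obtain K where K: "K > 0" "\<And>x y. x \<in> Z \<Longrightarrow> y \<in> Z \<Longrightarrow> D x y \<le> K" by (rule bounded_dist) blast
  have sp: "f x \<in> Z" "g x \<in> Z" if "x \<in> space M" for x
    using that measurable_space[OF assms(2)] measurable_space[OF assms(3)] by auto
  show ?thesis
  proof (rule integrable_const_bound[where B="K powr p"])
    show "AE x in M. norm (D (f x) (g x) powr p) \<le> K powr p"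
    proof (rule AE_I2)
      fix x assume "x \<in> space M"
      then have "D (f x) (g x) powr p \<le> K powr p"
        using p_gt_1 by (intro powr_mono2 K(2) sp) auto
      then show "norm (D (f x) (g x) powr p) \<le> K powr p" by simp
    qed
    show "(\<lambda>x. D (f x) (g x) powr p) \<in> borel_measurable M"
      by (intro powr_real_measurable dist_measurable_Pair[OF assms(2,3)]) simp
  qed
qed

text \<open>Distances are bounded on a compact space, so the moment condition is automatic; a base
  point exists because the total mass is one.\<close>

lemma P_iff: "\<mu> \<in> P \<longleftrightarrow> prob_space \<mu> \<and> sets \<mu> = sets B"
proof
  assume *: "prob_space \<mu> \<and> sets \<mu> = sets B"
  then interpret prob_space \<mu> by simp
  have sp: "space \<mu> = Z" using * sets_eq_imp_space_eq[of \<mu> B] by simp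
  then obtain z where z: "z \<in> Z" using not_empty by blast
  have "measurable \<mu> B = measurable B B" using * by (intro measurable_cong_sets) auto
  then have "integrable \<mu> (\<lambda>x. D z x powr p)"
    using z finite_measure_axioms by (intro integrable_dist_powr) auto
  then show "\<mu> \<in> P" using * z by (auto simp: prob_moment_def)
qed (auto simp: prob_moment_def)

lemma PD:
  assumes "\<mu> \<in> P"
  shows "prob_space \<mu>" "sets \<mu> = sets B" "space \<mu> = Z" "finite_measure \<mu>"
proof -
  show "prob_space \<mu>" "sets \<mu> = sets B" using assms by (auto simp: P_iff)
  then show "space \<mu> = Z" "finite_measure \<mu>"
    using sets_eq_imp_space_eq[of \<mu> B] prob_space.finite_measure[of \<mu>] by auto
qed

lemma measurable_P [simp]: "\<mu> \<in> P \<Longrightarrow> measurable \<mu> N = measurable B N"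
  by (rule measurable_cong_sets) (simp_all add: PD(2))

lemma distr_P: "prob_space M \<Longrightarrow> f \<in> M \<rightarrow>\<^sub>M B \<Longrightarrow> distr M B f \<in> P"
  unfolding P_iff by (simp add: prob_space.prob_space_distr)

lemma distr_P_id: "\<mu> \<in> P \<Longrightarrow> distr \<mu> B (\<lambda>z. z) = \<mu>"
  by (rule distr_id2) (simp add: PD)

lemma return_P: "a \<in> Z \<Longrightarrow> return B a \<in> P"
  unfolding P_iff by (simp add: prob_space_return)

lemma couplingsD:
  assumes "\<gamma> \<in> couplings Z D \<mu> \<nu>"
  shows "prob_space \<gamma>" "fst \<in> \<gamma> \<rightarrow>\<^sub>M B" "snd \<in> \<gamma> \<rightarrow>\<^sub>M B"
    "distr \<gamma> B fst = \<mu>" "distr \<gamma> B snd = \<nu>"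
proof -
  have s: "sets \<gamma> = sets B2" using assms by (simp add: couplings_def)
  show "fst \<in> \<gamma> \<rightarrow>\<^sub>M B" "snd \<in> \<gamma> \<rightarrow>\<^sub>M B"
    unfolding measurable_cong_sets[OF s refl]
    by (intro continuous_map_measurable continuous_map_fst continuous_map_snd)+
qed (use assms in \<open>auto simp: couplings_def\<close>)

text \<open>Every coupling used for an upper bound arises in this way, as the joint law of two maps
  on an auxiliary probability space.\<close>

lemma coupling_distr:
  assumes M: "prob_space M" and f: "f \<in> M \<rightarrow>\<^sub>M B" and g: "g \<in> M \<rightarrow>\<^sub>M B"
  shows "distr M B2 (\<lambda>x. (f x, g x)) \<in> couplings Z D (distr M B f) (distr M B g)"
proof -
  note m = measurable_Pair_B2[OF f g]
  have "fst \<in> B2 \<rightarrow>\<^sub>M B" "snd \<in> B2 \<rightarrow>\<^sub>M B"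
    by (intro continuous_map_measurable continuous_map_fst continuous_map_snd)+
  then have "distr (distr M B2 (\<lambda>x. (f x, g x))) B fst = distr M B f"
    "distr (distr M B2 (\<lambda>x. (f x, g x))) B snd = distr M B g"
    using m by (simp_all add: distr_distr o_def)
  then show ?thesis
    using prob_space.prob_space_distr[OF M m] by (simp add: couplings_def)
qed

lemma distr_pair_fst_snd:
  assumes \<mu>: "\<mu> \<in> P" and \<nu>: "\<nu> \<in> P"
  shows "distr (\<mu> \<Otimes>\<^sub>M \<nu>) B fst = \<mu>" "distr (\<mu> \<Otimes>\<^sub>M \<nu>) B snd = \<nu>"
proof -
  interpret M: prob_space \<mu> using PD[OF \<mu>] by simp
  interpret N: prob_space \<nu> using PD[OF \<nu>] by simp
  have m: "fst \<in> \<mu> \<Otimes>\<^sub>M \<nu> \<rightarrow>\<^sub>M B" "snd \<in> \<mu> \<Otimes>\<^sub>M \<nu> \<rightarrow>\<^sub>M B"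
    using measurable_fst[of \<mu> \<nu>] measurable_snd[of \<mu> \<nu>] PD(2)[OF \<mu>] PD(2)[OF \<nu>]
    by (auto cong: measurable_cong_sets)
  show "distr (\<mu> \<Otimes>\<^sub>M \<nu>) B fst = \<mu>"
    using N.distr_pair_fst[of \<mu>] PD(2)[OF \<mu>] by (metis distr_cong)
  show "distr (\<mu> \<Otimes>\<^sub>M \<nu>) B snd = \<nu>"
  proof (rule measure_eqI)
    fix A assume "A \<in> sets (distr (\<mu> \<Otimes>\<^sub>M \<nu>) B snd)"
    then have A: "A \<in> sets \<nu>" using PD(2)[OF \<nu>] by simp
    have "snd -` A \<inter> space (\<mu> \<Otimes>\<^sub>M \<nu>) = space \<mu> \<times> A"
      using sets.sets_into_space[OF A] by (auto simp: space_pair_measure)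
    then show "emeasure (distr (\<mu> \<Otimes>\<^sub>M \<nu>) B snd) A = emeasure \<nu> A"
      using A m PD(2)[OF \<nu>] by (simp add: emeasure_distr N.emeasure_pair_measure_Times M.emeasure_space_1)
  qed (simp add: PD(2)[OF \<nu>])
qed

text \<open>These facts replace the infimum of \<open>p\<close>-th roots by bounds on
  \<open>W \<mu> \<nu> powr p\<close>, the form in which costs are estimated later.\<close>

lemma W_nonneg: "\<mu> \<in> P \<Longrightarrow> \<nu> \<in> P \<Longrightarrow> 0 \<le> W \<mu> \<nu>"
  and W_upper_coupling: "\<gamma> \<in> couplings Z D \<mu> \<nu> \<Longrightarrow> W \<mu> \<nu> powr p \<le> (\<integral>z. D (fst z) (snd z) powr p \<partial>\<gamma>)"
  and W_lower: "\<mu> \<in> P \<Longrightarrow> \<nu> \<in> P \<Longrightarrow>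
    (\<And>\<gamma>. \<gamma> \<in> couplings Z D \<mu> \<nu> \<Longrightarrow> C \<le> (\<integral>z. D (fst z) (snd z) powr p \<partial>\<gamma>)) \<Longrightarrow> C \<le> W \<mu> \<nu> powr p"
proof -
  let ?c = "\<lambda>\<gamma>. (\<integral>z. D (fst z) (snd z) powr p \<partial>\<gamma>)"
  have nn: "0 \<le> ?c \<gamma>" for \<gamma> :: "('a \<times> 'a) measure" by (rule integral_nonneg_AE) auto
  have bdd: "bdd_below ((\<lambda>\<gamma>. ?c \<gamma> powr (1 / p)) ` couplings Z D \<mu> \<nu>)" by (rule bdd_belowI2[of _ 0]) auto
  \<comment> \<open>The product measure is a coupling. Nonemptiness is essential, since a real
    infimum over the empty set carries no information.\<close>
  have ne: "couplings Z D \<mu> \<nu> \<noteq> {}" if \<mu>: "\<mu> \<in> P" and \<nu>: "\<nu> \<in> P"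
  proof -
    interpret M: prob_space \<mu> using PD[OF \<mu>] by simp
    interpret N: prob_space \<nu> using PD[OF \<nu>] by simp
    interpret MN: pair_prob_space \<mu> \<nu> ..
    have m: "fst \<in> \<mu> \<Otimes>\<^sub>M \<nu> \<rightarrow>\<^sub>M B" "snd \<in> \<mu> \<Otimes>\<^sub>M \<nu> \<rightarrow>\<^sub>M B"
      using measurable_fst[of \<mu> \<nu>] measurable_snd[of \<mu> \<nu>] PD(2)[OF \<mu>] PD(2)[OF \<nu>]
      by (auto cong: measurable_cong_sets)
    have "distr (\<mu> \<Otimes>\<^sub>M \<nu>) B fst = \<mu>" "distr (\<mu> \<Otimes>\<^sub>M \<nu>) B snd = \<nu>"
      by (rule distr_pair_fst_snd[OF \<mu> \<nu>])+
    then show ?thesis using coupling_distr[OF _ m] MN.prob_space_axioms by auto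
  qed
  show "0 \<le> W \<mu> \<nu>" if "\<mu> \<in> P" "\<nu> \<in> P"
    unfolding wasserstein_def using ne[OF that] by (intro cINF_greatest) auto
  show "W \<mu> \<nu> powr p \<le> ?c \<gamma>" if "\<gamma> \<in> couplings Z D \<mu> \<nu>" 
  proof -
    have "W \<mu> \<nu> \<le> ?c \<gamma> powr (1 / p)" unfolding wasserstein_def by (rule cINF_lower[OF bdd that])
    moreover have "0 \<le> W \<mu> \<nu>" unfolding wasserstein_def using that by (intro cINF_greatest) auto
    ultimately have "W \<mu> \<nu> powr p \<le> (?c \<gamma> powr (1 / p)) powr p"
      using p_gt_1 by (intro powr_mono2) auto
    also have "\<dots> = ?c \<gamma>" using nn[of \<gamma>] p_gt_1 by (simp add: powr_powr)
    finally show ?thesis .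
  qed
  show "C \<le> W \<mu> \<nu> powr p"
    if "\<mu> \<in> P" "\<nu> \<in> P" and C: "\<And>\<gamma>. \<gamma> \<in> couplings Z D \<mu> \<nu> \<Longrightarrow> C \<le> ?c \<gamma>"
  proof (cases "C \<le> 0")
    case True
    then show ?thesis by (meson order_trans powr_ge_zero)
  next
    case False
    have "C powr (1 / p) \<le> W \<mu> \<nu>"
      unfolding wasserstein_def using C False p_gt_1
      by (intro cINF_greatest ne[OF that(1,2)] powr_mono2) auto
    then have "(C powr (1 / p)) powr p \<le> W \<mu> \<nu> powr p"
      using p_gt_1 by (intro powr_mono2) auto
    then show ?thesis using False p_gt_1 by (simp add: powr_powr)
  qed
qed

end

text \<open>Up to sign, the right derivative of the integral of \<open>max 0 (u x - c)\<close> in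
  \<open>c\<close> is the measure of the set where \<open>u x > c\<close>; so these hinge integrals
  determine the law of \<open>u\<close>.\<close>

lemma measure_greater_eqI:
  fixes u :: "'a \<Rightarrow> real"
  assumes M: "finite_measure M" "integrable M u" and N: "finite_measure N" "integrable N u"
    and eq: "\<And>c. (\<integral>x. max 0 (u x - c) \<partial>M) = (\<integral>x. max 0 (u x - c) \<partial>N)"
  shows "measure M {x \<in> space M. u x > c} = measure N {x \<in> space N. u x > c}"
proof -
  \<comment> \<open>Difference quotients of step \<open>1 / Suc n\<close>: a ramp that is
    \<open>0\<close> up to \<open>u x = c\<close> and \<open>1\<close> from
    \<open>u x = c + 1 / Suc n\<close> on.\<close>
  define s where "s n x = real (Suc n) * (max 0 (u x - c) - max 0 (u x - (c + 1 / Suc n)))" for n x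
  have s_alt: "s n x = min 1 (max 0 (real (Suc n) * (u x - c)))" for n x
  proof -
    have "real (Suc n) * (u x - (c + 1 / Suc n)) = real (Suc n) * (u x - c) - 1"
      by (simp add: field_simps del: of_nat_Suc)
    then show ?thesis
      unfolding s_def right_diff_distrib[of _ "max _ _"] max_mult_distrib_left by simp
  qed
  have s_lim: "(\<lambda>n. s n x) \<longlonglongrightarrow> indicator {x. u x > c} x" for x
  proof (cases "u x > c")
    case True
    obtain k where k: "1 / Suc k < u x - c" using True reals_Archimedean[of "u x - c"] by (auto simp: inverse_eq_divide)
    have "s n x = 1" if "n \<ge> k" for n
    proof -
      have "1 / Suc n \<le> 1 / Suc k" using that by (simp add: frac_le)
      then have "1 / Suc n \<le> u x - c" using k by linarith
      then have "1 \<le> real (Suc n) * (u x - c)"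
        using mult_left_mono[of "1 / Suc n" "u x - c" "real (Suc n)"] by (simp del: of_nat_Suc)
      then show ?thesis by (simp add: s_alt)
    qed
    then have "\<forall>\<^sub>F n in sequentially. s n x = 1" by (auto simp: eventually_sequentially)
    then show ?thesis using True by (simp add: tendsto_eventually)
  next
    case False
    then have "s n x = 0" for n by (simp add: s_alt mult_nonneg_nonpos max_absorb1)
    then show ?thesis using False by simp
  qed
  have lim: "(\<lambda>n. \<integral>x. s n x \<partial>L) \<longlonglongrightarrow> measure L {x \<in> space L. u x > c}"
    and int: "(\<integral>x. s n x \<partial>L) = real (Suc n) * ((\<integral>x. max 0 (u x - c) \<partial>L) - (\<integral>x. max 0 (u x - (c + 1 / Suc n)) \<partial>L))"
    if L: "finite_measure L" "integrable L u" for L n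
  proof -
    interpret finite_measure L by fact
    have [measurable]: "u \<in> borel_measurable L" using L by simp
    have i: "integrable L (\<lambda>x. max 0 (u x - c'))" for c' using L by auto
    show "(\<integral>x. s n x \<partial>L) = real (Suc n) * ((\<integral>x. max 0 (u x - c) \<partial>L) - (\<integral>x. max 0 (u x - (c + 1 / Suc n)) \<partial>L))"
      unfolding s_def using i by (simp del: of_nat_Suc)
    have "(\<lambda>n. \<integral>x. s n x \<partial>L) \<longlonglongrightarrow> (\<integral>x. indicator {x. u x > c} x \<partial>L)"
    proof (rule integral_dominated_convergence[where w="\<lambda>_. 1"])
      show "AE x in L. norm (s n x) \<le> 1" for n by (auto simp: s_alt)
      show "s n \<in> borel_measurable L" for n unfolding s_def by measurable
    qed (use s_lim in auto)
    also have "(\<integral>x. indicator {x. u x > c} x \<partial>L) = measure L {x \<in> space L. u x > c}"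
      by (subst Bochner_Integration.integral_indicator) (auto simp: Int_def conj_commute)
    finally show "(\<lambda>n. \<integral>x. s n x \<partial>L) \<longlonglongrightarrow> measure L {x \<in> space L. u x > c}" .
  qed
  show ?thesis
    using lim[OF M] lim[OF N] unfolding int[OF M] int[OF N] eq by (rule LIMSEQ_unique)
qed

section \<open>Costs to Dirac measures and push-forwards under isometries\<close>

context compact_wasserstein
begin

lemma powr_p_cancel:
  assumes "0 \<le> x" "0 \<le> y" "x powr p = y powr p"
  shows "x = y"
proof -
  have "(x powr p) powr (1 / p) = (y powr p) powr (1 / p)" using assms by simp
  then show ?thesis using assms(1,2) p_gt_1 by (simp add: powr_powr)
qed

lemma W_upper:
  assumes "prob_space M" "f \<in> M \<rightarrow>\<^sub>M B" "g \<in> M \<rightarrow>\<^sub>M B"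
  shows "W (distr M B f) (distr M B g) powr p \<le> (\<integral>x. D (f x) (g x) powr p \<partial>M)"
proof -
  have "(\<lambda>z. D (fst z) (snd z) powr p) \<in> borel_measurable B2"
    using dist_measurable2 by measurable
  then show ?thesis
    using W_upper_coupling[OF coupling_distr[OF assms]] measurable_Pair_B2[OF assms(2,3)]
    by (simp add: integral_distr)
qed

lemma couplings_integral_fst:
  fixes f :: "'a \<Rightarrow> real"
  assumes "\<gamma> \<in> couplings Z D \<mu> \<nu>" "f \<in> borel_measurable B"
  shows "(\<integral>z. f (fst z) \<partial>\<gamma>) = (\<integral>x. f x \<partial>\<mu>)"
    and "integrable \<mu> f \<Longrightarrow> integrable \<gamma> (\<lambda>z. f (fst z))"
  using couplingsD[OF assms(1)] assms(2) integral_distr[of fst \<gamma> B f] integrable_distr[of fst \<gamma> B f] by auto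

lemma couplings_integral_snd:
  fixes f :: "'a \<Rightarrow> real"
  assumes "\<gamma> \<in> couplings Z D \<mu> \<nu>" "f \<in> borel_measurable B"
  shows "(\<integral>z. f (snd z) \<partial>\<gamma>) = (\<integral>x. f x \<partial>\<nu>)"
    and "integrable \<nu> f \<Longrightarrow> integrable \<gamma> (\<lambda>z. f (snd z))"
  using couplingsD[OF assms(1)] assms(2) integral_distr[of snd \<gamma> B f] integrable_distr[of snd \<gamma> B f] by auto

lemma couplings_AE_fst:
  assumes "\<gamma> \<in> couplings Z D \<mu> \<nu>" "A \<in> sets B" "AE z in \<mu>. z \<in> A"
  shows "AE z in \<gamma>. fst z \<in> A"
  using assms AE_distr_iff[of fst \<gamma> B "\<lambda>z. z \<in> A"] couplingsD[OF assms(1)] sets.sets_into_space[OF assms(2)]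
  by (auto simp: Int_absorb1 Collect_conj_eq)

lemma integrable_dist_P:
  assumes "\<mu> \<in> P" "a \<in> Z"
  shows "integrable \<mu> (\<lambda>z. D a z powr p)"
  using assms by (intro integrable_dist_powr) (auto simp: PD)

lemma AE_return_iff:
  assumes "a \<in> Z" "A \<in> sets B"
  shows "(AE z in return B a. z \<in> A) \<longleftrightarrow> a \<in> A"
proof (subst AE_return)
  have "{z \<in> space B. z \<in> A} = A" using sets.sets_into_space[OF assms(2)] by auto
  then show "Measurable.pred B (\<lambda>z. z \<in> A)" using assms(2) by (simp add: pred_def)
qed (use assms in auto)

text \<open>The first coordinate of a coupling is almost surely \<open>a\<close> here, so all
  couplings have the same cost.\<close>

lemma W_return:
  assumes a: "a \<in> Z" and \<mu>: "\<mu> \<in> P"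
  shows "W (return B a) \<mu> powr p = (\<integral>z. D a z powr p \<partial>\<mu>)"
proof (rule antisym)
  have [measurable]: "D a \<in> borel_measurable B" using a by measurable
  have "(\<lambda>_. a) \<in> \<mu> \<rightarrow>\<^sub>M B" using a by simp
  moreover have "distr \<mu> B (\<lambda>_. a) = return B a"
    using a PD[OF \<mu>] by (intro measure_eqI) (auto simp: emeasure_distr prob_space.emeasure_space_1 split: split_indicator)
  ultimately show "W (return B a) \<mu> powr p \<le> (\<integral>z. D a z powr p \<partial>\<mu>)"
    using W_upper[of \<mu> "\<lambda>_. a" "\<lambda>z. z"] \<mu> PD[OF \<mu>] by (simp add: distr_P_id)
  show "(\<integral>z. D a z powr p \<partial>\<mu>) \<le> W (return B a) \<mu> powr p"
  proof (rule W_lower[OF return_P[OF a] \<mu>])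
    fix \<gamma> assume \<gamma>: "\<gamma> \<in> couplings Z D (return B a) \<mu>"
    have "AE z in \<gamma>. fst z \<in> {a}"
      using a AE_return_iff[OF a, of "{a}"] by (intro couplings_AE_fst[OF \<gamma>]) blast+
    then have *: "AE z in \<gamma>. D (fst z) (snd z) powr p = D a (snd z) powr p" by auto
    have [measurable]: "snd \<in> \<gamma> \<rightarrow>\<^sub>M B" "fst \<in> \<gamma> \<rightarrow>\<^sub>M B" using couplingsD[OF \<gamma>] by auto
    have "(\<integral>z. D (fst z) (snd z) powr p \<partial>\<gamma>) = (\<integral>z. D a (snd z) powr p \<partial>\<gamma>)"
      by (rule integral_cong_AE[OF _ _ *]) (use a in measurable)
    also have "\<dots> = (\<integral>z. D a z powr p \<partial>\<mu>)"
      by (rule couplings_integral_snd[OF \<gamma>]) measurable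
    finally show "(\<integral>z. D a z powr p \<partial>\<mu>) \<le> (\<integral>z. D (fst z) (snd z) powr p \<partial>\<gamma>)" by simp
  qed
qed

lemma W_return_return:
  assumes "a \<in> Z" "b \<in> Z"
  shows "W (return B a) (return B b) = D a b"
proof -
  have "W (return B a) (return B b) powr p = D a b powr p"
    using assms by (subst W_return) (auto simp: return_P integral_return)
  then show ?thesis
    by (rule powr_p_cancel[OF W_nonneg[OF return_P[OF assms(1)] return_P[OF assms(2)]] nonneg])
qed

text \<open>One inequality suffices: the reverse one follows by applying this to the inverse
  isometry.\<close>

lemma W_isometry:
  assumes iso: "is_isometry Z D \<phi>" and \<mu>: "\<mu> \<in> P" and \<nu>: "\<nu> \<in> P"
  shows "W (distr \<mu> B \<phi>) (distr \<nu> B \<phi>) powr p \<le> W \<mu> \<nu> powr p"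
proof (rule W_lower[OF \<mu> \<nu>])
  fix \<gamma> assume \<gamma>: "\<gamma> \<in> couplings Z D \<mu> \<nu>"
  have \<phi>[measurable]: "\<phi> \<in> B \<rightarrow>\<^sub>M B" by (rule continuous_map_measurable[OF isometry_continuous[OF iso]])
  note g = couplingsD[OF \<gamma>]
  have "W (distr \<gamma> B (\<lambda>z. \<phi> (fst z))) (distr \<gamma> B (\<lambda>z. \<phi> (snd z))) powr p \<le>
      (\<integral>z. D (\<phi> (fst z)) (\<phi> (snd z)) powr p \<partial>\<gamma>)"
    using g by (intro W_upper) auto
  also have "distr \<gamma> B (\<lambda>z. \<phi> (fst z)) = distr \<mu> B \<phi>"
    using distr_distr[OF \<phi> g(2)] g(4) by (simp add: o_def)
  also have "distr \<gamma> B (\<lambda>z. \<phi> (snd z)) = distr \<nu> B \<phi>"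
    using distr_distr[OF \<phi> g(3)] g(5) by (simp add: o_def)
  also have "(\<integral>z. D (\<phi> (fst z)) (\<phi> (snd z)) powr p \<partial>\<gamma>) = (\<integral>z. D (fst z) (snd z) powr p \<partial>\<gamma>)"
    using iso measurable_space[OF g(2)] measurable_space[OF g(3)]
    by (intro Bochner_Integration.integral_cong) (auto simp: is_isometry_def)
  finally show "W (distr \<mu> B \<phi>) (distr \<nu> B \<phi>) powr p \<le> (\<integral>z. D (fst z) (snd z) powr p \<partial>\<gamma>)" .
qed

lemma isometry_measurable: "is_isometry Z D \<phi> \<Longrightarrow> \<phi> \<in> B \<rightarrow>\<^sub>M B"
  by (rule continuous_map_measurable[OF isometry_continuous])

lemma distr_inv_isometry:
  assumes "is_isometry Z D \<phi>" "\<mu> \<in> P"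
  shows "distr (distr \<mu> B \<phi>) B (inv_into Z \<phi>) = \<mu>" "distr (distr \<mu> B (inv_into Z \<phi>)) B \<phi> = \<mu>"
proof -
  note m = isometry_measurable[OF assms(1)] isometry_measurable[OF isometry_inv_into[OF assms(1)]]
  have im: "\<phi> ` Z = Z" using assms by (simp add: is_isometry_def)
  have "distr \<mu> B (\<lambda>z. inv_into Z \<phi> (\<phi> z)) = distr \<mu> B (\<lambda>z. z)"
    "distr \<mu> B (\<lambda>z. \<phi> (inv_into Z \<phi> z)) = distr \<mu> B (\<lambda>z. z)"
    using isometry_inj[OF assms(1)] im PD[OF assms(2)]
    by (auto intro!: distr_cong simp: inv_into_f_f f_inv_into_f)
  then show "distr (distr \<mu> B \<phi>) B (inv_into Z \<phi>) = \<mu>" "distr (distr \<mu> B (inv_into Z \<phi>)) B \<phi> = \<mu>"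
    using m assms(2) by (simp_all add: distr_distr o_def distr_P_id)
qed

lemma isometry_distr:
  assumes iso: "is_isometry Z D \<phi>"
  shows "is_isometry P W (\<lambda>\<mu>. distr \<mu> B \<phi>)"
proof -
  let ?\<psi> = "inv_into Z \<phi>"
  note inv = isometry_inv_into[OF iso]
  note m = isometry_measurable[OF iso] isometry_measurable[OF inv]
  have mem: "distr \<mu> B \<phi> \<in> P" "distr \<mu> B ?\<psi> \<in> P" if "\<mu> \<in> P" for \<mu>
    using that m by (auto intro!: distr_P[OF PD(1)[OF that]])
  have "(\<lambda>\<mu>. distr \<mu> B \<phi>) ` P = P"
    using mem distr_inv_isometry[OF iso] by (auto simp: image_iff) metis
  moreover have "W (distr \<mu> B \<phi>) (distr \<nu> B \<phi>) = W \<mu> \<nu>" if mn: "\<mu> \<in> P" "\<nu> \<in> P" for \<mu> \<nu>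
  proof -
    have "W (distr \<mu> B \<phi>) (distr \<nu> B \<phi>) powr p = W \<mu> \<nu> powr p"
      using W_isometry[OF iso mn] W_isometry[OF inv mem(1)[OF mn(1)] mem(1)[OF mn(2)]]
        distr_inv_isometry[OF iso mn(1)] distr_inv_isometry[OF iso mn(2)] by simp
    then show ?thesis
      by (rule powr_p_cancel[OF W_nonneg[OF mem(1)[OF mn(1)] mem(1)[OF mn(2)]] W_nonneg[OF mn]])
  qed
  ultimately show ?thesis by (simp add: is_isometry_def)
qed

section \<open>Separation of measures by Wasserstein approximation\<close>

text \<open>Optimal couplings are not constructed; the factor \<open>2\<close> leaves room for an
  almost optimal one.\<close>

lemma W_close_coupling:
  assumes "\<mu> \<in> P" "\<nu> \<in> P" "W \<mu> \<nu> \<le> e" "0 < e"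
  obtains \<gamma> where "\<gamma> \<in> couplings Z D \<mu> \<nu>" "(\<integral>z. D (fst z) (snd z) powr p \<partial>\<gamma>) < (2 * e) powr p"
proof (rule ccontr)
  assume "\<not> thesis"
  then have "(2 * e) powr p \<le> W \<mu> \<nu> powr p"
    using that by (intro W_lower assms(1,2)) (meson not_less)
  also have "\<dots> \<le> e powr p" using assms W_nonneg p_gt_1 by (intro powr_mono2) auto
  also have "\<dots> < (2 * e) powr p" using assms(4) p_gt_1 by (intro powr_less_mono2) auto
  finally show False by simp
qed

text \<open>An almost optimal coupling controls the difference of the integrals. The constant comes
  from a pointwise linear bound of the distance by its \<open>p\<close>-th power, which takes the
  place of Hoelder's inequality.\<close>

lemma Lipschitz_integral_close:
  assumes \<mu>: "\<mu> \<in> P" and \<nu>: "\<nu> \<in> P" and "W \<mu> \<nu> \<le> e" "0 < e"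
    and f: "f \<in> borel_measurable B" "\<And>z. z \<in> Z \<Longrightarrow> \<bar>f z\<bar> \<le> K"
    and lip: "\<And>x y. x \<in> Z \<Longrightarrow> y \<in> Z \<Longrightarrow> \<bar>f x - f y\<bar> \<le> L * D x y" and "0 \<le> L"
  shows "\<bar>(\<integral>z. f z \<partial>\<mu>) - (\<integral>z. f z \<partial>\<nu>)\<bar> \<le> L * (1 + 2 powr p) * e"
proof -
  obtain \<gamma> where \<gamma>: "\<gamma> \<in> couplings Z D \<mu> \<nu>" "(\<integral>z. D (fst z) (snd z) powr p \<partial>\<gamma>) < (2 * e) powr p"
    by (rule W_close_coupling[OF assms(1-4)])
  note g = couplingsD[OF \<gamma>(1)]
  interpret prob_space \<gamma> by fact
  note sp = measurable_space[OF g(2)] measurable_space[OF g(3)]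
  have i: "integrable \<tau> f" if "\<tau> \<in> P" for \<tau>
    by (rule finite_measure.integrable_const_bound[OF PD(4)[OF that], where B=K])
      (use f that in \<open>auto simp: PD(3)[OF that]\<close>)
  have i1: "integrable \<gamma> (\<lambda>z. f (fst z))" and i2: "integrable \<gamma> (\<lambda>z. f (snd z))"
    using couplings_integral_fst(2)[OF \<gamma>(1) f(1) i[OF \<mu>]] couplings_integral_snd(2)[OF \<gamma>(1) f(1) i[OF \<nu>]] .
  have iD: "integrable \<gamma> (\<lambda>z. D (fst z) (snd z) powr p)"
    by (intro integrable_dist_powr g finite_measure_axioms)
  \<comment> \<open>Up to the threshold \<open>e\<close> there is nothing to show; above it the
    negative exponent gives \<open>D x y powr (1 - p) \<le> e powr (1 - p)\<close>.\<close>
  have D_le: "D x y \<le> e + e powr (1 - p) * D x y powr p" for x y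
  proof (cases "D x y \<le> e")
    case True
    then show ?thesis by (simp add: add_increasing2)
  next
    case False
    have "D x y = D x y powr (1 - p) * D x y powr p"
      using False \<open>0 < e\<close> by (simp flip: powr_add)
    also have "\<dots> \<le> e powr (1 - p) * D x y powr p"
      using False \<open>0 < e\<close> p_gt_1 by (intro mult_right_mono powr_mono2') auto
    finally show ?thesis using \<open>0 < e\<close> by simp
  qed
  have "\<bar>(\<integral>z. f z \<partial>\<mu>) - (\<integral>z. f z \<partial>\<nu>)\<bar> = \<bar>\<integral>z. f (fst z) - f (snd z) \<partial>\<gamma>\<bar>"
    using couplings_integral_fst(1)[OF \<gamma>(1) f(1)] couplings_integral_snd(1)[OF \<gamma>(1) f(1)] i1 i2 by simp
  also have "\<dots> \<le> (\<integral>z. \<bar>f (fst z) - f (snd z)\<bar> \<partial>\<gamma>)" by (rule integral_abs_bound)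
  also have "\<dots> \<le> (\<integral>z. L * (e + e powr (1 - p) * D (fst z) (snd z) powr p) \<partial>\<gamma>)"
  proof (rule integral_mono)
    fix z assume z: "z \<in> space \<gamma>"
    have "\<bar>f (fst z) - f (snd z)\<bar> \<le> L * D (fst z) (snd z)" using sp[OF z] by (intro lip) auto
    also have "\<dots> \<le> L * (e + e powr (1 - p) * D (fst z) (snd z) powr p)"
      using \<open>0 \<le> L\<close> D_le by (intro mult_left_mono) auto
    finally show "\<bar>f (fst z) - f (snd z)\<bar> \<le> L * (e + e powr (1 - p) * D (fst z) (snd z) powr p)" .
  qed (use i1 i2 iD in auto)
  also have "\<dots> = L * (e + e powr (1 - p) * (\<integral>z. D (fst z) (snd z) powr p \<partial>\<gamma>))"
    using iD by (simp add: prob_space)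
  also have "\<dots> \<le> L * (e + e powr (1 - p) * (2 * e) powr p)"
    using \<gamma>(2) \<open>0 \<le> L\<close> by (intro mult_left_mono add_left_mono) auto
  also have "e powr (1 - p) * (2 * e) powr p = 2 powr p * e"
    using \<open>0 < e\<close> by (simp add: powr_mult powr_diff)
  finally show ?thesis by (simp add: algebra_simps)
qed

lemma Lipschitz_measurable:
  fixes f :: "'a \<Rightarrow> real"
  assumes lip: "\<And>x y. x \<in> Z \<Longrightarrow> y \<in> Z \<Longrightarrow> \<bar>f x - f y\<bar> \<le> L * D x y"
  shows "f \<in> borel_measurable B"
  unfolding borel_measurable_iff_less
proof
  fix a
  have "openin mtopology {z \<in> Z. f z < a}"
    unfolding openin_mtopology
  proof (intro conjI allI impI)
    fix x assume x: "x \<in> {z \<in> Z. f z < a}"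
    \<comment> \<open>The summand \<open>1\<close> keeps the denominator positive whatever
      \<open>L\<close> is.\<close>
    define r where "r = (a - f x) / (\<bar>L\<bar> + 1)"
    have "mball x r \<subseteq> {z \<in> Z. f z < a}"
    proof
      fix y assume y: "y \<in> mball x r"
      have "f y - f x \<le> L * D y x" using lip[of y x] x y by auto
      also have "\<dots> \<le> \<bar>L\<bar> * D x y" by (simp add: commute mult_right_mono)
      also have "\<dots> \<le> (\<bar>L\<bar> + 1) * D x y" by (simp add: algebra_simps)
      also have "\<dots> < (\<bar>L\<bar> + 1) * r" using y by (intro mult_strict_left_mono) auto
      also have "\<dots> = a - f x" by (simp add: r_def add_pos_nonneg)
      finally show "y \<in> {z \<in> Z. f z < a}" using y by auto
    qed
    moreover have "r > 0" using x by (auto simp: r_def)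
    ultimately show "\<exists>r>0. mball x r \<subseteq> {z \<in> Z. f z < a}" by blast
  qed auto
  then show "{w \<in> space B. f w < a} \<in> sets B" by (simp add: openin_borel_of)
qed

text \<open>Serves in place of the triangle inequality and definiteness of \<open>W\<close>. A
  common approximation forces equal integrals of bounded Lipschitz functions, and these determine
  the measures of open sets.\<close>

lemma P_eqI_close:
  assumes \<alpha>: "\<alpha> \<in> P" and \<beta>: "\<beta> \<in> P"
    and close: "\<And>e. 0 < e \<Longrightarrow> \<exists>\<nu>\<in>P. W \<alpha> \<nu> \<le> e \<and> W \<beta> \<nu> \<le> e"
  shows "\<alpha> = \<beta>"
proof -
  have lip_eq: "(\<integral>z. f z \<partial>\<alpha>) = (\<integral>z. f z \<partial>\<beta>)"
    if f: "\<And>z. z \<in> Z \<Longrightarrow> \<bar>f z\<bar> \<le> K" "\<And>x y. x \<in> Z \<Longrightarrow> y \<in> Z \<Longrightarrow> \<bar>f x - f y\<bar> \<le> L * D x y" "0 \<le> L" for f K L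
  proof -
    note fm = Lipschitz_measurable[OF f(2)]
    have b: "\<bar>(\<integral>z. f z \<partial>\<alpha>) - (\<integral>z. f z \<partial>\<beta>)\<bar> \<le> 2 * (L * (1 + 2 powr p)) * e" if e: "e > 0" for e
    proof -
      obtain \<nu> where \<nu>: "\<nu> \<in> P" "W \<alpha> \<nu> \<le> e" "W \<beta> \<nu> \<le> e" using close[OF e] by blast
      have "\<bar>(\<integral>z. f z \<partial>\<tau>) - (\<integral>z. f z \<partial>\<nu>)\<bar> \<le> L * (1 + 2 powr p) * e" if "\<tau> \<in> P" "W \<tau> \<nu> \<le> e" for \<tau>
        by (rule Lipschitz_integral_close[OF that(1) \<nu>(1) that(2) e fm f(1) f(2) f(3)])
      from this[OF \<alpha> \<nu>(2)] this[OF \<beta> \<nu>(3)] show ?thesis by (simp add: abs_le_iff)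
    qed
    define C where "C = 2 * (L * (1 + 2 powr p)) + 1"
    have C: "C > 0" using f(3) by (simp add: C_def add_nonneg_pos)
    have "\<bar>(\<integral>z. f z \<partial>\<alpha>) - (\<integral>z. f z \<partial>\<beta>)\<bar> \<le> e" if "e > 0" for e
    proof -
      have "\<bar>(\<integral>z. f z \<partial>\<alpha>) - (\<integral>z. f z \<partial>\<beta>)\<bar> \<le> (C - 1) * (e / C)"
        using b[of "e / C"] that C by (simp add: C_def)
      also have "\<dots> \<le> C * (e / C)" using that C by (intro mult_right_mono) auto
      finally show ?thesis using C by simp
    qed
    then have "\<bar>(\<integral>z. f z \<partial>\<alpha>) - (\<integral>z. f z \<partial>\<beta>)\<bar> \<le> 0" by (rule field_le_epsilon) simp
    then show ?thesis by simp
  qed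
  have open_eq: "measure \<alpha> U = measure \<beta> U" if U: "openin mtopology U" for U
  proof (cases "U = Z")
    \<comment> \<open>The whole space is treated separately because its complement is empty and has
      no distance function.\<close>
    case True
    then show ?thesis
      using PD(1)[OF \<alpha>] PD(1)[OF \<beta>] prob_space.prob_space[of \<alpha>] prob_space.prob_space[of \<beta>]
      by (simp add: PD(3)[OF \<alpha>] PD(3)[OF \<beta>])
  next
    case False
    have UZ: "U \<subseteq> Z" using U openin_subset by fastforce
    define C where "C = Z - U"
    have C: "C \<noteq> {}" "C \<subseteq> Z" using UZ False by (auto simp: C_def)
    \<comment> \<open>The distance to the complement of \<open>U\<close>; the functions
      \<open>min 1 (real n * \<rho> z)\<close> are Lipschitz and tend to the indicator of
      \<open>U\<close>.\<close>
    define \<rho> where "\<rho> z = (INF c\<in>C. D c z)" for z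
    have bdd: "bdd_below ((\<lambda>c. D c z) ` C)" for z by (rule bdd_belowI2[of _ 0]) auto
    have nn: "0 \<le> \<rho> z" for z unfolding \<rho>_def by (rule cINF_greatest[OF C(1)]) auto
    have le: "\<rho> x \<le> \<rho> y + D x y" if "x \<in> Z" "y \<in> Z" for x y
    proof -
      have "\<rho> x - D x y \<le> D c y" if "c \<in> C" for c
        using cINF_lower[OF bdd that, of x] triangle[of c y x] that C \<open>x \<in> Z\<close> \<open>y \<in> Z\<close> commute[of x y]
        by (auto simp: \<rho>_def)
      then have "\<rho> x - D x y \<le> \<rho> y" unfolding \<rho>_def[of y] by (rule cINF_greatest[OF C(1)])
      then show ?thesis by simp
    qed
    have pos: "\<rho> z > 0" if z: "z \<in> U" for z
    proof -
      obtain r where r: "r > 0" "mball z r \<subseteq> U" using U z by (auto simp: openin_mtopology)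
      have "r \<le> D c z" if "c \<in> C" for c
        using that r z UZ commute[of c z] by (force simp: C_def)
      then have "r \<le> \<rho> z" unfolding \<rho>_def by (rule cINF_greatest[OF C(1)])
      then show ?thesis using r by simp
    qed
    have zero: "\<rho> z = 0" if z: "z \<in> C" for z
      using cINF_lower[OF bdd z, of z] nn[of z] z C by (auto simp: \<rho>_def)
    define f where "f n z = min 1 (real n * \<rho> z)" for n z
    have f_bd: "\<bar>f n z\<bar> \<le> 1" for n z using nn by (simp add: f_def min_def)
    have f_lip: "\<bar>f n x - f n y\<bar> \<le> real n * D x y" if "x \<in> Z" "y \<in> Z" for n x y
    proof -
      have "real n * \<rho> x \<le> real n * \<rho> y + real n * D x y" "real n * \<rho> y \<le> real n * \<rho> x + real n * D x y"
        using le[OF that] le[OF that(2) that(1)] commute[of x y] by (simp_all flip: distrib_left add: mult_left_mono)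
      moreover have "0 \<le> real n * D x y" by simp
      ultimately show ?thesis unfolding f_def by linarith
    qed
    have f_lim: "(\<lambda>n. f n z) \<longlonglongrightarrow> indicator U z" if z: "z \<in> Z" for z
    proof (cases "z \<in> U")
      case True
      obtain k where k: "1 / \<rho> z \<le> real k" using real_arch_simple by blast
      have "f n z = 1" if "n \<ge> k" for n
      proof -
        have "1 / \<rho> z \<le> real n" using k that by linarith
        then show ?thesis using pos[OF True] by (simp add: f_def field_simps)
      qed
      then have "\<forall>\<^sub>F n in sequentially. f n z = 1" by (auto simp: eventually_sequentially)
      then show ?thesis using True by (simp add: tendsto_eventually)
    next
      case False
      then have "f n z = 0" for n using zero[of z] z by (simp add: f_def C_def)
      then show ?thesis using False by simp
    qed
    have lim: "(\<lambda>n. \<integral>z. f n z \<partial>\<tau>) \<longlonglongrightarrow> measure \<tau> U" if \<tau>: "\<tau> \<in> P" for \<tau>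
    proof -
      interpret prob_space \<tau> using PD[OF \<tau>] by simp
      have Us: "U \<in> sets \<tau>" using U PD(2)[OF \<tau>] by (simp add: openin_borel_of)
      have "(\<lambda>n. \<integral>z. f n z \<partial>\<tau>) \<longlonglongrightarrow> (\<integral>z. indicator U z \<partial>\<tau>)"
      proof (rule integral_dominated_convergence[where w="\<lambda>_. 1"])
        show "f n \<in> borel_measurable \<tau>" for n
          using Lipschitz_measurable[OF f_lip] \<tau> by simp
        show "AE z in \<tau>. (\<lambda>n. f n z) \<longlonglongrightarrow> indicator U z"
          by (rule AE_I2) (simp add: f_lim PD(3)[OF \<tau>])
        show "AE z in \<tau>. norm (f n z) \<le> 1" for n using f_bd by simp
      qed (use Us in auto)
      then show ?thesis using Us sets.sets_into_space[OF Us] by (simp add: Int_absorb1)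
    qed
    have "(\<lambda>n. \<integral>z. f n z \<partial>\<alpha>) = (\<lambda>n. \<integral>z. f n z \<partial>\<beta>)"
      using lip_eq[OF f_bd f_lip] by auto
    then show ?thesis using lim[OF \<alpha>] lim[OF \<beta>] LIMSEQ_unique by metis
  qed
  interpret A: prob_space \<alpha> using PD[OF \<alpha>] by simp
  interpret B: prob_space \<beta> using PD[OF \<beta>] by simp
  show ?thesis
  proof (rule measure_eqI_generator_eq[where E="{U. openin mtopology U}" and \<Omega>=Z and A="\<lambda>_. Z"])
    show "Int_stable {U. openin mtopology U}" by (auto simp: Int_stable_def)
    show "{U. openin mtopology U} \<subseteq> Pow Z" using openin_subset by fastforce
    show "emeasure \<alpha> U = emeasure \<beta> U" if "U \<in> {U. openin mtopology U}" for U
      using open_eq that by (simp add: A.emeasure_eq_measure B.emeasure_eq_measure)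
    show "sets \<alpha> = sigma_sets Z {U. openin mtopology U}" "sets \<beta> = sigma_sets Z {U. openin mtopology U}"
      using PD(2)[OF \<alpha>] PD(2)[OF \<beta>] sets_borel_of[of mtopology] by auto
    show "range (\<lambda>_. Z) \<subseteq> {U. openin mtopology U}" using openin_topspace[of mtopology] by auto
  qed (auto simp: A.emeasure_eq_measure)
qed

lemma W_self: "\<mu> \<in> P \<Longrightarrow> W \<mu> \<mu> = 0"
proof -
  assume \<mu>: "\<mu> \<in> P"
  have "W \<mu> \<mu> powr p \<le> (\<integral>z. D z z powr p \<partial>\<mu>)"
    using W_upper[OF PD(1)[OF \<mu>], of "\<lambda>z. z" "\<lambda>z. z"] \<mu> by (simp add: distr_P_id)
  also have "\<dots> = (\<integral>z. 0 \<partial>\<mu>)"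
    by (rule Bochner_Integration.integral_cong) (auto simp: PD(3)[OF \<mu>])
  finally have "W \<mu> \<mu> powr p = 0 powr p" by (simp add: order_antisym)
  then show ?thesis by (rule powr_p_cancel[OF W_nonneg[OF \<mu> \<mu>], rotated]) simp
qed

lemma W_eq_0D:
  assumes "\<mu> \<in> P" "\<nu> \<in> P" "W \<mu> \<nu> = 0"
  shows "\<mu> = \<nu>"
  by (rule P_eqI_close[OF assms(1,2)]) (rule bexI[OF _ assms(2)], use assms(2,3) W_self in simp)

lemma isometry_P_inj: "is_isometry P W \<Phi> \<Longrightarrow> inj_on \<Phi> P"
  unfolding is_isometry_def by (rule inj_onI) (metis W_eq_0D W_self)

lemma isometry_P_inv_into:
  assumes "is_isometry P W \<Phi>"
  shows "is_isometry P W (inv_into P \<Phi>)"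
proof -
  have im: "\<Phi> ` P = P" and eq: "\<And>x y. x \<in> P \<Longrightarrow> y \<in> P \<Longrightarrow> W (\<Phi> x) (\<Phi> y) = W x y"
    using assms by (auto simp: is_isometry_def)
  have "W (inv_into P \<Phi> x) (inv_into P \<Phi> y) = W x y" if "x \<in> P" "y \<in> P" for x y
    using that eq[of "inv_into P \<Phi> x" "inv_into P \<Phi> y"] im
    by (simp add: f_inv_into_f inv_into_into)
  then show ?thesis
    using bij_betw_inv_into[of \<Phi> P P] isometry_P_inj[OF assms] im
    by (simp add: is_isometry_def bij_betw_def)
qed

section \<open>Transport to measures on two points\<close>

text \<open>Sending \<open>z\<close> to \<open>b\<close> exactly where \<open>u z > c\<close>
  minimises the cost when mass at \<open>b\<close> carries the additional price \<open>c\<close>.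
  The resulting bound has the shape of the dual bound in \<open>two_point_lower\<close>.\<close>

lemma two_point_upper:
  fixes c :: real
  assumes a: "a \<in> Z" and b: "b \<in> Z" and \<mu>: "\<mu> \<in> P"
  defines "u \<equiv> \<lambda>z. D a z powr p - D b z powr p"
  defines "m \<equiv> distr \<mu> B (\<lambda>z. if u z > c then b else a)"
  shows "m \<in> P" "AE z in m. z \<in> {a, b}" "a \<noteq> b \<Longrightarrow> measure m {b} = measure \<mu> {z \<in> Z. u z > c}"
    "W m \<mu> powr p \<le> (\<integral>z. D a z powr p \<partial>\<mu>) - (\<integral>z. max 0 (u z - c) \<partial>\<mu>) - c * measure \<mu> {z \<in> Z. u z > c}"
proof -
  interpret prob_space \<mu> using PD[OF \<mu>] by simp
  have [measurable]: "D a \<in> borel_measurable B" "D b \<in> borel_measurable B" using a b by (auto intro: dist_measurable)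
  have um [measurable]: "u \<in> borel_measurable B" unfolding u_def by measurable
  have Us: "{z \<in> Z. u z > c} \<in> sets B" using um by (metis borel_measurable_iff_greater space_B)
  let ?T = "\<lambda>z. if u z > c then b else a"
  have T: "?T \<in> \<mu> \<rightarrow>\<^sub>M B" unfolding measurable_P[OF \<mu>]
    by (rule measurable_If) (use a b Us in auto)
  show mP: "m \<in> P" unfolding m_def by (rule distr_P[OF prob_space_axioms T])
  have ab: "{a, b} \<in> sets B" using a b by (intro finite_sets) auto
  moreover have "{z \<in> space B. z \<in> {a, b}} = {a, b}" using a b by auto
  ultimately have "{z \<in> space B. z \<in> {a, b}} \<in> sets B" by argo
  then show "AE z in m. z \<in> {a, b}"
    unfolding m_def by (subst AE_distr_iff[OF T]) auto
  show "measure m {b} = measure \<mu> {z \<in> Z. u z > c}" if "a \<noteq> b"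
  proof -
    have "?T -` {b} \<inter> space \<mu> = {z \<in> Z. u z > c}" using that PD(3)[OF \<mu>] by (auto split: if_splits)
    then show ?thesis unfolding m_def using T b by (simp add: measure_distr)
  qed
  have i: "integrable \<mu> (\<lambda>z. D a z powr p)" "integrable \<mu> u"
    using integrable_dist_P[OF \<mu> a] integrable_dist_P[OF \<mu> b] by (auto simp: u_def)
  have ind: "integrable \<mu> (\<lambda>z. indicator {z \<in> Z. u z > c} z :: real)"
    using Us PD(2)[OF \<mu>] by (auto simp: less_top[symmetric])
  have "W m \<mu> powr p \<le> (\<integral>z. D (?T z) z powr p \<partial>\<mu>)"
    using W_upper[OF prob_space_axioms T, of "\<lambda>z. z"] \<mu> by (simp add: distr_P_id m_def)
  \<comment> \<open>Where \<open>u z > c\<close>, the cost \<open>D b z powr p\<close> is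
    \<open>D a z powr p - u z\<close>, and the two contributions of \<open>c\<close> cancel.\<close>
  also have "\<dots> = (\<integral>z. D a z powr p - max 0 (u z - c) - c * indicator {z \<in> Z. u z > c} z \<partial>\<mu>)"
    by (rule Bochner_Integration.integral_cong) (auto simp: PD(3)[OF \<mu>] u_def)
  also have "\<dots> = (\<integral>z. D a z powr p \<partial>\<mu>) - (\<integral>z. max 0 (u z - c) \<partial>\<mu>) - c * measure \<mu> {z \<in> Z. u z > c}"
  proof -
    have "{z \<in> Z. u z > c} \<inter> space \<mu> = {z \<in> Z. u z > c}" using PD(3)[OF \<mu>] by auto
    then show ?thesis using i ind by simp
  qed
  finally show "W m \<mu> powr p \<le> (\<integral>z. D a z powr p \<partial>\<mu>) - (\<integral>z. max 0 (u z - c) \<partial>\<mu>) - c * measure \<mu> {z \<in> Z. u z > c}" .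
qed

text \<open>Kantorovich duality with the potentials \<open>c * indicator {b}\<close> and
  \<open>D a z powr p - max 0 (u z - c)\<close>.\<close>
lemma two_point_lower:
  fixes c :: real
  assumes a: "a \<in> Z" and b: "b \<in> Z" and ne: "a \<noteq> b" and \<mu>: "\<mu> \<in> P" and m: "m \<in> P" "AE z in m. z \<in> {a, b}"
  defines "u \<equiv> \<lambda>z. D a z powr p - D b z powr p"
  shows "(\<integral>z. D a z powr p \<partial>\<mu>) - (\<integral>z. max 0 (u z - c) \<partial>\<mu>) - c * measure m {b} \<le> W m \<mu> powr p"
proof (rule W_lower[OF m(1) \<mu>])
  fix \<gamma> assume \<gamma>: "\<gamma> \<in> couplings Z D m \<mu>"
  note g = couplingsD[OF \<gamma>]
  interpret prob_space \<gamma> by fact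
  have [measurable]: "D a \<in> borel_measurable B" "D b \<in> borel_measurable B" using a b by (auto intro: dist_measurable)
  have um [measurable]: "u \<in> borel_measurable B" unfolding u_def by measurable
  have i: "integrable \<mu> (\<lambda>z. D a z powr p)" "integrable \<mu> u"
    using integrable_dist_P[OF \<mu> a] integrable_dist_P[OF \<mu> b] by (auto simp: u_def)
  have i2: "integrable \<mu> (\<lambda>z. max 0 (u z - c))"
  proof -
    interpret M: finite_measure \<mu> using PD[OF \<mu>] by simp
    show ?thesis using i by auto
  qed
  have ig: "integrable \<mu> (\<lambda>z. D a z powr p - max 0 (u z - c))" using i(1) i2 by auto
  have ih: "integrable m (\<lambda>z. c * indicator {b} z :: real)"
    using PD(2)[OF m(1)] b finite_measure.emeasure_finite[OF PD(4)[OF m(1)]] by (auto simp: less_top[symmetric])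
  have mg: "(\<lambda>z. D a z powr p - max 0 (u z - c)) \<in> borel_measurable B"
    and mh: "(\<lambda>z. c * indicator {b} z :: real) \<in> borel_measurable B"
    using b by (auto intro!: borel_measurable_times borel_measurable_indicator)
  have ab: "{a, b} \<in> sets B" using a b by (intro finite_sets) auto
  \<comment> \<open>The potentials are admissible: for mass coming from \<open>a\<close> it is
    enough that the hinge term is nonnegative, for mass from \<open>b\<close> that it is at least
    \<open>u (snd z) - c\<close>.\<close>
  have ge: "AE z in \<gamma>. (D a (snd z) powr p - max 0 (u (snd z) - c)) - c * indicator {b} (fst z) \<le> D (fst z) (snd z) powr p"
    using couplings_AE_fst[OF \<gamma> ab m(2)] by eventually_elim (use ne in \<open>auto simp: u_def\<close>)
  have "(\<integral>z. D a z powr p \<partial>\<mu>) - (\<integral>z. max 0 (u z - c) \<partial>\<mu>) - c * measure m {b}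
    = (\<integral>z. D a z powr p - max 0 (u z - c) \<partial>\<mu>) - (\<integral>z. c * indicator {b} z \<partial>m)"
    using i(1) i2 PD(3)[OF m(1)] b by simp
  also have "\<dots> = (\<integral>z. (D a (snd z) powr p - max 0 (u (snd z) - c)) - c * indicator {b} (fst z) \<partial>\<gamma>)"
    using couplings_integral_snd(2)[OF \<gamma> mg ig] couplings_integral_fst(2)[OF \<gamma> mh ih]
    by (simp only: Bochner_Integration.integral_diff couplings_integral_snd(1)[OF \<gamma> mg] couplings_integral_fst(1)[OF \<gamma> mh])
  also have "\<dots> \<le> (\<integral>z. D (fst z) (snd z) powr p \<partial>\<gamma>)"
    by (rule integral_mono_AE[OF Bochner_Integration.integrable_diff[OF
          couplings_integral_snd(2)[OF \<gamma> mg ig] couplings_integral_fst(2)[OF \<gamma> mh ih]]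
          integrable_dist_powr[OF finite_measure_axioms g(2,3)] ge])
  finally show "(\<integral>z. D a z powr p \<partial>\<mu>) - (\<integral>z. max 0 (u z - c) \<partial>\<mu>) - c * measure m {b} \<le> (\<integral>z. D (fst z) (snd z) powr p \<partial>\<gamma>)" .
qed

text \<open>The upper bound for one measure and the dual lower bound for the other are taken at the
  same \<open>m\<close>, so the terms with the factor \<open>c\<close> cancel. By symmetry the hinge
  integrals of the cost difference agree, and with them its tails.\<close>

lemma two_point_level_sets:
  fixes c :: real
  assumes a: "a \<in> Z" and b: "b \<in> Z" and \<alpha>: "\<alpha> \<in> P" and \<beta>: "\<beta> \<in> P"
    and W_eq: "\<And>m. m \<in> P \<Longrightarrow> AE z in m. z \<in> {a, b} \<Longrightarrow> W m \<alpha> = W m \<beta>"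
  shows "measure \<alpha> {z \<in> Z. D a z powr p - D b z powr p > c} = measure \<beta> {z \<in> Z. D a z powr p - D b z powr p > c}"
proof (cases "a = b")
  \<comment> \<open>Here the cost difference vanishes, so the set is all of \<open>Z\<close> or
    empty according to the sign of \<open>c\<close>.\<close>
  case True
  then show ?thesis
    using PD(1)[OF \<alpha>] PD(1)[OF \<beta>] prob_space.prob_space[of \<alpha>] prob_space.prob_space[of \<beta>]
    by (cases "c < 0") (simp_all add: PD(3)[OF \<alpha>] PD(3)[OF \<beta>])
next
  case False
  define u where "u z = D a z powr p - D b z powr p" for z
  have ra: "AE z in return B a. z \<in> {a, b}"
    using AE_return_iff[OF a finite_sets[of "{a, b}"]] a b by simp
  have int_a: "(\<integral>z. D a z powr p \<partial>\<alpha>) = (\<integral>z. D a z powr p \<partial>\<beta>)"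
    using W_eq[OF return_P[OF a] ra] W_return[OF a \<alpha>] W_return[OF a \<beta>] by simp
  have le: "(\<integral>z. max 0 (u z - c) \<partial>\<mu>) \<le> (\<integral>z. max 0 (u z - c) \<partial>\<nu>)"
    if "\<mu> \<in> P" "\<nu> \<in> P" and eq: "\<And>m. m \<in> P \<Longrightarrow> AE z in m. z \<in> {a, b} \<Longrightarrow> W m \<mu> = W m \<nu>"
      "(\<integral>z. D a z powr p \<partial>\<mu>) = (\<integral>z. D a z powr p \<partial>\<nu>)" for \<mu> \<nu> c
  proof -
    \<comment> \<open>\<open>m\<close> is adapted to \<open>\<mu>\<close>; for \<open>\<nu>\<close>
      only the lower bound is applied to it.\<close>
    define m where "m = distr \<mu> B (\<lambda>z. if u z > c then b else a)"
    note up = two_point_upper[OF a b that(1), of c, folded u_def m_def]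
    show ?thesis
      using up(3)[OF False] up(4) two_point_lower[OF a b False that(2) up(1,2), of c, folded u_def] eq(1)[OF up(1,2)] eq(2)
      by simp
  qed
  have "(\<integral>z. max 0 (u z - c) \<partial>\<alpha>) = (\<integral>z. max 0 (u z - c) \<partial>\<beta>)" for c
    using W_eq int_a by (intro antisym le \<alpha> \<beta>) (simp_all)
  moreover have "integrable \<mu> u" if "\<mu> \<in> P" for \<mu>
    unfolding u_def using integrable_dist_P[OF that a] integrable_dist_P[OF that b] by auto
  ultimately have "measure \<alpha> {z \<in> space \<alpha>. u z > c} = measure \<beta> {z \<in> space \<beta>. u z > c}"
    using \<alpha> \<beta> by (intro measure_greater_eqI PD) auto
  then show ?thesis by (simp add: PD(3)[OF \<alpha>] PD(3)[OF \<beta>] u_def)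
qed

section \<open>Dirac measures and finitely supported measures\<close>

lemma measure_eq_1_iff: "\<mu> \<in> P \<Longrightarrow> A \<in> sets B \<Longrightarrow> measure \<mu> A = 1 \<longleftrightarrow> (AE z in \<mu>. z \<in> A)"
  using prob_space.prob_eq_1[of \<mu> A] PD(1,2)[of \<mu>] by simp

lemma finite_support_eqI:
  assumes \<alpha>: "\<alpha> \<in> P" "AE z in \<alpha>. z \<in> A" and \<beta>: "\<beta> \<in> P" "AE z in \<beta>. z \<in> A"
    and A: "finite A" "A \<subseteq> Z" and eq: "\<And>w. w \<in> A \<Longrightarrow> measure \<alpha> {w} = measure \<beta> {w}"
  shows "\<alpha> = \<beta>"
proof (rule measure_eqI)
  show "sets \<alpha> = sets \<beta>" using PD(2)[OF \<alpha>(1)] PD(2)[OF \<beta>(1)] by simp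
  fix E assume "E \<in> sets \<alpha>"
  then have E: "E \<in> sets B" using PD(2)[OF \<alpha>(1)] by simp
  have *: "measure \<mu> E = (\<Sum>w\<in>E \<inter> A. measure \<mu> {w})" if \<mu>: "\<mu> \<in> P" "AE z in \<mu>. z \<in> A" for \<mu>
  proof -
    interpret prob_space \<mu> using PD[OF \<mu>(1)] by simp
    have "measure \<mu> E = measure \<mu> (E \<inter> A)"
      using \<mu>(2) E finite_sets[OF A] PD(2)[OF \<mu>(1)] by (intro finite_measure_eq_AE) auto
    also have "\<dots> = (\<Sum>w\<in>E \<inter> A. measure \<mu> {w})"
      using A PD(2)[OF \<mu>(1)] by (intro finite_measure_eq_sum_singleton) auto
    finally show ?thesis .
  qed
  have "measure \<alpha> E = measure \<beta> E" unfolding *[OF \<alpha>] *[OF \<beta>] using eq by simp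
  then show "emeasure \<alpha> E = emeasure \<beta> E"
    using PD(4)[OF \<alpha>(1)] PD(4)[OF \<beta>(1)] by (simp add: finite_measure.emeasure_eq_measure)
qed

lemma eq_returnI:
  assumes "a \<in> Z" "\<mu> \<in> P" "AE z in \<mu>. z = a"
  shows "\<mu> = return B a"
proof (rule finite_support_eqI[where A="{a}"])
  have r: "AE z in return B a. z \<in> {a}" using AE_return_iff[of a "{a}"] assms(1) by blast
  then show "AE z in return B a. z \<in> {a}" .
  show "measure \<mu> {w} = measure (return B a) {w}" if "w \<in> {a}" for w
  proof -
    have "measure \<mu> {a} = 1" "measure (return B a) {a} = 1"
      using assms r return_P by (subst measure_eq_1_iff; auto)+
    then show ?thesis using that by simp
  qed
qed (use assms return_P in auto)

text \<open>By compactness some point \<open>a\<close> has no open neighbourhood of measure zero;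
  all balls around \<open>a\<close> then have full measure.\<close>

lemma zero_one_imp_return:
  assumes m: "m \<in> P" and zo: "\<And>U. openin mtopology U \<Longrightarrow> measure m U = 0 \<or> measure m U = 1"
  obtains a where "a \<in> Z" "m = return B a"
proof -
  interpret prob_space m using PD[OF m] by simp
  have "\<exists>a\<in>Z. \<forall>U. openin mtopology U \<longrightarrow> a \<in> U \<longrightarrow> measure m U \<noteq> 0"
  proof (rule ccontr)
    assume "\<not> ?thesis"
    then have cov: "Z \<subseteq> \<Union>{U. openin mtopology U \<and> measure m U = 0}" by auto
    obtain \<F> where \<F>: "finite \<F>" "\<F> \<subseteq> {U. openin mtopology U \<and> measure m U = 0}" "Z \<subseteq> \<Union>\<F>"
      using compact cov unfolding compact_space_def compactin_def
      by (metis (mono_tags, lifting) mem_Collect_eq topspace_mtopology)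
    have "measure m Z \<le> measure m (\<Union>\<F>)"
      using \<F> PD(2)[OF m] by (intro finite_measure_mono sets.finite_Union) (auto intro: openin_borel_of)
    also have "\<dots> \<le> (\<Sum>U\<in>\<F>. measure m U)"
      using \<F> PD(2)[OF m] measure_UNION_le[of \<F> "\<lambda>U. U" m] by (auto intro: openin_borel_of)
    also have "\<dots> = 0" using \<F>(2) by (intro sum.neutral) auto
    finally show False using prob_space PD(3)[OF m] by simp
  qed
  then obtain a where a: "a \<in> Z" "\<And>U. openin mtopology U \<Longrightarrow> a \<in> U \<Longrightarrow> measure m U \<noteq> 0" by blast
  have "AE z in m. z \<in> mball a (1 / Suc n)" for n
    using a(2)[of "mball a (1 / Suc n)"] zo[of "mball a (1 / Suc n)"] a(1)
      measure_eq_1_iff[OF m mball_sets, of a "1 / Suc n"] by auto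
  then have "AE z in m. \<forall>n. z \<in> mball a (1 / Suc n)" unfolding AE_all_countable by blast
  then have "AE z in m. z = a"
  proof eventually_elim
    case (elim z)
    show "z = a"
    proof (rule ccontr)
      assume "z \<noteq> a"
      then have "0 < D a z" using elim a(1) by (auto simp: in_mball)
      then obtain n where "1 / Suc n < D a z" using reals_Archimedean by (auto simp: inverse_eq_divide)
      then show False using elim by (auto simp: in_mball dest!: spec[of _ n])
    qed
  qed
  then show thesis using that a(1) eq_returnI[OF a(1) m] by blast
qed

text \<open>A measurable substitute for the nearest-point map, built by induction: adding
  \<open>x\<close> to \<open>A\<close> redirects the points of one ball to \<open>x\<close>.\<close>

lemma finite_valued_approx:
  assumes "finite A" "A \<noteq> {}" "A \<subseteq> Z"
  shows "\<exists>T. T \<in> B \<rightarrow>\<^sub>M B \<and> (\<forall>z. T z \<in> A) \<and> (\<forall>z\<in>Z. \<forall>w\<in>A. D w z < e \<longrightarrow> D (T z) z < e)"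
  using assms
proof (induction rule: finite_ne_induct)
  case (singleton x)
  then show ?case by (intro exI[of _ "\<lambda>_. x"]) auto
next
  case (insert x A)
  then obtain T where T: "T \<in> B \<rightarrow>\<^sub>M B" "\<forall>z. T z \<in> A" "\<forall>z\<in>Z. \<forall>w\<in>A. D w z < e \<longrightarrow> D (T z) z < e"
    by auto
  let ?T = "\<lambda>z. if z \<in> mball x e then x else T z"
  have "mball x e \<inter> Z = mball x e" by auto
  then have "?T \<in> B \<rightarrow>\<^sub>M B"
    using T(1) insert.prems by (intro measurable_If_set) auto
  moreover have "\<forall>z. ?T z \<in> insert x A" using T(2) by simp
  moreover have "\<forall>z\<in>Z. \<forall>w\<in>insert x A. D w z < e \<longrightarrow> D (?T z) z < e"
    using T(3) insert.prems by auto
  ultimately show ?case by blast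
qed

text \<open>Push \<open>\<mu>\<close> forward to a finite net whose points have been moved into the
  dense set \<open>G\<close>.\<close>

lemma finite_support_approx:
  assumes \<mu>: "\<mu> \<in> P" and G: "G \<subseteq> Z" "\<And>z e. z \<in> Z \<Longrightarrow> 0 < e \<Longrightarrow> \<exists>w\<in>G. D w z < e" and e: "0 < e"
  obtains \<nu> A where "\<nu> \<in> P" "finite A" "A \<subseteq> G" "AE z in \<nu>. z \<in> A" "W \<mu> \<nu> \<le> e"
proof -
  interpret prob_space \<mu> using PD[OF \<mu>] by simp
  have "Z \<noteq> {}" using not_empty PD(3)[OF \<mu>] by simp
  \<comment> \<open>One half of \<open>e\<close> is spent on the net, the other on moving its points
    into \<open>G\<close>.\<close>
  obtain K where K: "finite K" "K \<subseteq> Z" "Z \<subseteq> (\<Union>x\<in>K. mball x (e / 2))"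
    using compact e unfolding compact_space_eq_mcomplete_mtotally_bounded mtotally_bounded_def
    by (meson half_gt_zero)
  obtain w where w: "\<And>x. x \<in> K \<Longrightarrow> w x \<in> G \<and> D (w x) x < e / 2"
    using G(2)[of _ "e / 2"] K(2) e by (metis half_gt_zero subsetD)
  define A where "A = w ` K"
  have A: "finite A" "A \<subseteq> G" "A \<noteq> {}" using K w \<open>Z \<noteq> {}\<close> by (auto simp: A_def)
  have AZ: "A \<subseteq> Z" using A G by auto
  have near: "\<exists>v\<in>A. D v z < e" if z: "z \<in> Z" for z
  proof -
    obtain x where x: "x \<in> K" "z \<in> mball x (e / 2)" using K z by blast
    have "D (w x) z \<le> D (w x) x + D x z" using x w K z G by (intro triangle) auto
    also have "\<dots> < e" using w[OF x(1)] x(2) by simp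
    finally show ?thesis using x by (auto simp: A_def)
  qed
  obtain T where T: "T \<in> B \<rightarrow>\<^sub>M B" "\<And>z. T z \<in> A" "\<And>z v. z \<in> Z \<Longrightarrow> v \<in> A \<Longrightarrow> D v z < e \<Longrightarrow> D (T z) z < e"
    using finite_valued_approx[OF A(1,3) AZ, of e] by blast
  have T': "T \<in> \<mu> \<rightarrow>\<^sub>M B" using T(1) \<mu> by simp
  let ?\<nu> = "distr \<mu> B T"
  have \<nu>: "?\<nu> \<in> P" by (rule distr_P[OF prob_space_axioms T'])
  have "{z \<in> space B. z \<in> A} = A" using AZ by auto
  then have "AE z in ?\<nu>. z \<in> A"
    using finite_sets[OF A(1) AZ] T(2) by (subst AE_distr_iff[OF T']) auto
  moreover have "W \<mu> ?\<nu> \<le> e"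
  proof -
    have "W \<mu> ?\<nu> powr p \<le> (\<integral>z. D z (T z) powr p \<partial>\<mu>)"
      using W_upper[OF prob_space_axioms _ T', of "\<lambda>z. z"] \<mu> by (simp add: distr_P_id)
    also have "\<dots> \<le> (\<integral>z. e powr p \<partial>\<mu>)"
    proof (rule integral_mono)
      show "integrable \<mu> (\<lambda>z. D z (T z) powr p)"
        using T' \<mu> by (intro integrable_dist_powr finite_measure_axioms) auto
      fix z assume "z \<in> space \<mu>"
      then have z: "z \<in> Z" using PD(3)[OF \<mu>] by simp
      then have "D z (T z) < e" using T(3) near commute by metis
      then show "D z (T z) powr p \<le> e powr p" using p_gt_1 by (intro powr_mono2) auto
    qed simp
    also have "\<dots> = e powr p" by (simp add: prob_space)
    finally have "W \<mu> ?\<nu> powr p \<le> e powr p" .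
    then show ?thesis using powr_less_mono2[of p e "W \<mu> ?\<nu>"] p_gt_1 e by fastforce
  qed
  ultimately show thesis using that \<nu> A by blast
qed

lemma distr_eqI_greater:
  fixes u :: "'a \<Rightarrow> real"
  assumes \<alpha>: "\<alpha> \<in> P" and \<beta>: "\<beta> \<in> P" and u: "u \<in> borel_measurable B"
    and eq: "\<And>c. measure \<alpha> {z \<in> Z. u z > c} = measure \<beta> {z \<in> Z. u z > c}"
  shows "distr \<alpha> borel u = distr \<beta> borel u"
proof (rule cdf_unique)
  have rd: "real_distribution (distr \<mu> borel u)" if \<mu>: "\<mu> \<in> P" for \<mu>
    using prob_space.prob_space_distr[OF PD(1)[OF \<mu>], of u borel] u \<mu>
    by (simp add: real_distribution_def real_distribution_axioms_def)
  then show "real_distribution (distr \<alpha> borel u)" "real_distribution (distr \<beta> borel u)" using \<alpha> \<beta> by auto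
  have "cdf (distr \<mu> borel u) c = 1 - measure \<mu> {z \<in> Z. u z > c}" if \<mu>: "\<mu> \<in> P" for \<mu> c
  proof -
    interpret prob_space \<mu> using PD[OF \<mu>] by simp
    have s: "{z \<in> Z. u z > c} \<in> sets \<mu>"
      using u PD(2)[OF \<mu>] by (metis borel_measurable_iff_greater space_B)
    have "u -` {..c} \<inter> space \<mu> = space \<mu> - {z \<in> Z. u z > c}" using PD(3)[OF \<mu>] by auto
    then show ?thesis using u \<mu> s by (simp add: cdf_def measure_distr prob_compl)
  qed
  then show "cdf (distr \<alpha> borel u) = cdf (distr \<beta> borel u)" using \<alpha> \<beta> eq by auto
qed

lemma measure_two_points:
  assumes \<mu>: "\<mu> \<in> P" "AE v in \<mu>. v \<in> {a, b}" and ab: "a \<in> Z" "b \<in> Z" "a \<noteq> b"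
  shows "measure \<mu> {b} = 1 - measure \<mu> {a}"
proof -
  interpret prob_space \<mu> using PD[OF \<mu>(1)] by simp
  have "measure \<mu> ({a} \<union> {b}) = measure \<mu> {a} + measure \<mu> {b}"
    using ab PD(2)[OF \<mu>(1)] by (intro finite_measure_Union) auto
  moreover have "measure \<mu> {a, b} = 1" using measure_eq_1_iff[OF \<mu>(1) finite_sets[of "{a, b}"]] \<mu>(2) ab by simp
  ultimately show ?thesis by (simp add: insert_commute)
qed

text \<open>However \<open>m\<close> distributes its mass on \<open>A\<close>, no mass reaches
  \<open>z\<close> from nearer than the nearest point of \<open>A\<close>.\<close>

lemma W_finite_support_lower:
  assumes m: "m \<in> P" "AE z in m. z \<in> A" and A: "finite A" "A \<noteq> {}" "A \<subseteq> Z" and \<mu>: "\<mu> \<in> P"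
  defines "\<rho> \<equiv> \<lambda>z. MIN w\<in>A. D w z"
  shows "integrable \<mu> (\<lambda>z. \<rho> z powr p)" "(\<integral>z. \<rho> z powr p \<partial>\<mu>) \<le> W m \<mu> powr p"
proof -
  obtain a where a: "a \<in> A" "a \<in> Z" using A by auto
  have le: "\<rho> z \<le> D w z" if "w \<in> A" for w z unfolding \<rho>_def using A that by (intro Min_le) auto
  have nn: "0 \<le> \<rho> z" for z unfolding \<rho>_def using A by (subst Min_ge_iff) auto
  have \<rho>: "\<rho> \<in> borel_measurable B"
    unfolding \<rho>_def using A dist_measurable by (intro borel_measurable_Min) auto
  then have \<rho>p: "(\<lambda>z. \<rho> z powr p) \<in> borel_measurable B" by measurable
  show i: "integrable \<mu> (\<lambda>z. \<rho> z powr p)"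
  proof (rule Bochner_Integration.integrable_bound[OF integrable_dist_P[OF \<mu> a(2)]])
    show "(\<lambda>z. \<rho> z powr p) \<in> borel_measurable \<mu>" using \<rho>p \<mu> by simp
    show "AE z in \<mu>. norm (\<rho> z powr p) \<le> norm (D a z powr p)"
      using le[OF a(1)] nn p_gt_1 by (intro AE_I2) (auto intro!: powr_mono2)
  qed
  show "(\<integral>z. \<rho> z powr p \<partial>\<mu>) \<le> W m \<mu> powr p"
  proof (rule W_lower[OF m(1) \<mu>])
    fix \<gamma> assume \<gamma>: "\<gamma> \<in> couplings Z D m \<mu>"
    note g = couplingsD[OF \<gamma>]
    have "AE z in \<gamma>. \<rho> (snd z) powr p \<le> D (fst z) (snd z) powr p"
      using couplings_AE_fst[OF \<gamma> finite_sets[OF A(1,3)] m(2)]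
      by eventually_elim (use le nn p_gt_1 in \<open>auto intro!: powr_mono2\<close>)
    then have "(\<integral>z. \<rho> (snd z) powr p \<partial>\<gamma>) \<le> (\<integral>z. D (fst z) (snd z) powr p \<partial>\<gamma>)"
      using couplings_integral_snd(2)[OF \<gamma> \<rho>p i] prob_space.finite_measure[OF g(1)] g
      by (intro integral_mono_AE integrable_dist_powr)
    then show "(\<integral>z. \<rho> z powr p \<partial>\<mu>) \<le> (\<integral>z. D (fst z) (snd z) powr p \<partial>\<gamma>)"
      using couplings_integral_snd(1)[OF \<gamma> \<rho>p] by simp
  qed
qed

lemma measurable_finite_exception:
  assumes "finite G" "G \<subseteq> Z" "a \<in> Z" "\<And>z. z \<in> G \<Longrightarrow> f z \<in> Z"
  shows "(\<lambda>z. if z \<in> G then f z else a) \<in> B \<rightarrow>\<^sub>M B"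
proof (rule measurable_borel_ofI)
  fix U assume "openin mtopology U"
  have "(\<lambda>z. if z \<in> G then f z else a) -` U \<inter> space B = {z \<in> G. f z \<in> U} \<union> (if a \<in> U then Z - G else {})"
    using assms by (auto split: if_splits)
  moreover have "{z \<in> G. f z \<in> U} \<in> sets B" using assms by (intro finite_sets) auto
  moreover have "Z - G \<in> sets B" using finite_sets[OF assms(1,2)] sets.top[of B] by auto
  ultimately show "(\<lambda>z. if z \<in> G then f z else a) -` U \<inter> space B \<in> sets B" by auto
qed (use assms in auto)

text \<open>The two one-sided families are what bisectors with \<open>N\<close> and with
  \<open>S\<close> provide later. Each singleton is the difference of two consecutive level sets of
  one family, chosen by the sign of \<open>R w\<close>.\<close>

lemma eqI_injective_levels:
  fixes R :: "'a \<Rightarrow> real"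
  assumes \<alpha>: "\<alpha> \<in> P" "AE z in \<alpha>. z \<in> G" and \<beta>: "\<beta> \<in> P" "AE z in \<beta>. z \<in> G"
    and G: "finite G" "G \<subseteq> Z" "inj_on R G"
    and less: "\<And>c. 0 \<le> c \<Longrightarrow> measure \<alpha> {z \<in> G. R z < c} = measure \<beta> {z \<in> G. R z < c}"
    and greater: "\<And>c. c \<le> 0 \<Longrightarrow> measure \<alpha> {z \<in> G. R z > c} = measure \<beta> {z \<in> G. R z > c}"
  shows "\<alpha> = \<beta>"
proof (rule finite_support_eqI[OF \<alpha> \<beta> G(1,2)])
  fix w assume w: "w \<in> G"
  have sets: "H \<in> sets B" if "H \<subseteq> G" for H using that G by (intro finite_sets) (auto intro: finite_subset)
  have eqw: "z = w" if "z \<in> G" "R z = R w" for z using inj_onD[OF G(3)] that w by blast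
  have diff: "measure \<mu> (H - K) = measure \<mu> H - measure \<mu> K" if "\<mu> \<in> P" "K \<subseteq> H" "H \<subseteq> G" for \<mu> H K
    using that PD(2)[OF that(1)] sets by (intro finite_measure.finite_measure_Diff PD(4)) auto
  show "measure \<alpha> {w} = measure \<beta> {w}"
  proof (cases "0 \<le> R w")
    case True
    \<comment> \<open>The smallest value of \<open>R\<close> above \<open>R w\<close>, capped at
      \<open>R w + 1\<close> so that the minimum exists. No value of \<open>R\<close> on
      \<open>G\<close> lies strictly between \<open>R w\<close> and \<open>c\<close>.\<close>
    define c where "c = Min (insert (R w + 1) (R ` {z \<in> G. R w < R z}))"
    have c: "R w < c" unfolding c_def using G(1) by (subst Min_gr_iff) auto
    have c_le: "c \<le> R z" if "z \<in> G" "R w < R z" for z unfolding c_def using G(1) that by (intro Min_le) auto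
    have e: "{w} = {z \<in> G. R z < c} - {z \<in> G. R z < R w}"
    proof (intro set_eqI iffI)
      fix z assume z: "z \<in> {z \<in> G. R z < c} - {z \<in> G. R z < R w}"
      then have "R z = R w" using c_le[of z] by force
      then show "z \<in> {w}" using z eqw by auto
    qed (use w c in auto)
    have "measure \<mu> {w} = measure \<mu> {z \<in> G. R z < c} - measure \<mu> {z \<in> G. R z < R w}" if "\<mu> \<in> P" for \<mu>
      unfolding e by (rule diff[OF that]) (use c in auto)
    from this[OF \<alpha>(1)] this[OF \<beta>(1)] show ?thesis
      using less[of c] less[of "R w"] c True by simp
  next
    case False
    \<comment> \<open>The mirror image from below. Both \<open>c\<close> and \<open>R w\<close> are
      negative here, as \<open>greater\<close> requires.\<close>
    define c where "c = Max (insert (R w - 1) (R ` {z \<in> G. R z < R w}))"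
    have c: "c < R w" unfolding c_def using G(1) by (subst Max_less_iff) auto
    have c_le: "R z \<le> c" if "z \<in> G" "R z < R w" for z unfolding c_def using G(1) that by (intro Max_ge) auto
    have e: "{w} = {z \<in> G. R z > c} - {z \<in> G. R z > R w}"
    proof (intro set_eqI iffI)
      fix z assume z: "z \<in> {z \<in> G. R z > c} - {z \<in> G. R z > R w}"
      then have "R z = R w" using c_le[of z] by force
      then show "z \<in> {w}" using z eqw by auto
    qed (use w c in auto)
    have "measure \<mu> {w} = measure \<mu> {z \<in> G. R z > c} - measure \<mu> {z \<in> G. R z > R w}" if "\<mu> \<in> P" for \<mu>
      unfolding e by (rule diff[OF that]) (use c in auto)
    from this[OF \<alpha>(1)] this[OF \<beta>(1)] show ?thesis
      using greater[of c] greater[of "R w"] c False by simp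
  qed
qed

end

section \<open>The spherical suspension as a metric space\<close>

text \<open>Cauchy-Schwarz for the components of \<open>u\<close> and \<open>w\<close> orthogonal to
  \<open>v\<close> bounds \<open>u \<bullet> w\<close> from below by the cosine of the sum of the
  two angles.\<close>

lemma arccos_triangle:
  fixes u v w :: "'a :: real_inner"
  assumes n: "norm u = 1" "norm v = 1" "norm w = 1"
  shows "arccos (u \<bullet> w) \<le> arccos (u \<bullet> v) + arccos (v \<bullet> w)"
proof (cases "arccos (u \<bullet> v) + arccos (v \<bullet> w) \<le> pi")
  \<comment> \<open>A sum above \<open>pi\<close> is no restriction, since \<open>arccos\<close> is
    at most \<open>pi\<close>.\<close>
  case False
  have "\<bar>u \<bullet> w\<bar> \<le> 1" using Cauchy_Schwarz_ineq2[of u w] n by simp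
  then have "arccos (u \<bullet> w) \<le> pi" by (intro arccos_ubound) auto
  then show ?thesis using False by simp
next
  case True
  have b: "\<bar>u \<bullet> w\<bar> \<le> 1" "\<bar>u \<bullet> v\<bar> \<le> 1" "\<bar>v \<bullet> w\<bar> \<le> 1"
    using Cauchy_Schwarz_ineq2[of u w] Cauchy_Schwarz_ineq2[of u v] Cauchy_Schwarz_ineq2[of v w] n by simp_all
  define a c where "a = u \<bullet> v" and "c = v \<bullet> w"
  have sq: "u \<bullet> u = 1" "v \<bullet> v = 1" "w \<bullet> w = 1" using n by (simp_all add: dot_square_norm)
  have "(u - a *\<^sub>R v) \<bullet> (w - c *\<^sub>R v) = u \<bullet> w - a * c"
    using sq by (simp add: a_def c_def inner_diff_left inner_diff_right inner_commute)
  moreover have "(u - a *\<^sub>R v) \<bullet> (u - a *\<^sub>R v) = 1 - a\<^sup>2" "(w - c *\<^sub>R v) \<bullet> (w - c *\<^sub>R v) = 1 - c\<^sup>2"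
    using sq by (simp_all add: a_def c_def inner_diff_left inner_diff_right inner_commute power2_eq_square)
  ultimately have "\<bar>u \<bullet> w - a * c\<bar> \<le> sqrt (1 - a\<^sup>2) * sqrt (1 - c\<^sup>2)"
    using Cauchy_Schwarz_ineq2[of "u - a *\<^sub>R v" "w - c *\<^sub>R v"] by (simp add: norm_eq_sqrt_inner)
  then have "a * c - sqrt (1 - a\<^sup>2) * sqrt (1 - c\<^sup>2) \<le> u \<bullet> w" by linarith
  moreover have "cos (arccos a + arccos c) = a * c - sqrt (1 - a\<^sup>2) * sqrt (1 - c\<^sup>2)"
    using b by (simp add: cos_add sin_arccos_abs a_def c_def abs_le_iff)
  ultimately have "cos (arccos a + arccos c) \<le> u \<bullet> w" by simp
  then have "arccos (u \<bullet> w) \<le> arccos (cos (arccos a + arccos c))"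
    using b by (intro arccos_le_arccos) (auto simp: abs_le_iff)
  also have "\<dots> = arccos a + arccos c"
    using True b by (intro arccos_cos add_nonneg_nonneg arccos_lbound) (auto simp: a_def c_def abs_le_iff)
  finally show ?thesis by (simp add: a_def c_def)
qed

text \<open>The spherical law of cosines: the cosine of the side opposite the angle
  \<open>\<theta>\<close> enclosed by sides \<open>t\<close> and \<open>s\<close>.\<close>

definition sph_cos :: "real \<Rightarrow> real \<Rightarrow> real \<Rightarrow> real" where
  "sph_cos t s \<theta> = cos t * cos s + sin t * sin s * cos \<theta>"

lemma sph_cos_bound: "\<bar>sph_cos t s \<theta>\<bar> \<le> 1"
proof -
  have "(cos t, sin t) \<bullet> (cos s, sin s * cos \<theta>) = sph_cos t s \<theta>"
    by (simp add: sph_cos_def)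
  moreover have "norm (cos t, sin t) = 1" by (simp add: norm_Pair)
  moreover have "norm (cos s, sin s * cos \<theta>) \<le> 1"
  proof -
    have "(sin s * cos \<theta>)\<^sup>2 \<le> (sin s)\<^sup>2 * 1"
      unfolding power_mult_distrib by (intro mult_left_mono) (auto simp: abs_square_le_1)
    then have "(cos s)\<^sup>2 + (sin s * cos \<theta>)\<^sup>2 \<le> 1" using sin_cos_squared_add2[of s] by linarith
    then show ?thesis by (simp add: norm_Pair)
  qed
  ultimately show ?thesis
    using Cauchy_Schwarz_ineq2[of "(cos t, sin t)" "(cos s, sin s * cos \<theta>)"] by simp
qed

lemma sph_cos_bounds: "-1 \<le> sph_cos t s \<theta>" "sph_cos t s \<theta> \<le> 1"
  using sph_cos_bound[of t s \<theta>] by (auto simp: abs_le_iff)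

text \<open>The model is the unit sphere in dimension three, with points at polar angles
  \<open>t\<close>, \<open>s\<close>, \<open>r\<close> and longitudes \<open>0\<close>,
  \<open>a\<close>, \<open>a + b\<close>. The longitude difference \<open>a + b\<close> is finally
  lowered to \<open>c\<close>; since \<open>a + b \<le> pi\<close>, the cosine is monotone
  there.\<close>

lemma sph_triangle:
  assumes "0 \<le> a" "0 \<le> b" "0 \<le> c" "c \<le> a + b" "a + b \<le> pi"
    and t: "t \<in> {0..pi}" "s \<in> {0..pi}" "r \<in> {0..pi}"
  shows "arccos (sph_cos t r c) \<le> arccos (sph_cos t s a) + arccos (sph_cos s r b)"
proof -
  let ?u = "(cos t, sin t, 0) :: real \<times> real \<times> real"
  let ?v = "(cos s, sin s * cos a, sin s * sin a) :: real \<times> real \<times> real"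
  let ?w = "(cos r, sin r * cos (a + b), sin r * sin (a + b)) :: real \<times> real \<times> real"
  have one: "x\<^sup>2 + (y\<^sup>2 + z\<^sup>2) = 1" if "x = cos q" "y = sin q * cos g" "z = sin q * sin g" for x y z q g :: real
  proof -
    have "y\<^sup>2 + z\<^sup>2 = (sin q)\<^sup>2 * ((sin g)\<^sup>2 + (cos g)\<^sup>2)"
      unfolding that power_mult_distrib by algebra
    then show ?thesis using that by simp
  qed
  have n: "norm ?u = 1" "norm ?v = 1" "norm ?w = 1"
    unfolding norm_Pair real_norm_def power2_abs
    using one[OF refl refl refl] by (simp_all add: norm_Pair)
  have uv: "?u \<bullet> ?v = sph_cos t s a" "?u \<bullet> ?w = sph_cos t r (a + b)"
    by (simp_all add: sph_cos_def)
  have "cos b = cos a * cos (a + b) + sin a * sin (a + b)"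
    using cos_diff[of "a + b" a] by (simp add: algebra_simps)
  then have vw: "?v \<bullet> ?w = sph_cos s r b"
    by (simp add: sph_cos_def algebra_simps)
  have "cos (a + b) \<le> cos c" using assms by (intro cos_monotone_0_pi_le) auto
  then have "sph_cos t r (a + b) \<le> sph_cos t r c"
    using t by (auto simp: sph_cos_def intro!: mult_left_mono mult_nonneg_nonneg sin_ge_zero)
  then have "arccos (sph_cos t r c) \<le> arccos (sph_cos t r (a + b))"
    using sph_cos_bounds by (intro arccos_le_arccos) auto
  also have "\<dots> \<le> arccos (sph_cos t s a) + arccos (sph_cos s r b)"
    using arccos_triangle[OF n] by (simp only: uv vw)
  finally show ?thesis .
qed

locale suspension = Metric_space X d for X :: "'a set" and d :: "'a \<Rightarrow> 'a \<Rightarrow> real" +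
  assumes compact_X: "compact_space mtopology" and diam: "mdiam X d < pi / 2" and X_ne: "X \<noteq> {}"
begin

abbreviation Z :: "('a \<times> real) set set" where "Z \<equiv> susp X"
abbreviation D :: "('a \<times> real) set \<Rightarrow> ('a \<times> real) set \<Rightarrow> real" where "D \<equiv> susp_dist X d"

definition pt :: "'a \<Rightarrow> real \<Rightarrow> ('a \<times> real) set" where "pt x t = susp_rel X `` {(x, t)}"

lemma pt_in_Z [simp]: "x \<in> X \<Longrightarrow> 0 \<le> t \<Longrightarrow> t \<le> pi \<Longrightarrow> pt x t \<in> Z"
  by (auto simp: pt_def susp_def intro!: quotientI)

lemma Z_cases:
  assumes "z \<in> Z" obtains x t where "x \<in> X" "0 \<le> t" "t \<le> pi" "z = pt x t"
  using assms by (auto simp: susp_def pt_def elim!: quotientE)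

lemma D_pt: "x \<in> X \<Longrightarrow> y \<in> X \<Longrightarrow> 0 \<le> t \<Longrightarrow> t \<le> pi \<Longrightarrow> 0 \<le> s \<Longrightarrow> s \<le> pi \<Longrightarrow>
    D (pt x t) (pt y s) = arccos (sph_cos t s (d x y))"
  unfolding pt_def sph_cos_def by (rule susp_dist_class) auto

text \<open>The supremum in \<open>mdiam\<close> bounds distances only if they are bounded at all;
  compactness provides this.\<close>

lemma d_less: "x \<in> X \<Longrightarrow> y \<in> X \<Longrightarrow> d x y < pi / 2"
proof -
  assume xy: "x \<in> X" "y \<in> X"
  have "mbounded X" using compact_X compactin_imp_mbounded by (auto simp: compact_space_def)
  then obtain K where K: "\<And>x y. x \<in> X \<Longrightarrow> y \<in> X \<Longrightarrow> d x y \<le> K" by (auto simp: mbounded_alt)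
  have "bdd_above ((\<lambda>(x, y). d x y) ` (X \<times> X))" by (rule bdd_aboveI2[of _ _ K]) (use K in auto)
  from cSUP_upper2[OF this, of "(x, y)" "d x y"] xy have "d x y \<le> mdiam X d"
    using X_ne by (simp add: mdiam_def)
  then show ?thesis using diam by simp
qed

lemma cos_d_pos: "x \<in> X \<Longrightarrow> y \<in> X \<Longrightarrow> 0 < cos (d x y)"
  using d_less[of x y] nonneg[of x y] pi_gt_zero by (intro cos_gt_zero_pi) linarith+

lemma pt_pole: "x \<in> X \<Longrightarrow> y \<in> X \<Longrightarrow> pt x 0 = pt y 0" "x \<in> X \<Longrightarrow> y \<in> X \<Longrightarrow> pt x pi = pt y pi"
  by (auto simp: pt_def susp_rel_def)

text \<open>The equality case of \<open>sph_cos_le\<close>: off the poles, a distance as short as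
  the height difference occurs only along a meridian.\<close>

lemma sph_cos_eq_cos_diff:
  assumes "0 < t" "t < pi" "0 < s" "s < pi" "x \<in> X" "y \<in> X" "sph_cos t s (d x y) = cos (t - s)"
  shows "x = y"
proof -
  have "sin t * sin s * (1 - cos (d x y)) = 0" using assms(7) by (simp add: sph_cos_def cos_diff algebra_simps)
  moreover have "sin t > 0" "sin s > 0" using assms by (auto intro: sin_gt_zero)
  ultimately have "cos (d x y) = cos 0" by simp
  moreover have "d x y \<le> pi" using d_less[OF assms(5,6)] pi_gt_zero by linarith
  ultimately have "d x y = 0" using cos_inj_pi[of "d x y" 0] by simp
  then show "x = y" using zero[OF assms(5,6)] by blast
qed

lemma sph_cos_le: "0 \<le> t \<Longrightarrow> t \<le> pi \<Longrightarrow> 0 \<le> s \<Longrightarrow> s \<le> pi \<Longrightarrow> sph_cos t s \<theta> \<le> cos (t - s)"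
  using mult_left_mono[of "cos \<theta>" 1 "sin t * sin s"] sin_ge_zero[of t] sin_ge_zero[of s]
  by (simp add: sph_cos_def cos_diff)

lemma D_eq_0_iff:
  assumes "z \<in> Z" "w \<in> Z" shows "D z w = 0 \<longleftrightarrow> z = w"
proof -
  obtain x t where x: "x \<in> X" "0 \<le> t" "t \<le> pi" "z = pt x t" using assms(1) by (rule Z_cases)
  obtain y s where y: "y \<in> X" "0 \<le> s" "s \<le> pi" "w = pt y s" using assms(2) by (rule Z_cases)
  have "D z w = 0 \<longleftrightarrow> sph_cos t s (d x y) = 1"
    using x y sph_cos_bounds[of t s "d x y"] arccos_eq_iff[of "sph_cos t s (d x y)" 1] by (simp add: D_pt abs_le_iff)
  also have "\<dots> \<longleftrightarrow> z = w"
  proof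
    assume eq: "sph_cos t s (d x y) = 1"
    then have c: "cos (t - s) = 1" using sph_cos_le[of t s "d x y"] x y by (simp add: antisym)
    have "\<bar>t - s\<bar> = 0" by (rule cos_inj_pi) (use x y c in auto)
    then have ts: "t = s" by simp
    show "z = w"
    proof (cases "0 < t \<and> t < pi")
      case True
      then show ?thesis using sph_cos_eq_cos_diff[of t s x y] x y ts eq c by auto
    next
      case False
      then have "t = 0 \<or> t = pi" using x by auto
      then show ?thesis using x y ts pt_pole[OF x(1) y(1)] by auto
    qed
  next
    assume "z = w"
    then have "((x, t), (y, s)) \<in> susp_rel X"
      using x y eq_equiv_class[OF _ equiv_susp_rel[of X]] by (auto simp: pt_def)
    then have "x = y \<and> t = s \<or> t = 0 \<and> s = 0 \<or> t = pi \<and> s = pi" by (auto simp: susp_rel_def)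
    then show "sph_cos t s (d x y) = 1" using x by (auto simp: sph_cos_def simp flip: power2_eq_square)
  qed
  finally show ?thesis .
qed

text \<open>The diameter bound keeps the sum of two distances in \<open>X\<close> below
  \<open>pi\<close>, as the spherical model requires.\<close>

lemma D_triangle:
  assumes "z \<in> Z" "w \<in> Z" "v \<in> Z"
  shows "D z v \<le> D z w + D w v"
proof -
  obtain x t where x: "x \<in> X" "0 \<le> t" "t \<le> pi" "z = pt x t" using assms(1) by (rule Z_cases)
  obtain y s where y: "y \<in> X" "0 \<le> s" "s \<le> pi" "w = pt y s" using assms(2) by (rule Z_cases)
  obtain q r where q: "q \<in> X" "0 \<le> r" "r \<le> pi" "v = pt q r" using assms(3) by (rule Z_cases)
  show ?thesis
    using x y q sph_triangle[of "d x y" "d y q" "d x q" t s r] d_less[of x y] d_less[of y q] triangle[of x y q]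
    by (simp add: D_pt)
qed

lemma sph_cos_commute: "sph_cos t s \<theta> = sph_cos s t \<theta>"
  by (simp add: sph_cos_def mult.commute)

lemma Metric_space_Z: "Metric_space Z D"
proof
  fix z w :: "('a \<times> real) set"
  have "0 \<le> D z w \<and> D z w = D w z"
  proof (cases "z \<in> Z \<and> w \<in> Z")
    case True
    then have "z \<in> Z" "w \<in> Z" by auto
    obtain x t where x: "x \<in> X" "0 \<le> t" "t \<le> pi" "z = pt x t" using \<open>z \<in> Z\<close> by (rule Z_cases)
    obtain y s where y: "y \<in> X" "0 \<le> s" "s \<le> pi" "w = pt y s" using \<open>w \<in> Z\<close> by (rule Z_cases)
    show ?thesis
      using x y sph_cos_commute[of t s] commute[of x y]
      by (simp add: D_pt arccos_lbound sph_cos_bounds)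
  next
    case False
    then have "D z w = 0" "D w z = 0" by (auto simp: susp_dist_def)
    then show ?thesis by simp
  qed
  then show "0 \<le> D z w" "D z w = D w z" by auto
qed (auto simp: D_eq_0_iff D_triangle)

sublocale Z: Metric_space Z D by (rule Metric_space_Z)

lemma D_pt_same: "x \<in> X \<Longrightarrow> 0 \<le> t \<Longrightarrow> t \<le> pi \<Longrightarrow> 0 \<le> s \<Longrightarrow> s \<le> pi \<Longrightarrow> D (pt x t) (pt x s) = \<bar>t - s\<bar>"
proof -
  assume *: "x \<in> X" "0 \<le> t" "t \<le> pi" "0 \<le> s" "s \<le> pi"
  have "sph_cos t s 0 = cos \<bar>t - s\<bar>" by (simp add: sph_cos_def cos_diff)
  moreover have "arccos (cos \<bar>t - s\<bar>) = \<bar>t - s\<bar>" using * by (intro arccos_cos) auto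
  ultimately show ?thesis using * by (simp add: D_pt del: cos_abs_real)
qed

text \<open>Together with \<open>D_pt_same\<close> this gives joint continuity of \<open>pt\<close>
  in both coordinates.\<close>

lemma D_pt_le: "x \<in> X \<Longrightarrow> y \<in> X \<Longrightarrow> 0 \<le> s \<Longrightarrow> s \<le> pi \<Longrightarrow> D (pt x s) (pt y s) \<le> d x y"
proof -
  assume *: "x \<in> X" "y \<in> X" "0 \<le> s" "s \<le> pi"
  have "sph_cos s s (d x y) = cos (d x y) + (cos s)\<^sup>2 * (1 - cos (d x y))"
  proof -
    have "sph_cos s s (d x y) = (cos s)\<^sup>2 + (1 - (cos s)\<^sup>2) * cos (d x y)"
      unfolding sin_squared_eq[symmetric] by (simp add: sph_cos_def power2_eq_square)
    then show ?thesis by (simp add: algebra_simps)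
  qed
  then have "cos (d x y) \<le> sph_cos s s (d x y)" by simp
  then have "arccos (sph_cos s s (d x y)) \<le> arccos (cos (d x y))"
    using sph_cos_bounds by (intro arccos_le_arccos) auto
  also have "\<dots> = d x y" using d_less[of x y] * by (intro arccos_cos) auto
  finally show ?thesis using * by (simp add: D_pt)
qed

text \<open>With its metric topology the suspension is a continuous image of the cylinder
  \<open>X \<times> {0..pi}\<close>.\<close>

lemma compact_Z: "compact_space Z.mtopology"
proof -
  let ?I = "top_of_set {0..pi}"
  have "continuous_map (prod_topology mtopology ?I) Z.mtopology (\<lambda>(x, t). pt x t)"
    unfolding Z.continuous_map_to_metric
  proof (intro ballI allI impI)
    fix q and e :: real assume q: "q \<in> topspace (prod_topology mtopology ?I)" and e: "0 < e"
    obtain x t where xt: "q = (x, t)" by (cases q)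
    have x: "x \<in> X" "0 \<le> t" "t \<le> pi" using q by (auto simp: xt)
    let ?U = "mball x (e / 2) \<times> ({0..pi} \<inter> ball t (e / 2))"
    have "openin ?I ({0..pi} \<inter> ball t (e / 2))" by (intro openin_open_Int) simp
    then have 1: "openin (prod_topology mtopology ?I) ?U" by (simp add: openin_prod_Times_iff)
    have 2: "(x, t) \<in> ?U" using x e by auto
    have "pt y s \<in> Z.mball (pt x t) e" if ys: "(y, s) \<in> ?U" for y s
    proof -
      have y: "y \<in> X" "0 \<le> s" "s \<le> pi" "d x y < e / 2" "\<bar>t - s\<bar> < e / 2" using ys by (auto simp: dist_real_def)
      have "D (pt x t) (pt y s) \<le> D (pt x t) (pt x s) + D (pt x s) (pt y s)" using x y by (intro D_triangle) auto
      also have "\<dots> \<le> \<bar>t - s\<bar> + d x y" using x y D_pt_same D_pt_le by (intro add_mono) auto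
      finally show ?thesis using x y by simp
    qed
    then have 3: "\<forall>q\<in>?U. (case q of (y, s) \<Rightarrow> pt y s) \<in> Z.mball (pt x t) e"
      by (intro ballI) (metis (no_types, lifting) case_prod_conv surj_pair)
    show "\<exists>U. openin (prod_topology mtopology ?I) U \<and> q \<in> U \<and>
        (\<forall>y\<in>U. (case y of (y, s) \<Rightarrow> pt y s) \<in> Z.mball (case q of (x, t) \<Rightarrow> pt x t) e)"
      unfolding xt prod.case by (intro exI[of _ ?U] conjI 1 2 3)
  qed
  moreover have "compactin (prod_topology mtopology ?I) (X \<times> {0..pi})"
    using compact_X by (auto simp: compactin_Times compact_space_def compactin_subtopology)
  ultimately have "compactin Z.mtopology ((\<lambda>(x, t). pt x t) ` (X \<times> {0..pi}))" by (rule image_compactin[rotated])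
  also have "(\<lambda>(x, t). pt x t) ` (X \<times> {0..pi}) = Z" by (auto elim!: Z_cases)
  finally show ?thesis by (simp add: compact_space_def)
qed

end

section \<open>Compact spaces with two antipodal poles\<close>

text \<open>Both terms lie below their chords \<open>s * L powr (p - 1)\<close>, strictly inside the
  interval because \<open>p > 1\<close>. Hence the sum of the costs to the two poles is largest
  exactly at the poles.\<close>

lemma powr_sum_le:
  fixes t L p :: real
  assumes "0 \<le> t" "t \<le> L" "p > 1"
  shows "t powr p + (L - t) powr p \<le> L powr p"
    and "t powr p + (L - t) powr p = L powr p \<Longrightarrow> t = 0 \<or> t = L"
proof -
  have le: "s powr p \<le> s * L powr (p - 1)" if "0 \<le> s" "s \<le> L" for s
  proof (cases "s = 0")
    case False
    then have "s powr p = s * s powr (p - 1)" using that by (simp add: powr_diff)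
    also have "\<dots> \<le> s * L powr (p - 1)" using that assms by (intro mult_left_mono powr_mono2) auto
    finally show ?thesis .
  qed (use assms in simp)
  have L: "t * L powr (p - 1) + (L - t) * L powr (p - 1) = L powr p"
  proof -
    have "L powr p = L * L powr (p - 1)" using assms by (cases "L = 0") (simp_all add: powr_diff)
    then show ?thesis by (simp add: algebra_simps)
  qed
  show "t powr p + (L - t) powr p \<le> L powr p" using le[of t] le[of "L - t"] assms L by simp
  show "t = 0 \<or> t = L" if eq: "t powr p + (L - t) powr p = L powr p"
  proof (rule ccontr)
    assume "\<not> (t = 0 \<or> t = L)"
    then have t: "0 < t" "t < L" using assms by auto
    have "t powr p = t * t powr (p - 1)" using t by (simp add: powr_diff)
    also have "\<dots> < t * L powr (p - 1)" using t assms by (intro mult_strict_left_mono powr_less_mono2) auto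
    finally show False using le[of "L - t"] t L eq by simp
  qed
qed

text \<open>Abstracts what the argument on measures needs of the suspension: every point lies
  between two poles, and only the poles realise the distance \<open>L\<close>. The height of a point
  \<open>z\<close> is \<open>D N z\<close>.\<close>

locale bipolar = compact_wasserstein +
  fixes N S :: 'a and L :: real
  assumes NS [simp]: "N \<in> Z" "S \<in> Z" and L_pos: "0 < L"
    and pole_sum: "z \<in> Z \<Longrightarrow> D N z + D S z = L"
    and antipodal: "z \<in> Z \<Longrightarrow> w \<in> Z \<Longrightarrow> D z w = L \<Longrightarrow> z = N \<and> w = S \<or> z = S \<and> w = N"
begin

text \<open>Every result about \<open>N\<close> thereby becomes available for
  \<open>S\<close>.\<close>

lemma swap: "bipolar Z D p S N L"
  by unfold_locales (use NS L_pos pole_sum antipodal in \<open>force simp: add.commute\<close>)+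

lemma D_NS: "D N S = L" "D S N = L"
  using pole_sum[of S] pole_sum[of N] by simp_all

lemma D_le_L: "z \<in> Z \<Longrightarrow> w \<in> Z \<Longrightarrow> D z w \<le> L"
  using triangle[of z N w] triangle[of z S w] pole_sum[of z] pole_sum[of w] commute[of z N] commute[of z S] by auto

lemma D_N_le: "z \<in> Z \<Longrightarrow> D N z \<le> L"
  using pole_sum[of z] nonneg[of S z] by linarith

lemma D_N_eq_L: "z \<in> Z \<Longrightarrow> D N z = L \<Longrightarrow> z = S"
  using pole_sum[of z] by auto

section \<open>Isometries and the poles\<close>

definition pole_fixing :: "('a measure \<Rightarrow> 'a measure) \<Rightarrow> bool" where
  "pole_fixing \<Phi> \<longleftrightarrow> is_isometry P W \<Phi> \<and> \<Phi> (return B N) = return B N \<and> \<Phi> (return B S) = return B S"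

lemma isometry_PD:
  assumes "is_isometry P W \<Phi>"
  shows "\<mu> \<in> P \<Longrightarrow> \<Phi> \<mu> \<in> P" "\<mu> \<in> P \<Longrightarrow> \<nu> \<in> P \<Longrightarrow> W (\<Phi> \<mu>) (\<Phi> \<nu>) = W \<mu> \<nu>"
  using assms by (auto simp: is_isometry_def)

text \<open>Since \<open>L\<close> bounds all distances, the product coupling costs at most
  \<open>L powr p\<close>, and hence exactly that. So almost all independent pairs are antipodal,
  which leaves only the two Dirac measures.\<close>

lemma W_eq_L_imp_poles:
  assumes \<mu>: "\<mu> \<in> P" and \<nu>: "\<nu> \<in> P" and W_L: "W \<mu> \<nu> = L"
  shows "\<mu> = return B N \<and> \<nu> = return B S \<or> \<mu> = return B S \<and> \<nu> = return B N"
proof -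
  interpret M: prob_space \<mu> using PD[OF \<mu>] by simp
  interpret K: prob_space \<nu> using PD[OF \<nu>] by simp
  interpret MK: pair_prob_space \<mu> \<nu> ..
  have m: "fst \<in> \<mu> \<Otimes>\<^sub>M \<nu> \<rightarrow>\<^sub>M B" "snd \<in> \<mu> \<Otimes>\<^sub>M \<nu> \<rightarrow>\<^sub>M B"
    using measurable_fst[of \<mu> \<nu>] measurable_snd[of \<mu> \<nu>] PD(2)[OF \<mu>] PD(2)[OF \<nu>]
    by (auto cong: measurable_cong_sets)
  note i = integrable_dist_powr[OF MK.finite_measure_axioms m]
  have sp: "fst q \<in> Z" "snd q \<in> Z" if "q \<in> space (\<mu> \<Otimes>\<^sub>M \<nu>)" for q
    using that measurable_space[OF m(1)] measurable_space[OF m(2)] by auto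
  have "W \<mu> \<nu> powr p \<le> (\<integral>q. D (fst q) (snd q) powr p \<partial>(\<mu> \<Otimes>\<^sub>M \<nu>))"
    using W_upper[OF MK.prob_space_axioms m] distr_pair_fst_snd[OF \<mu> \<nu>] by simp
  then have "AE q in \<mu> \<Otimes>\<^sub>M \<nu>. D (fst q) (snd q) powr p = L powr p"
    using i sp D_le_L p_gt_1 W_L
    by (intro MK.integral_eq_AE_eq AE_I2) (auto intro!: powr_mono2 simp: MK.prob_space)
  then have "AE q in \<mu> \<Otimes>\<^sub>M \<nu>. fst q = N \<and> snd q = S \<or> fst q = S \<and> snd q = N"
    using AE_space
  proof eventually_elim
    case (elim q)
    have "D (fst q) (snd q) = L" by (rule powr_p_cancel[OF nonneg _ elim(1)]) (use L_pos in simp)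
    then show ?case using antipodal sp[OF elim(2)] by blast
  qed
  then have AE2: "AE x in \<mu>. AE y in \<nu>. x = N \<and> y = S \<or> x = S \<and> y = N"
    by (auto dest: MK.AE_pair)
  have ne: "N \<noteq> S" using D_NS L_pos by auto
  \<comment> \<open>One typical first coordinate determines \<open>\<nu>\<close>; once
    \<open>\<nu>\<close> is known, it determines almost every first coordinate.\<close>
  obtain x where x: "AE y in \<nu>. x = N \<and> y = S \<or> x = S \<and> y = N"
    using M.AE_False AE2 by (metis (mono_tags, lifting) eventually_mono)
  have not_False: "\<not> (AE y in \<nu>. False)" by (simp add: K.AE_False)
  have ex: "\<exists>y. R y" if "AE y in \<nu>. R y" for R
    using that not_False by (metis (mono_tags, lifting) eventually_mono)
  have xs: "x = N \<or> x = S" using ex[OF x] by auto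
  show ?thesis
  proof (cases "x = N")
    case True
    then have y: "AE y in \<nu>. y = S" using x ne by (auto elim: eventually_mono)
    have "AE x in \<mu>. x = N"
      using AE2
    proof eventually_elim
      case (elim x')
      then have "AE y in \<nu>. (x' = N \<and> y = S \<or> x' = S \<and> y = N) \<and> y = S" using y by auto
      from ex[OF this] show ?case using ne by auto
    qed
    then show ?thesis using y eq_returnI \<mu> \<nu> by auto
  next
    case False
    then have y: "AE y in \<nu>. y = N" using x ne xs by (auto elim: eventually_mono)
    have "AE x in \<mu>. x = S"
      using AE2
    proof eventually_elim
      case (elim x')
      then have "AE y in \<nu>. (x' = N \<and> y = S \<or> x' = S \<and> y = N) \<and> y = N" using y by auto
      from ex[OF this] show ?case using ne by auto
    qed
    then show ?thesis using y eq_returnI \<mu> \<nu> by auto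
  qed
qed

lemma isometry_poles:
  assumes "is_isometry P W \<Phi>"
  shows "pole_fixing \<Phi> \<or> \<Phi> (return B N) = return B S \<and> \<Phi> (return B S) = return B N"
proof -
  have "W (\<Phi> (return B N)) (\<Phi> (return B S)) = L"
    using isometry_PD(2)[OF assms, of "return B N" "return B S"] return_P W_return_return[of N S] D_NS by simp
  then show ?thesis
    using W_eq_L_imp_poles[of "\<Phi> (return B N)" "\<Phi> (return B S)"] isometry_PD(1)[OF assms] return_P assms
    by (auto simp: pole_fixing_def)
qed

text \<open>The integral of \<open>D N z powr p + D S z powr p\<close> is preserved and attains its
  maximum \<open>L powr p\<close> only for measures on the poles; the weights are then read off from
  the two costs separately.\<close>

lemma pole_measures_fixed:
  assumes \<Phi>: "pole_fixing \<Phi>" and m: "m \<in> P" "AE z in m. z \<in> {N, S}"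
  shows "\<Phi> m = m"
proof -
  have iso: "is_isometry P W \<Phi>" and fx: "\<Phi> (return B N) = return B N" "\<Phi> (return B S) = return B S"
    using \<Phi> by (auto simp: pole_fixing_def)
  let ?m = "\<Phi> m"
  have m': "?m \<in> P" using isometry_PD[OF iso] m by simp
  interpret M: prob_space m using PD[OF m(1)] by simp
  interpret M': prob_space ?m using PD[OF m'] by simp
  have int_eq: "(\<integral>z. D N z powr p \<partial>?m) = (\<integral>z. D N z powr p \<partial>m)" "(\<integral>z. D S z powr p \<partial>?m) = (\<integral>z. D S z powr p \<partial>m)"
    using isometry_PD(2)[OF iso return_P m(1), of N] isometry_PD(2)[OF iso return_P m(1), of S] fx
      W_return[OF _ m(1)] W_return[OF _ m'] NS by metis+
  note i = integrable_dist_P[OF m(1)] integrable_dist_P[OF m']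
  have ne: "N \<noteq> S" using D_NS L_pos by auto
  have ind: "(\<integral>z. D N z powr p \<partial>\<mu>) = L powr p * measure \<mu> {S}" "(\<integral>z. D S z powr p \<partial>\<mu>) = L powr p * measure \<mu> {N}"
    if \<mu>: "\<mu> \<in> P" "AE z in \<mu>. z \<in> {N, S}" for \<mu>
  proof -
    have [simp]: "space \<mu> = Z" using PD[OF \<mu>(1)] by simp
    have m: "(\<lambda>z. D N z powr p) \<in> borel_measurable \<mu>" "(\<lambda>z. D S z powr p) \<in> borel_measurable \<mu>"
      using integrable_dist_P[OF \<mu>(1)] NS by blast+
    have "{S} \<in> sets \<mu>" "{N} \<in> sets \<mu>" using PD(2)[OF \<mu>(1)] by auto
    then have mi: "(\<lambda>z. L powr p * indicator {S} z) \<in> borel_measurable \<mu>"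
      "(\<lambda>z. L powr p * indicator {N} z) \<in> borel_measurable \<mu>" by simp_all
    have "(\<integral>z. D N z powr p \<partial>\<mu>) = (\<integral>z. L powr p * indicator {S} z \<partial>\<mu>)"
      by (rule integral_cong_AE[OF m(1) mi(1)]) (use \<mu>(2) in eventually_elim, use ne D_NS in auto)
    moreover have "(\<integral>z. D S z powr p \<partial>\<mu>) = (\<integral>z. L powr p * indicator {N} z \<partial>\<mu>)"
      by (rule integral_cong_AE[OF m(2) mi(2)]) (use \<mu>(2) in eventually_elim, use ne D_NS in auto)
    ultimately show "(\<integral>z. D N z powr p \<partial>\<mu>) = L powr p * measure \<mu> {S}" "(\<integral>z. D S z powr p \<partial>\<mu>) = L powr p * measure \<mu> {N}"
      by simp_all
  qed
  have "measure m {N} + measure m {S} = measure m {N, S}"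
    using M.finite_measure_Union[of "{N}" "{S}"] ne PD(2)[OF m(1)] by (simp add: insert_commute)
  moreover have "measure m {N, S} = 1" using measure_eq_1_iff[OF m(1) finite_sets] m(2) by simp
  ultimately have "(\<integral>z. L powr p \<partial>?m) \<le> (\<integral>z. D N z powr p + D S z powr p \<partial>?m)"
    using i int_eq ind[OF m] by (simp add: M'.prob_space algebra_simps)
       (metis distrib_left mult.right_neutral order_refl)
  moreover have "D N z powr p + D S z powr p \<le> L powr p" if "z \<in> Z" for z
  proof -
    have "D S z = L - D N z" using pole_sum[OF that] by simp
    then show ?thesis using powr_sum_le(1)[OF nonneg D_N_le[OF that] p_gt_1] by simp
  qed
  then have "AE z in ?m. D N z powr p + D S z powr p \<le> L powr p"
    using PD(3)[OF m'] by (intro AE_I2) simp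
  ultimately have "AE z in ?m. D N z powr p + D S z powr p = L powr p"
    using i by (intro M'.integral_eq_AE_eq Bochner_Integration.integrable_add) auto
  then have AE': "AE z in ?m. z \<in> {N, S}"
    using AE_space
  proof eventually_elim
    case (elim z)
    then have z: "z \<in> Z" using PD(3)[OF m'] by simp
    then have "D S z = L - D N z" using pole_sum[of z] by simp
    then have "D N z = 0 \<or> D N z = L" using elim powr_sum_le(2)[OF nonneg D_N_le[OF z] p_gt_1] by simp
    then show ?case using z D_N_eq_L by auto
  qed
  show "?m = m"
  proof (rule finite_support_eqI[OF m' AE' m])
    fix w assume "w \<in> {N, S}"
    moreover have "L powr p > 0" using L_pos by simp
    ultimately show "measure ?m {w} = measure m {w}" using ind[OF m] ind[OF m' AE'] int_eq by auto
  qed auto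
qed

section \<open>Invariance of heights\<close>

text \<open>The costs to the fixed measures on \<open>{N, S}\<close> determine the law of
  \<open>D N z powr p - D S z powr p\<close>, and this difference is a strictly increasing function
  of the height.\<close>

lemma height_distr:
  assumes \<Phi>: "pole_fixing \<Phi>" and \<alpha>: "\<alpha> \<in> P"
  shows "distr (\<Phi> \<alpha>) borel (D N) = distr \<alpha> borel (D N)"
proof (rule distr_eqI_greater)
  have iso: "is_isometry P W \<Phi>" using \<Phi> by (simp add: pole_fixing_def)
  show \<beta>: "\<Phi> \<alpha> \<in> P" by (rule isometry_PD[OF iso \<alpha>])
  show "D N \<in> borel_measurable B" by simp
  define u where "u s = s powr p - (L - s) powr p" for s
  have u_mono: "u s < u r" if "0 \<le> s" "s < r" "r \<le> L" for s r
    using that p_gt_1 powr_less_mono2[of p s r] powr_mono2[of p "L - r" "L - s"] by (simp add: u_def)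
  have lev: "measure (\<Phi> \<alpha>) {z \<in> Z. D N z powr p - D S z powr p > c} = measure \<alpha> {z \<in> Z. D N z powr p - D S z powr p > c}" for c
  proof (rule two_point_level_sets[OF NS \<beta> \<alpha>])
    fix m assume "m \<in> P" "AE z in m. z \<in> {N, S}"
    then show "W m (\<Phi> \<alpha>) = W m \<alpha>"
      using pole_measures_fixed[OF \<Phi>] isometry_PD(2)[OF iso _ \<alpha>, of m] by simp
  qed
  fix c
  \<comment> \<open>Monotonicity of \<open>u\<close> is available on \<open>{0..L}\<close> only; for
    other \<open>c\<close> the sets are all of \<open>Z\<close> or empty.\<close>
  consider "c < 0" | "0 \<le> c" "c \<le> L" | "c > L" by linarith
  then show "measure (\<Phi> \<alpha>) {z \<in> Z. c < D N z} = measure \<alpha> {z \<in> Z. c < D N z}"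
  proof cases
    case 1
    then have "{z \<in> Z. c < D N z} = Z" using order.strict_trans2[OF 1 nonneg] by auto
    then show ?thesis
      using PD(1)[OF \<alpha>] PD(1)[OF \<beta>] prob_space.prob_space[of \<alpha>] prob_space.prob_space[of "\<Phi> \<alpha>"]
      by (simp add: PD(3)[OF \<alpha>] PD(3)[OF \<beta>])
  next
    case 2
    have "c < D N z \<longleftrightarrow> u c < D N z powr p - D S z powr p" if z: "z \<in> Z" for z
    proof -
      have "D N z powr p - D S z powr p = u (D N z)" 
      proof -
        have "D S z = L - D N z" using pole_sum[OF z] by simp
        then show ?thesis by (simp add: u_def)
      qed
      moreover have "u c < u (D N z)" if "c < D N z" using u_mono[of c "D N z"] that 2 D_N_le[OF z] by simp
      moreover have "u (D N z) \<le> u c" if "\<not> c < D N z"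
        using u_mono[of "D N z" c] that 2 by (cases "D N z = c") auto
      ultimately show ?thesis by (metis not_le)
    qed
    then have "{z \<in> Z. c < D N z} = {z \<in> Z. u c < D N z powr p - D S z powr p}" by blast
    then show ?thesis using lev by simp
  next
    case 3
    then have e: "{z \<in> Z. c < D N z} = {}" using D_N_le by fastforce
    show ?thesis unfolding e by simp
  qed
qed (use \<alpha> in simp)

lemma height_measure:
  assumes \<Phi>: "pole_fixing \<Phi>" and \<alpha>: "\<alpha> \<in> P" and T: "T \<in> sets borel"
  shows "measure (\<Phi> \<alpha>) {z \<in> Z. D N z \<in> T} = measure \<alpha> {z \<in> Z. D N z \<in> T}"
proof -
  have \<beta>: "\<Phi> \<alpha> \<in> P" using \<Phi> \<alpha> isometry_PD by (auto simp: pole_fixing_def)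
  have *: "measure \<mu> {z \<in> Z. D N z \<in> T} = measure (distr \<mu> borel (D N)) T" if \<mu>: "\<mu> \<in> P" for \<mu>
  proof -
    have "D N -` T \<inter> space \<mu> = {z \<in> Z. D N z \<in> T}" using PD(3)[OF \<mu>] by auto
    then show ?thesis using \<mu> T dist_measurable[of N] by (simp add: measure_distr)
  qed
  show ?thesis unfolding *[OF \<alpha>] *[OF \<beta>] height_distr[OF \<Phi> \<alpha>] ..
qed

lemma height_sets: "T \<in> sets borel \<Longrightarrow> {z \<in> Z. D N z \<in> T} \<in> sets B"
  using measurable_sets[OF dist_measurable[of N], of T] by (simp add: vimage_def Int_def conj_commute)

lemma height_AE:
  assumes \<Phi>: "pole_fixing \<Phi>" and \<alpha>: "\<alpha> \<in> P" and T: "T \<in> sets borel"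
  shows "(AE z in \<Phi> \<alpha>. D N z \<in> T) \<longleftrightarrow> (AE z in \<alpha>. D N z \<in> T)"
proof -
  have \<beta>: "\<Phi> \<alpha> \<in> P" using \<Phi> \<alpha> isometry_PD by (auto simp: pole_fixing_def)
  have "(AE z in \<mu>. D N z \<in> T) \<longleftrightarrow> measure \<mu> {z \<in> Z. D N z \<in> T} = 1" if \<mu>: "\<mu> \<in> P" for \<mu>
    unfolding measure_eq_1_iff[OF \<mu> height_sets[OF T]]
    using AE_space[of \<mu>] PD(3)[OF \<mu>] by (auto elim!: eventually_elim2)
  then show ?thesis using height_measure[OF assms] \<alpha> \<beta> by simp
qed

lemma height_integral:
  fixes f :: "real \<Rightarrow> real"
  assumes \<Phi>: "pole_fixing \<Phi>" and \<alpha>: "\<alpha> \<in> P" and f: "f \<in> borel_measurable borel"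
  shows "(\<integral>z. f (D N z) \<partial>\<Phi> \<alpha>) = (\<integral>z. f (D N z) \<partial>\<alpha>)"
proof -
  have \<beta>: "\<Phi> \<alpha> \<in> P" using \<Phi> \<alpha> isometry_PD by (auto simp: pole_fixing_def)
  have "(\<integral>z. f (D N z) \<partial>\<mu>) = (\<integral>t. f t \<partial>distr \<mu> borel (D N))" if "\<mu> \<in> P" for \<mu>
    using that f dist_measurable[of N] by (simp add: integral_distr)
  then show ?thesis using height_distr[OF \<Phi> \<alpha>] \<alpha> \<beta> by simp
qed

lemma pole_fixingD:
  assumes "pole_fixing \<Phi>"
  shows "is_isometry P W \<Phi>" "\<mu> \<in> P \<Longrightarrow> \<Phi> \<mu> \<in> P" "\<mu> \<in> P \<Longrightarrow> \<nu> \<in> P \<Longrightarrow> W (\<Phi> \<mu>) (\<Phi> \<nu>) = W \<mu> \<nu>"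
    "\<Phi> (return B N) = return B N" "\<Phi> (return B S) = return B S"
  using assms isometry_PD by (auto simp: pole_fixing_def)

lemma pole_fixing_inv_into:
  assumes "pole_fixing \<Phi>"
  shows "pole_fixing (inv_into P \<Phi>)"
proof -
  note \<Phi> = pole_fixingD[OF assms]
  have "inv_into P \<Phi> (return B a) = return B a" if "a \<in> Z" "\<Phi> (return B a) = return B a" for a
    using inv_into_f_f[OF isometry_P_inj[OF \<Phi>(1)] return_P[OF that(1)]] that(2) by simp
  then show ?thesis using \<Phi> isometry_P_inv_into[OF \<Phi>(1)] by (simp add: pole_fixing_def)
qed

section \<open>Images of Dirac measures\<close>

text \<open>The mass at \<open>N\<close> alone costs \<open>t powr p\<close> per unit, which
  exhausts the bound \<open>int\<close>; all remaining mass has to sit at \<open>z\<close>.\<close>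

lemma concentrated_at_two_points:
  assumes \<kappa>: "\<kappa> \<in> P" and z: "z \<in> Z" "D N z = t" and AE_t: "AE v in \<kappa>. D N v \<in> {0, t}"
    and int: "(\<integral>v. D z v powr p \<partial>\<kappa>) \<le> t powr p * measure \<kappa> {N}"
  shows "AE v in \<kappa>. v \<in> {N, z}"
proof -
  interpret prob_space \<kappa> using PD[OF \<kappa>] by simp
  have N: "{N} \<in> sets \<kappa>" using PD(2)[OF \<kappa>] by simp
  have "AE v in \<kappa>. t powr p * indicator {N} v = D z v powr p"
  proof (rule integral_eq_AE_eq)
    show "integrable \<kappa> (\<lambda>v. t powr p * indicator {N} v)"
      using N by (auto simp: less_top[symmetric])
    show "integrable \<kappa> (\<lambda>v. D z v powr p)" by (rule integrable_dist_P[OF \<kappa> z(1)])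
    show "AE v in \<kappa>. t powr p * indicator {N} v \<le> D z v powr p"
      using z by (intro AE_I2) (auto simp: indicator_def commute)
    show "(\<integral>v. D z v powr p \<partial>\<kappa>) \<le> (\<integral>v. t powr p * indicator {N} v \<partial>\<kappa>)"
      using int N PD(3)[OF \<kappa>] by simp
  qed
  then show ?thesis
    using AE_space
  proof eventually_elim
    case (elim v)
    then show ?case using z PD(3)[OF \<kappa>] by (cases "v = N") auto
  qed
qed

text \<open>Two ways of moving a share of the image to \<open>N\<close> turn out to give the same
  measure. They leave the masses \<open>r\<close> and \<open>r * r\<close> on \<open>E\<close>,
  which forces \<open>r = r * r\<close>.\<close>

lemma isometry_image_return_zero_one:
  assumes \<Phi>: "pole_fixing \<Phi>" and z: "z \<in> Z" "z \<noteq> N" and E: "E \<in> sets B" "N \<notin> E"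
  shows "measure (\<Phi> (return B z)) E \<in> {0, 1}"
proof -
  define t where "t = D N z"
  define m where "m = \<Phi> (return B z)"
  define r where "r = measure m E"
  note \<Phi>D = pole_fixingD[OF \<Phi>]
  have t: "0 < t" using z by (simp add: t_def)
  have m: "m \<in> P" unfolding m_def by (rule \<Phi>D(2)[OF return_P[OF z(1)]])
  interpret M: prob_space m using PD[OF m] by simp
  interpret Q: pair_prob_space m m ..
  let ?Q = "m \<Otimes>\<^sub>M m"
  have fs: "fst \<in> ?Q \<rightarrow>\<^sub>M B" "snd \<in> ?Q \<rightarrow>\<^sub>M B"
    using measurable_fst[of m m] measurable_snd[of m m] PD(2)[OF m] by (auto cong: measurable_cong_sets)
  have "AE v in return B z. v \<in> {v \<in> Z. D N v \<in> {t}}"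
    using AE_return_iff[OF z(1) height_sets[of "{t}"]] z by (simp add: t_def)
  then have "AE v in return B z. D N v \<in> {t}" by (auto elim: eventually_mono)
  then have m_t: "AE v in m. D N v \<in> {t}"
    unfolding m_def using height_AE[OF \<Phi> return_P[OF z(1)], of "{t}"] by simp
  \<comment> \<open>The inverse carries the two modified measures back, where they are compared with
    the Dirac measure at \<open>z\<close>.\<close>
  define \<Psi> where "\<Psi> = inv_into P \<Phi>"
  have \<Psi>: "pole_fixing \<Psi>" unfolding \<Psi>_def by (rule pole_fixing_inv_into[OF \<Phi>])
  note \<Psi>D = pole_fixingD[OF \<Psi>]
  have \<Psi>m: "\<Psi> m = return B z"
    unfolding \<Psi>_def m_def by (rule inv_into_f_f[OF isometry_P_inj[OF \<Phi>D(1)] return_P[OF z(1)]])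
  \<comment> \<open>On two independent samples of \<open>m\<close>, \<open>\<omega> snd\<close>
    sweeps exactly the mass outside \<open>E\<close> to \<open>N\<close>, while
    \<open>\<omega> fst\<close> sweeps a share of \<open>m\<close> that is independent of
    position.\<close>
  define \<omega> where "\<omega> f = distr ?Q B (\<lambda>q. if snd q \<in> E then f q else N)" for f :: "'a \<times> 'a \<Rightarrow> 'a"
  have EQ: "{q \<in> space ?Q. snd q \<in> E} \<in> sets ?Q"
    using measurable_sets[OF fs(2) E(1)] by (simp add: vimage_def Int_def conj_commute)
  have rQ: "measure ?Q {q \<in> space ?Q. snd q \<in> E} = r"
  proof -
    have "measure (distr ?Q B snd) E = measure ?Q (snd -` E \<inter> space ?Q)" using fs E by (simp add: measure_distr)
    then show ?thesis using distr_pair_fst_snd(2)[OF m m] by (simp add: r_def vimage_def Int_def conj_commute)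
  qed
  have key: "\<omega> f \<in> P \<and> (AE v in \<Psi> (\<omega> f). v \<in> {N, z}) \<and> measure (\<Psi> (\<omega> f)) {N} = 1 - r"
    if f: "f \<in> ?Q \<rightarrow>\<^sub>M B" "distr ?Q B f = m" for f
  proof -
    have g: "(\<lambda>q. if snd q \<in> E then f q else N) \<in> ?Q \<rightarrow>\<^sub>M B"
      using EQ f(1) by (intro measurable_If) auto
    have \<omega>P: "\<omega> f \<in> P" unfolding \<omega>_def by (rule distr_P[OF Q.prob_space_axioms g])
    note \<kappa>P = \<Psi>D(2)[OF \<omega>P]
    have f_t: "AE q in ?Q. D N (f q) = t"
    proof -
      have "(AE v in distr ?Q B f. D N v \<in> {t}) \<longleftrightarrow> (AE q in ?Q. D N (f q) \<in> {t})"
        by (rule AE_distr_iff[OF f(1)]) (use height_sets[of "{t}"] in simp)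
      then show ?thesis using m_t unfolding f(2) by simp
    qed
    have fZ: "f q \<in> Z" if "q \<in> space ?Q" for q using measurable_space[OF f(1) that] by simp
    have \<omega>_t: "AE v in \<omega> f. D N v \<in> {0, t}"
      unfolding \<omega>_def using height_sets[of "{0, t}"]
      by (subst AE_distr_iff[OF g]) (use f_t in \<open>auto elim: eventually_mono\<close>)
    \<comment> \<open>The sampled point almost surely differs from \<open>N\<close>, because its
      height is \<open>t > 0\<close>; so only the swept mass arrives at \<open>N\<close>.\<close>
    have \<omega>_N: "measure (\<omega> f) {N} = 1 - r"
    proof -
      have "measure (\<omega> f) {N} = measure ?Q ((\<lambda>q. if snd q \<in> E then f q else N) -` {N} \<inter> space ?Q)"
        unfolding \<omega>_def using g by (simp add: measure_distr)
      also have "\<dots> = measure ?Q (space ?Q - {q \<in> space ?Q. snd q \<in> E})"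
      proof (rule Q.finite_measure_eq_AE)
        show "AE q in ?Q. (q \<in> (\<lambda>q. if snd q \<in> E then f q else N) -` {N} \<inter> space ?Q) =
            (q \<in> space ?Q - {q \<in> space ?Q. snd q \<in> E})"
          using f_t AE_space
        proof eventually_elim
          case (elim q)
          have "f q \<noteq> N"
          proof
            assume "f q = N"
            then show False using elim(1) t by simp
          qed
          then show ?case using elim(2) by auto
        qed
      qed (use g EQ measurable_sets[OF g, of "{N}"] in auto)
      also have "\<dots> = 1 - r" using Q.prob_compl[OF EQ] rQ by simp
      finally show ?thesis .
    qed
    have N0: "{v \<in> Z. D N v \<in> {0}} = {N}" by auto
    have \<kappa>_N: "measure (\<Psi> (\<omega> f)) {N} = 1 - r"
      using height_measure[OF \<Psi> \<omega>P, of "{0}"] \<omega>_N unfolding N0 by simp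
    \<comment> \<open>The coupling that moves only the swept mass costs
      \<open>t powr p * (1 - r)\<close>, exactly what \<open>concentrated_at_two_points\<close>
      allows.\<close>
    have "(\<integral>v. D z v powr p \<partial>\<Psi> (\<omega> f)) = W (\<Psi> m) (\<Psi> (\<omega> f)) powr p"
      unfolding \<Psi>m by (rule W_return[OF z(1) \<kappa>P, symmetric])
    also have "\<dots> = W m (\<omega> f) powr p" using \<Psi>D(3)[OF m \<omega>P] by simp
    also have "\<dots> \<le> (\<integral>q. D (f q) (if snd q \<in> E then f q else N) powr p \<partial>?Q)"
      using W_upper[OF Q.prob_space_axioms f(1) g] f(2) by (simp add: \<omega>_def)
    also have "\<dots> = (\<integral>q. t powr p * indicator (space ?Q - {q \<in> space ?Q. snd q \<in> E}) q \<partial>?Q)"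
    proof (rule integral_cong_AE)
      show "(\<lambda>q. D (f q) (if snd q \<in> E then f q else N) powr p) \<in> borel_measurable ?Q"
        by (intro powr_real_measurable dist_measurable_Pair f g) simp
      show "AE q in ?Q. D (f q) (if snd q \<in> E then f q else N) powr p =
          t powr p * indicator (space ?Q - {q \<in> space ?Q. snd q \<in> E}) q"
        using f_t AE_space by eventually_elim (use fZ in \<open>auto simp: commute[of _ N]\<close>)
    qed (use EQ in \<open>auto intro!: borel_measurable_times borel_measurable_indicator\<close>)
    also have "\<dots> = t powr p * measure (\<Psi> (\<omega> f)) {N}"
      using Q.prob_compl[OF EQ] rQ \<kappa>_N by (simp add: Int_absorb2)
    finally have "AE v in \<Psi> (\<omega> f). v \<in> {N, z}"
      using height_AE[OF \<Psi> \<omega>P, of "{0, t}"] \<omega>_t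
      by (intro concentrated_at_two_points[OF \<kappa>P z(1)]) (auto simp: t_def)
    then show ?thesis using \<omega>P \<kappa>_N by simp
  qed
  note k1 = key[OF fs(2) distr_pair_fst_snd(2)[OF m m]] and k2 = key[OF fs(1) distr_pair_fst_snd(1)[OF m m]]
  note mz = measure_two_points[OF _ _ NS(1) z(1) z(2)[symmetric]]
  \<comment> \<open>Both measures live on \<open>{N, z}\<close> and have weight \<open>1 - r\<close>
    at \<open>N\<close>.\<close>
  have "\<Psi> (\<omega> snd) = \<Psi> (\<omega> fst)"
  proof (rule finite_support_eqI)
    show "\<Psi> (\<omega> snd) \<in> P" "\<Psi> (\<omega> fst) \<in> P" using k1 k2 \<Psi>D(2) by auto
    then show "measure (\<Psi> (\<omega> snd)) {w} = measure (\<Psi> (\<omega> fst)) {w}" if "w \<in> {N, z}" for w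
      using that k1 k2 mz by auto
  qed (use k1 k2 z in auto)
  then have "\<omega> snd = \<omega> fst"
    using inj_onD[OF isometry_P_inj[OF \<Psi>D(1)]] k1 k2 by blast
  moreover have "measure (\<omega> snd) E = r"
  proof -
    have g: "(\<lambda>q. if snd q \<in> E then snd q else N) \<in> ?Q \<rightarrow>\<^sub>M B" using EQ fs by (intro measurable_If) auto
    have "(\<lambda>q. if snd q \<in> E then snd q else N) -` E \<inter> space ?Q = {q \<in> space ?Q. snd q \<in> E}"
      using E(2) by (auto split: if_splits)
    then show ?thesis unfolding \<omega>_def using g E(1) rQ by (simp add: measure_distr)
  qed
  moreover have "measure (\<omega> fst) E = r * r"
  proof -
    have g: "(\<lambda>q. if snd q \<in> E then fst q else N) \<in> ?Q \<rightarrow>\<^sub>M B" using EQ fs by (intro measurable_If) auto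
    have Em: "E \<in> sets m" using E PD(2)[OF m] by simp
    have "(\<lambda>q. if snd q \<in> E then fst q else N) -` E \<inter> space ?Q = E \<times> E"
      using E(2) sets.sets_into_space[OF Em] by (auto simp: space_pair_measure split: if_splits)
    then have "measure (\<omega> fst) E = measure ?Q (E \<times> E)"
      unfolding \<omega>_def using g E(1) by (simp add: measure_distr)
    also have "\<dots> = r * r"
    proof -
      have "ennreal (measure ?Q (E \<times> E)) = ennreal (r * r)"
        using M.emeasure_pair_measure_Times[OF Em Em]
        unfolding Q.emeasure_eq_measure M.emeasure_eq_measure r_def by (simp add: ennreal_mult)
      then show ?thesis by (simp add: r_def)
    qed
    finally show ?thesis .
  qed
  ultimately have "r * (1 - r) = 0" by (simp add: algebra_simps)
  then show ?thesis by (auto simp: r_def m_def)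
qed

text \<open>The zero-one law covers sets without \<open>N\<close> only. By invariance of heights
  \<open>N\<close> is a null set of the image when \<open>z \<noteq> N\<close>, so the law extends
  to all open sets.\<close>

lemma isometry_image_return:
  assumes \<Phi>: "pole_fixing \<Phi>" and z: "z \<in> Z"
  obtains w where "w \<in> Z" "\<Phi> (return B z) = return B w"
proof (cases "z = N")
  case True
  then show thesis using that[of N] pole_fixingD(4)[OF \<Phi>] by simp
next
  case False
  note m = pole_fixingD(2)[OF \<Phi> return_P[OF z]]
  interpret M: prob_space "\<Phi> (return B z)" using PD[OF m] by simp
  have "measure (\<Phi> (return B z)) {N} = 0"
  proof -
    have N0: "{v \<in> Z. D N v \<in> {0}} = {N}" by auto
    have "measure (return B z) {N} = 0" using z False by (simp add: measure_return)
    then show ?thesis using height_measure[OF \<Phi> return_P[OF z], of "{0}"] unfolding N0 by simp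
  qed
  then have null: "{N} \<in> null_sets (\<Phi> (return B z))"
    using PD(2)[OF m] by (intro null_setsI) (simp_all add: M.emeasure_eq_measure)
  have "measure (\<Phi> (return B z)) U = 0 \<or> measure (\<Phi> (return B z)) U = 1" if U: "openin mtopology U" for U
  proof -
    have Us: "U \<in> sets B" using U by (rule openin_borel_of)
    then have "U - {N} \<in> sets B" using NS(1) by (intro sets.Diff singleton_sets)
    from isometry_image_return_zero_one[OF \<Phi> z False this]
    have "measure (\<Phi> (return B z)) (U - {N}) \<in> {0, 1}" by simp
    then show ?thesis using measure_Diff_null_set[OF _ null] Us PD(2)[OF m] by simp
  qed
  from zero_one_imp_return[OF m this] show thesis using that by metis
qed

section \<open>Invariance of level sets and reduction to fixed Dirac measures\<close>

text \<open>The height law preserves the weight at \<open>N\<close>, and the cost to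
  \<open>z\<close> is \<open>t powr p\<close> times this weight;
  \<open>concentrated_at_two_points\<close> then excludes the other points of the same
  height.\<close>

lemma two_point_measures_fixed:
  assumes \<Phi>: "pole_fixing \<Phi>" and ret: "\<And>z. z \<in> Z \<Longrightarrow> \<Phi> (return B z) = return B z"
    and z: "z \<in> Z" and m: "m \<in> P" "AE v in m. v \<in> {N, z}"
  shows "\<Phi> m = m"
proof (cases "z = N")
  \<comment> \<open>Then all mass is at \<open>N\<close>, and \<open>m\<close> is a measure on the
    poles.\<close>
  case True
  have "AE v in m. v \<in> {N, S}" using m(2) unfolding True by eventually_elim auto
  then show ?thesis by (rule pole_measures_fixed[OF \<Phi> m(1)])
next
  case False
  note \<Phi>D = pole_fixingD[OF \<Phi>]
  define t where "t = D N z"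
  have t: "0 < t" using z False by (simp add: t_def)
  note m' = \<Phi>D(2)[OF m(1)]
  have N0: "{v \<in> Z. D N v \<in> {0}} = {N}" by auto
  have N_eq: "measure (\<Phi> m) {N} = measure m {N}"
    using height_measure[OF \<Phi> m(1), of "{0}"] unfolding N0 by simp
  have "AE v in m. D N v \<in> {0, t}" using m(2) by (auto elim: eventually_mono simp: t_def)
  then have AE_t: "AE v in \<Phi> m. D N v \<in> {0, t}" using height_AE[OF \<Phi> m(1), of "{0, t}"] by simp
  interpret M: prob_space m using PD[OF m(1)] by simp
  have "(\<integral>v. D z v powr p \<partial>\<Phi> m) = (\<integral>v. D z v powr p \<partial>m)"
    using \<Phi>D(3)[OF return_P[OF z] m(1)] ret[OF z] W_return[OF z m(1)] W_return[OF z m'] by simp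
  also have "\<dots> = (\<integral>v. t powr p * indicator {N} v \<partial>m)"
  proof (rule integral_cong_AE)
    show "(\<lambda>v. D z v powr p) \<in> borel_measurable m" using integrable_dist_P[OF m(1) z] by blast
    show "AE v in m. D z v powr p = t powr p * indicator {N} v"
      using m(2) by eventually_elim (use z False in \<open>auto simp: t_def commute[of z N]\<close>)
    have "{N} \<in> sets m" using PD(2)[OF m(1)] by simp
    then show "(\<lambda>v. t powr p * indicator {N} v) \<in> borel_measurable m" by simp
  qed
  also have "\<dots> = t powr p * measure (\<Phi> m) {N}" using N_eq PD(3)[OF m(1)] by simp
  finally have AE': "AE v in \<Phi> m. v \<in> {N, z}"
    using AE_t by (intro concentrated_at_two_points[OF m' z]) (auto simp: t_def)
  note mz = measure_two_points[OF _ _ NS(1) z False[symmetric]]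
  show ?thesis
    by (rule finite_support_eqI[OF m' AE' m]) (use z N_eq mz[OF m' AE'] mz[OF m] in auto)
qed

lemma level_sets_invariant:
  assumes \<Phi>: "pole_fixing \<Phi>" and ret: "\<And>z. z \<in> Z \<Longrightarrow> \<Phi> (return B z) = return B z"
    and z: "z \<in> Z" and \<alpha>: "\<alpha> \<in> P"
  shows "measure (\<Phi> \<alpha>) {v \<in> Z. D N v powr p - D z v powr p > c} = measure \<alpha> {v \<in> Z. D N v powr p - D z v powr p > c}"
proof (rule two_point_level_sets)
  show "\<Phi> \<alpha> \<in> P" using pole_fixingD(2)[OF \<Phi> \<alpha>] .
  fix m assume "m \<in> P" "AE v in m. v \<in> {N, z}"
  then show "W m (\<Phi> \<alpha>) = W m \<alpha>"
    using two_point_measures_fixed[OF \<Phi> ret z] pole_fixingD(3)[OF \<Phi> _ \<alpha>, of m] by simp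
qed (use z \<alpha> in auto)

lemma isometry_of_returns:
  assumes \<Phi>: "pole_fixing \<Phi>"
  obtains \<phi> where "is_isometry Z D \<phi>" "\<phi> N = N" "\<phi> S = S" "\<And>z. z \<in> Z \<Longrightarrow> \<Phi> (return B z) = return B (\<phi> z)"
proof -
  note \<Phi>D = pole_fixingD[OF \<Phi>]
  have "\<exists>w. w \<in> Z \<and> \<Phi> (return B z) = return B w" if "z \<in> Z" for z
    using isometry_image_return[OF \<Phi> that] by metis
  then obtain \<phi> where \<phi>: "\<And>z. z \<in> Z \<Longrightarrow> \<phi> z \<in> Z" "\<And>z. z \<in> Z \<Longrightarrow> \<Phi> (return B z) = return B (\<phi> z)"
    by metis
  have inj: "a = b" if "a \<in> Z" "b \<in> Z" "return B a = return B b" for a b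
    using W_return_return[of a b] W_return_return[of a a] that by simp
  have iso: "D (\<phi> z) (\<phi> w) = D z w" if "z \<in> Z" "w \<in> Z" for z w
    using \<Phi>D(3)[OF return_P[OF that(1)] return_P[OF that(2)]] W_return_return \<phi> that by simp
  \<comment> \<open>Surjectivity holds because the inverse of \<open>\<Phi>\<close> also maps Dirac
    measures to Dirac measures.\<close>
  have "\<exists>z\<in>Z. \<phi> z = w" if w: "w \<in> Z" for w
  proof -
    obtain z where z: "z \<in> Z" "inv_into P \<Phi> (return B w) = return B z"
      using isometry_image_return[OF pole_fixing_inv_into[OF \<Phi>] w] .
    have "return B w \<in> \<Phi> ` P" using return_P[OF w] \<Phi>D(1) by (simp add: is_isometry_def)
    then have "\<Phi> (return B z) = return B w" using f_inv_into_f[of "return B w" \<Phi> P] z(2) by simp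
    then show ?thesis using inj z w \<phi> by (metis)
  qed
  then have "is_isometry Z D \<phi>" using \<phi>(1) iso by (auto simp: is_isometry_def image_iff)
  moreover have "\<phi> N = N" "\<phi> S = S" using \<phi> \<Phi>D(4,5) inj NS by metis+
  ultimately show thesis using that \<phi>(2) by blast
qed

lemma level_measure:
  assumes \<Phi>: "pole_fixing \<Phi>" and ret: "\<And>z. z \<in> Z \<Longrightarrow> \<Phi> (return B z) = return B z"
    and z: "z \<in> Z" and \<alpha>: "\<alpha> \<in> P" and T: "T \<in> sets borel"
  shows "measure (\<Phi> \<alpha>) {v \<in> Z. D N v powr p - D z v powr p \<in> T} = measure \<alpha> {v \<in> Z. D N v powr p - D z v powr p \<in> T}"
proof -
  define u where "u v = D N v powr p - D z v powr p" for v
  note \<beta> = pole_fixingD(2)[OF \<Phi> \<alpha>]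
  have um: "u \<in> borel_measurable B"
    unfolding u_def using dist_measurable[OF NS(1)] dist_measurable[OF z] by measurable
  have eq: "distr (\<Phi> \<alpha>) borel u = distr \<alpha> borel u"
    using level_sets_invariant[OF \<Phi> ret z \<alpha>] by (intro distr_eqI_greater \<beta> \<alpha> um) (simp add: u_def)
  have *: "measure \<mu> {v \<in> Z. u v \<in> T} = measure (distr \<mu> borel u) T" if \<mu>: "\<mu> \<in> P" for \<mu>
  proof -
    have "u -` T \<inter> space \<mu> = {v \<in> Z. u v \<in> T}" using PD(3)[OF \<mu>] by auto
    then show ?thesis using \<mu> T um by (simp add: measure_distr)
  qed
  have "measure (\<Phi> \<alpha>) {v \<in> Z. u v \<in> T} = measure \<alpha> {v \<in> Z. u v \<in> T}"
    unfolding *[OF \<alpha>] *[OF \<beta>] eq ..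
  then show ?thesis by (simp add: u_def)
qed

lemma distr_return_isometry:
  assumes "is_isometry Z D \<phi>" "z \<in> Z"
  shows "distr (return B z) B \<phi> = return B (\<phi> z)"
  using distr_return[OF isometry_measurable[OF assms(1)]] assms(2) by simp

text \<open>Normalisation in two steps: \<open>\<sigma>\<close> reduces to isometries that fix the
  poles, and the inverse of the induced isometry of \<open>Z\<close> to those that fix all Dirac
  measures.\<close>

lemma rigid_if_returns_determine:
  assumes \<sigma>: "is_isometry Z D \<sigma>" "\<sigma> N = S" "\<sigma> S = N"
    and det: "\<And>\<Phi> \<mu>. pole_fixing \<Phi> \<Longrightarrow> (\<And>z. z \<in> Z \<Longrightarrow> \<Phi> (return B z) = return B z) \<Longrightarrow> \<mu> \<in> P \<Longrightarrow> \<Phi> \<mu> = \<mu>"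
  shows "isometrically_rigid p Z D"
proof -
  have fixing: "\<exists>\<phi>. is_isometry Z D \<phi> \<and> (\<forall>\<mu>\<in>P. \<Phi> \<mu> = distr \<mu> B \<phi>)" if \<Phi>: "pole_fixing \<Phi>" for \<Phi>
  proof -
    note \<Phi>D = pole_fixingD[OF \<Phi>]
    obtain \<phi> where \<phi>: "is_isometry Z D \<phi>" "\<phi> N = N" "\<phi> S = S" "\<And>z. z \<in> Z \<Longrightarrow> \<Phi> (return B z) = return B (\<phi> z)"
      using isometry_of_returns[OF \<Phi>] by metis
    let ?\<psi> = "inv_into Z \<phi>"
    note \<psi> = isometry_inv_into[OF \<phi>(1)]
    have inv: "?\<psi> (\<phi> z) = z" if "z \<in> Z" for z using inv_into_f_f[OF isometry_inj[OF \<phi>(1)] that] .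
    have \<phi>Z: "\<phi> z \<in> Z" if "z \<in> Z" for z using \<phi>(1) that by (auto simp: is_isometry_def)
    define \<Phi>' where "\<Phi>' \<mu> = distr (\<Phi> \<mu>) B ?\<psi>" for \<mu>
    have iso: "is_isometry P W \<Phi>'"
      unfolding \<Phi>'_def by (rule is_isometry_comp[OF isometry_distr[OF \<psi>] \<Phi>D(1)])
    have ret: "\<Phi>' (return B z) = return B z" if "z \<in> Z" for z
      using that distr_return_isometry[OF \<psi> \<phi>Z[OF that]] inv by (simp add: \<Phi>'_def \<phi>(4))
    have "pole_fixing \<Phi>'" using iso ret by (simp add: pole_fixing_def)
    then have id: "\<Phi>' \<mu> = \<mu>" if "\<mu> \<in> P" for \<mu> using det ret that by blast
    have "\<Phi> \<mu> = distr \<mu> B \<phi>" if "\<mu> \<in> P" for \<mu>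
      using distr_inv_isometry(2)[OF \<phi>(1) \<Phi>D(2)[OF that]] id[OF that] by (simp add: \<Phi>'_def)
    then show ?thesis using \<phi>(1) by blast
  qed
  have "\<exists>\<phi>. is_isometry Z D \<phi> \<and> (\<forall>\<mu>\<in>P. \<Phi> \<mu> = distr \<mu> B \<phi>)" if \<Phi>: "is_isometry P W \<Phi>" for \<Phi>
  proof (cases "pole_fixing \<Phi>")
    case True
    then show ?thesis by (rule fixing)
  next
    case False
    then have sw: "\<Phi> (return B N) = return B S" "\<Phi> (return B S) = return B N"
      using isometry_poles[OF \<Phi>] by auto
    define \<Phi>' where "\<Phi>' \<mu> = distr (\<Phi> \<mu>) B \<sigma>" for \<mu>
    have "is_isometry P W \<Phi>'"
      unfolding \<Phi>'_def by (rule is_isometry_comp[OF isometry_distr[OF \<sigma>(1)] \<Phi>])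
    moreover have "\<Phi>' (return B N) = return B N" "\<Phi>' (return B S) = return B S"
      using distr_return_isometry[OF \<sigma>(1)] \<sigma>(2,3) sw by (simp_all add: \<Phi>'_def)
    ultimately have "pole_fixing \<Phi>'" by (simp add: pole_fixing_def)
    from fixing[OF this] obtain \<phi> where \<phi>: "is_isometry Z D \<phi>" "\<forall>\<mu>\<in>P. \<Phi>' \<mu> = distr \<mu> B \<phi>" by blast
    note \<sigma>' = isometry_inv_into[OF \<sigma>(1)]
    have "\<Phi> \<mu> = distr \<mu> B (\<lambda>z. inv_into Z \<sigma> (\<phi> z))" if \<mu>: "\<mu> \<in> P" for \<mu>
    proof -
      have "\<Phi> \<mu> = distr (\<Phi>' \<mu>) B (inv_into Z \<sigma>)"
        unfolding \<Phi>'_def by (rule distr_inv_isometry(1)[OF \<sigma>(1) isometry_PD(1)[OF \<Phi> \<mu>], symmetric])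
      also have "\<dots> = distr (distr \<mu> B \<phi>) B (inv_into Z \<sigma>)" using \<phi>(2) \<mu> by simp
      also have "\<dots> = distr \<mu> B (\<lambda>z. inv_into Z \<sigma> (\<phi> z))"
        using distr_distr[OF isometry_measurable[OF \<sigma>'], of \<phi> \<mu>] isometry_measurable[OF \<phi>(1)] \<mu> by (simp add: o_def)
      finally show ?thesis .
    qed
    then show ?thesis using is_isometry_comp[OF \<sigma>' \<phi>(1)] by blast
  qed
  then show ?thesis by (simp add: isometrically_rigid_def)
qed

end

section \<open>Rigidity of spherical suspensions\<close>

context suspension
begin

section \<open>Coordinates, flip and meridians\<close>

definition pN :: "('a \<times> real) set" where "pN = pt (SOME x. x \<in> X) 0"
definition pS :: "('a \<times> real) set" where "pS = pt (SOME x. x \<in> X) pi"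
text \<open>The meridian coordinate, determined only off the poles; at a pole it is some point of
  \<open>X\<close>.\<close>

definition xc :: "('a \<times> real) set \<Rightarrow> 'a" where "xc z = (SOME x. x \<in> X \<and> (\<exists>t\<in>{0..pi}. z = pt x t))"

lemma some_X: "(SOME x. x \<in> X) \<in> X"
  using X_ne by (simp add: some_in_eq)

lemma pt_0: "x \<in> X \<Longrightarrow> pt x 0 = pN" and pt_pi: "x \<in> X \<Longrightarrow> pt x pi = pS"
  using pt_pole[OF _ some_X] by (simp_all add: pN_def pS_def)

lemma poles_in_Z: "pN \<in> Z" "pS \<in> Z"
  using some_X by (simp_all add: pN_def pS_def)

lemma D_poles:
  assumes "x \<in> X" "0 \<le> t" "t \<le> pi"
  shows "D pN (pt x t) = t" "D pS (pt x t) = pi - t"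
  using D_pt_same[of x 0 t] D_pt_same[of x pi t] assms by (simp_all add: pt_0 pt_pi)

text \<open>As \<open>cos (d x y) > 0\<close>, the mixed term of the cosine law is nonnegative, so
  distance \<open>pi\<close> forces \<open>cos t * cos s \<le> -1\<close>, which happens only at
  opposite poles.\<close>

lemma antipodal:
  assumes "z \<in> Z" "w \<in> Z" "D z w = pi"
  shows "z = pN \<and> w = pS \<or> z = pS \<and> w = pN"
proof -
  obtain x t where x: "x \<in> X" "0 \<le> t" "t \<le> pi" "z = pt x t" using assms(1) by (rule Z_cases)
  obtain y s where y: "y \<in> X" "0 \<le> s" "s \<le> pi" "w = pt y s" using assms(2) by (rule Z_cases)
  have "cos (D z w) = sph_cos t s (d x y)"
    using x y D_pt[of x y t s] sph_cos_bounds by (simp add: cos_arccos)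
  then have "sph_cos t s (d x y) = -1" using assms(3) by simp
  moreover have "0 \<le> sin t * sin s * cos (d x y)"
    using x y cos_d_pos[OF x(1) y(1)] by (intro mult_nonneg_nonneg sin_ge_zero) auto
  ultimately have prod: "cos t * cos s \<le> -1" by (simp add: sph_cos_def)
  have "cos t = 1 \<and> cos s = -1 \<or> cos t = -1 \<and> cos s = 1"
  proof -
    have "\<bar>cos t\<bar> * \<bar>cos s\<bar> \<ge> 1" using prod by (simp flip: abs_mult)
    moreover have "\<bar>cos t\<bar> * \<bar>cos s\<bar> \<le> \<bar>cos t\<bar> * 1" "\<bar>cos t\<bar> * \<bar>cos s\<bar> \<le> 1 * \<bar>cos s\<bar>"
      using abs_cos_le_one[of t] abs_cos_le_one[of s] by (intro mult_left_mono mult_right_mono; simp)+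
    ultimately have "\<bar>cos t\<bar> = 1" "\<bar>cos s\<bar> = 1" using abs_cos_le_one[of t] abs_cos_le_one[of s] by linarith+
    then show ?thesis using prod by (auto simp: abs_if split: if_splits)
  qed
  moreover have "r = 0" if "cos r = 1" "0 \<le> r" "r \<le> pi" for r using cos_inj_pi[of r 0] that by simp
  moreover have "r = pi" if "cos r = -1" "0 \<le> r" "r \<le> pi" for r using cos_inj_pi[of r pi] that by simp
  ultimately have "t = 0 \<and> s = pi \<or> t = pi \<and> s = 0" using x y by blast
  then show ?thesis using x y pt_0 pt_pi by auto
qed

lemma pt_eq_iff:
  assumes "x \<in> X" "y \<in> X" "0 < t" "t < pi" "0 \<le> s" "s \<le> pi" "pt x t = pt y s"
  shows "x = y" "t = s"
proof -
  have "((x, t), (y, s)) \<in> susp_rel X"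
    using assms eq_equiv_class[OF _ equiv_susp_rel[of X]] by (auto simp: pt_def)
  then show "x = y" "t = s" using assms by (auto simp: susp_rel_def)
qed

lemma xc_pt: "x \<in> X \<Longrightarrow> 0 < t \<Longrightarrow> t < pi \<Longrightarrow> xc (pt x t) = x"
  unfolding xc_def by (rule some_equality) (auto dest: pt_eq_iff intro!: bexI[of _ t])

lemma xc: "z \<in> Z \<Longrightarrow> xc z \<in> X \<and> z = pt (xc z) (D pN z)"
proof -
  assume "z \<in> Z"
  then obtain x t where x: "x \<in> X" "0 \<le> t" "t \<le> pi" "z = pt x t" by (rule Z_cases)
  then have "\<exists>x. x \<in> X \<and> (\<exists>t\<in>{0..pi}. z = pt x t)"
    by (intro exI[of _ x] conjI bexI[of _ t]) auto
  from someI_ex[OF this] have "xc z \<in> X \<and> (\<exists>t\<in>{0..pi}. z = pt (xc z) t)" unfolding xc_def .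
  then obtain s where s: "xc z \<in> X" "s \<in> {0..pi}" "z = pt (xc z) s" by blast
  then have "D pN z = s" using D_poles(1)[of "xc z" s] by simp
  then show ?thesis using s by simp
qed

definition flip :: "('a \<times> real) set \<Rightarrow> ('a \<times> real) set" where "flip z = pt (xc z) (pi - D pN z)"

lemma flip_pt: "x \<in> X \<Longrightarrow> 0 \<le> t \<Longrightarrow> t \<le> pi \<Longrightarrow> flip (pt x t) = pt x (pi - t)"
proof -
  assume x: "x \<in> X" "0 \<le> t" "t \<le> pi"
  have xX: "xc (pt x t) \<in> X" using xc[of "pt x t"] x by simp
  consider "t = 0" | "t = pi" | "0 < t" "t < pi" using x by fastforce
  then show ?thesis
  proof cases
    case 3
    then show ?thesis using x xc_pt[of x t] by (simp add: flip_def D_poles)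
  qed (use x xX D_poles(1)[OF x] pt_0 pt_pi in \<open>auto simp: flip_def\<close>)
qed

lemma flip_isometry: "is_isometry Z D flip"
  unfolding is_isometry_def
proof (intro conjI ballI)
  have "flip z \<in> Z \<and> flip (flip z) = z" if "z \<in> Z" for z
    using that by (rule Z_cases) (simp add: flip_pt)
  then show "flip ` Z = Z" by force
  fix z w assume zw: "z \<in> Z" "w \<in> Z"
  obtain x t where x: "x \<in> X" "0 \<le> t" "t \<le> pi" "z = pt x t" using zw(1) by (rule Z_cases)
  obtain y s where y: "y \<in> X" "0 \<le> s" "s \<le> pi" "w = pt y s" using zw(2) by (rule Z_cases)
  show "D (flip z) (flip w) = D z w"
    using x y by (simp add: flip_pt D_pt sph_cos_def)
qed

lemma flip_poles: "flip pN = pS" "flip pS = pN"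
  using flip_pt[OF some_X, of 0] flip_pt[OF some_X, of pi] some_X by (simp_all add: pt_0 pt_pi)

lemma bipolar_Z: "1 < p \<Longrightarrow> bipolar Z D p pN pS pi"
proof unfold_locales
  fix z assume "z \<in> Z"
  then show "D pN z + D pS z = pi" by (rule Z_cases) (simp add: D_poles)
qed (use compact_Z poles_in_Z antipodal in auto)

text \<open>Recognises meridians metrically, as the equality case of
  \<open>D_ge_height_diff\<close>.\<close>

lemma D_meridian_eq:
  assumes z: "z \<in> Z" "0 < D pN z" "D pN z < pi" and y: "y \<in> X" "0 < s" "s < pi"
    and eq: "D (pt y s) z = \<bar>D pN z - s\<bar>"
  shows "z = pt y (D pN z)"
proof -
  define t where "t = D pN z"
  have x: "xc z \<in> X" "z = pt (xc z) t" using xc[OF z(1)] by (auto simp: t_def)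
  have "cos \<bar>t - s\<bar> = cos (arccos (sph_cos s t (d y (xc z))))"
    using eq D_pt[of y "xc z" s t] x y z by (simp flip: t_def)
  then have "sph_cos s t (d y (xc z)) = cos (s - t)"
    using sph_cos_bounds by (simp add: cos_arccos) (metis cos_minus minus_diff_eq)
  then have "y = xc z" using z y x by (intro sph_cos_eq_cos_diff[of s t]) (auto simp: t_def)
  then show ?thesis using x by (simp add: t_def)
qed

lemma D_ge_height_diff: "z \<in> Z \<Longrightarrow> w \<in> Z \<Longrightarrow> \<bar>D pN z - D pN w\<bar> \<le> D w z"
  using D_triangle[of pN w z] D_triangle[of pN z w] poles_in_Z Z.commute[of z w] by (auto simp: abs_le_iff)

text \<open>The bisector of the points at heights \<open>0\<close> and \<open>pi - 2 * arctan c\<close> on a meridian meets it at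
  the height with cotangent \<open>c\<close>.\<close>
lemma bisector:
  assumes x: "x \<in> X" "y \<in> X" and t: "0 < t" "t < pi"
  shows "0 \<le> c \<Longrightarrow> D pN (pt y t) > D (pt x (pi - 2 * arctan c)) (pt y t) \<longleftrightarrow> cos t < c * (sin t * cos (d x y))"
    and "c \<le> 0 \<Longrightarrow> D pS (pt y t) > D (pt x (- 2 * arctan c)) (pt y t) \<longleftrightarrow> cos t > c * (sin t * cos (d x y))"
proof -
  define a where "a = arctan c"
  define k where "k = sin t * cos (d x y)"
  have a: "- (pi / 2) < a" "a < pi / 2" "tan a = c" using arctan[of c] by (auto simp: a_def)
  have ca: "0 < cos a" using a by (intro cos_gt_zero_pi) auto
  have sa: "sin a = c * cos a" using a ca by (simp add: tan_def field_simps)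
  \<comment> \<open>The double-angle formulas give both sides of the comparison the positive factor
    \<open>2 * cos a * cos a\<close>, which cancels.\<close>
  have cos2: "1 + cos (2 * a) = 2 * cos a * cos a" by (simp add: cos_double_cos power2_eq_square)
  have sin2: "sin (2 * a) = 2 * cos a * cos a * c" by (simp add: sin_double sa)
  have pos: "0 < 2 * cos a * cos a" using ca by simp
  {
    assume "0 \<le> c"
    then have a0: "0 \<le> a" by (simp add: a_def)
    have "D (pt x (pi - 2 * a)) (pt y t) = arccos (sph_cos (pi - 2 * a) t (d x y))"
      using x t a a0 by (intro D_pt) auto
    moreover have "D pN (pt y t) = arccos (cos t)" using x t D_poles by (simp add: arccos_cos)
    ultimately have "D pN (pt y t) > D (pt x (pi - 2 * a)) (pt y t) \<longleftrightarrow> cos t < sph_cos (pi - 2 * a) t (d x y)"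
      using arccos_less_mono[of "sph_cos (pi - 2 * a) t (d x y)" "cos t"] sph_cos_bound by simp
    also have "\<dots> \<longleftrightarrow> (1 + cos (2 * a)) * cos t < sin (2 * a) * k"
      by (simp add: sph_cos_def k_def algebra_simps)
    also have "\<dots> \<longleftrightarrow> (2 * cos a * cos a) * cos t < (2 * cos a * cos a) * (c * k)"
      unfolding cos2 sin2 by (simp add: mult.assoc)
    also have "\<dots> \<longleftrightarrow> cos t < c * k" using mult_less_cancel_left_pos[OF pos] by blast
    finally show "D pN (pt y t) > D (pt x (pi - 2 * arctan c)) (pt y t) \<longleftrightarrow> cos t < c * (sin t * cos (d x y))"
      by (simp add: a_def k_def)
  }
  {
    assume "c \<le> 0"
    then have a0: "a \<le> 0" by (simp add: a_def)
    have "D (pt x (- 2 * a)) (pt y t) = arccos (sph_cos (- 2 * a) t (d x y))"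
      using x t a a0 by (intro D_pt) auto
    moreover have "D pS (pt y t) = arccos (- cos t)"
      using x t D_poles arccos_minus[of "cos t"] by (simp add: arccos_cos)
    ultimately have "D pS (pt y t) > D (pt x (- 2 * a)) (pt y t) \<longleftrightarrow> - cos t < sph_cos (- 2 * a) t (d x y)"
      using arccos_less_mono[of "sph_cos (- 2 * a) t (d x y)" "- cos t"] sph_cos_bound by simp
    also have "\<dots> \<longleftrightarrow> sin (2 * a) * k < (1 + cos (2 * a)) * cos t"
      by (simp add: sph_cos_def k_def algebra_simps)
    also have "\<dots> \<longleftrightarrow> (2 * cos a * cos a) * (c * k) < (2 * cos a * cos a) * cos t"
      unfolding cos2 sin2 by (simp add: mult.assoc)
    also have "\<dots> \<longleftrightarrow> c * k < cos t" using mult_less_cancel_left_pos[OF pos] by blast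
    finally show "D pS (pt y t) > D (pt x (- 2 * arctan c)) (pt y t) \<longleftrightarrow> cos t > c * (sin t * cos (d x y))"
      by (simp add: a_def k_def)
  }
qed

end

locale suspension_wasserstein = suspension +
  fixes p :: real
  assumes p: "1 < p"

sublocale suspension_wasserstein \<subseteq> Z: bipolar Z D p pN pS pi
  by (rule bipolar_Z[OF p])

context suspension_wasserstein
begin

section \<open>Measures on slices and grids\<close>

text \<open>At height \<open>s\<close> the level
  \<open>D pN v powr p - D w v powr p = s powr p\<close> contains only \<open>v = w\<close>, so
  invariance of levels preserves the weight of each atom.\<close>

lemma slice_measures_fixed:
  assumes \<Phi>: "Z.pole_fixing \<Phi>" and ret: "\<And>z. z \<in> Z \<Longrightarrow> \<Phi> (return Z.B z) = return Z.B z"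
    and F: "finite F" "F \<subseteq> X" and s: "0 < s" "s < pi"
    and \<theta>: "\<theta> \<in> Z.P" "AE z in \<theta>. z \<in> (\<lambda>x. pt x s) ` F"
  shows "\<Phi> \<theta> = \<theta>"
proof -
  define A where "A = (\<lambda>x. pt x s) ` F"
  note \<theta>' = Z.pole_fixingD(2)[OF \<Phi> \<theta>(1)]
  have A: "finite A" "A \<subseteq> Z" using F s by (auto simp: A_def)
  have hA: "D pN w = s" if "w \<in> A" for w using that F s by (auto simp: A_def D_poles)
  have AE_A: "AE z in \<theta>. z \<in> A" using \<theta>(2) by (simp add: A_def)
  have h: "AE z in \<theta>. D pN z \<in> {s}" using AE_A by eventually_elim (simp add: hA)
  then have h': "AE z in \<Phi> \<theta>. D pN z \<in> {s}" using Z.height_AE[OF \<Phi> \<theta>(1), of "{s}"] by simp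
  have eq: "measure (\<Phi> \<theta>) {w} = measure \<theta> {w}" if w: "w \<in> A" for w
  proof -
    have wZ: "w \<in> Z" using A w by auto
    let ?E = "{v \<in> Z. D pN v powr p - D w v powr p \<in> {s powr p}}"
    have "measure \<mu> ?E = measure \<mu> {w}" if \<mu>: "\<mu> \<in> Z.P" "AE z in \<mu>. D pN z \<in> {s}" for \<mu>
    proof -
      interpret prob_space \<mu> using Z.PD[OF \<mu>(1)] by simp
      have um: "(\<lambda>v. D pN v powr p - D w v powr p) \<in> borel_measurable Z.B"
        using Z.dist_measurable[OF wZ] Z.dist_measurable[OF poles_in_Z(1)] by measurable
      have Eq: "(\<lambda>v. D pN v powr p - D w v powr p) -` {s powr p} \<inter> space Z.B = ?E" by auto
      have E: "?E \<in> sets Z.B" unfolding Eq[symmetric] by (rule measurable_sets[OF um]) (rule borel_singleton[OF sets.empty_sets])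
      show ?thesis
      proof (rule finite_measure_eq_AE)
        show "AE z in \<mu>. (z \<in> ?E) = (z \<in> {w})"
          using \<mu>(2) AE_space by eventually_elim (use wZ hA[OF w] Z.PD(3)[OF \<mu>(1)] in auto)
      qed (use E Z.singleton_sets[OF wZ] in \<open>simp_all only: Z.PD(2)[OF \<mu>(1)]\<close>)
    qed
    then show ?thesis
      using Z.level_measure[OF \<Phi> ret wZ \<theta>(1), of "{s powr p}"] \<theta>(1) \<theta>' h h' by simp
  qed
  have sum: "measure \<mu> A = (\<Sum>w\<in>A. measure \<mu> {w})" if "\<mu> \<in> Z.P" for \<mu>
    using Z.PD(2,4)[OF that] A by (intro finite_measure.finite_measure_eq_sum_singleton) auto
  \<comment> \<open>The atoms keep their weights, which already add up to one, so no mass is left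
    outside \<open>A\<close>.\<close>
  have "measure (\<Phi> \<theta>) A = measure \<theta> A" using eq sum \<theta>(1) \<theta>' by simp
  then have "AE z in \<Phi> \<theta>. z \<in> A"
    using Z.measure_eq_1_iff[OF \<theta>(1) Z.finite_sets[OF A]] Z.measure_eq_1_iff[OF \<theta>' Z.finite_sets[OF A]] AE_A by simp
  then show ?thesis by (rule Z.finite_support_eqI[OF \<theta>' _ \<theta>(1) AE_A A eq])
qed

definition grid :: "'a set \<Rightarrow> real set \<Rightarrow> ('a \<times> real) set set" where
  "grid F T = (\<lambda>(x, t). pt x t) ` (F \<times> T)"

lemma grid_props:
  assumes "F \<subseteq> X" "T \<subseteq> {0<..<pi}" "z \<in> grid F T"
  shows "z \<in> Z" "xc z \<in> F" "D pN z \<in> T" "z = pt (xc z) (D pN z)"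
  using assms by (auto simp: grid_def xc_pt D_poles subset_iff)

text \<open>The measure is compared with its projection \<open>\<theta>\<close> along meridians to
  one slice, which \<open>\<Phi>\<close> fixes. Heights bound the cost between
  \<open>\<theta>\<close> and the image from below, and equality is possible only on the meridians
  through \<open>A\<close>.\<close>

lemma grid_invariant:
  assumes \<Phi>: "Z.pole_fixing \<Phi>" and ret: "\<And>z. z \<in> Z \<Longrightarrow> \<Phi> (return Z.B z) = return Z.B z"
    and F: "finite F" "F \<subseteq> X" and T: "finite T" "T \<subseteq> {0<..<pi}"
    and \<alpha>: "\<alpha> \<in> Z.P" "AE z in \<alpha>. z \<in> grid F T"
  shows "AE z in \<Phi> \<alpha>. z \<in> grid F T"
proof -
  \<comment> \<open>Any height strictly between the poles would serve for the slice.\<close>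
  define s where "s = pi / 2"
  have s: "0 < s" "s < pi" by (simp_all add: s_def)
  note \<beta> = Z.pole_fixingD(2)[OF \<Phi> \<alpha>(1)]
  note gp = grid_props[OF F(2) T(2)]
  let ?G = "grid F T"
  interpret A: prob_space \<alpha> using Z.PD[OF \<alpha>(1)] by simp
  interpret B: prob_space "\<Phi> \<alpha>" using Z.PD[OF \<beta>] by simp
  have G: "finite ?G" "?G \<subseteq> Z" using F T gp by (auto simp: grid_def)
  have "F \<noteq> {}"
  proof
    assume "F = {}"
    then have "AE z in \<alpha>. False" using \<alpha>(2) by (simp add: grid_def)
    then show False by (simp add: A.AE_False)
  qed
  then obtain x1 where x1: "x1 \<in> F" by blast
  define A where "A = (\<lambda>x. pt x s) ` F"
  have A: "finite A" "A \<noteq> {}" "A \<subseteq> Z" using F \<open>F \<noteq> {}\<close> s by (auto simp: A_def)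
  \<comment> \<open>Slides grid points along their meridians to height \<open>s\<close>; off the
    grid, a null set of \<open>\<alpha>\<close>, the value is arbitrary in \<open>A\<close>.\<close>
  define f where "f z = (if z \<in> ?G then pt (xc z) s else pt x1 s)" for z
  have fA: "f z \<in> A" for z using gp x1 by (auto simp: f_def A_def)
  have f: "f \<in> \<alpha> \<rightarrow>\<^sub>M Z.B"
    unfolding f_def Z.measurable_P[OF \<alpha>(1)]
    using G gp x1 F s by (intro Z.measurable_finite_exception) (auto simp: subset_iff)
  define \<theta> where "\<theta> = distr \<alpha> Z.B f"
  have \<theta>: "\<theta> \<in> Z.P" unfolding \<theta>_def by (rule Z.distr_P[OF A.prob_space_axioms f])
  have As: "A \<in> sets Z.B" using A by (intro Z.finite_sets) auto
  have "{z \<in> space Z.B. z \<in> A} = A" using A by auto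
  then have AE_\<theta>: "AE z in \<theta>. z \<in> A"
    unfolding \<theta>_def using As fA by (subst AE_distr_iff[OF f]) auto
  have \<Phi>\<theta>: "\<Phi> \<theta> = \<theta>"
    by (rule slice_measures_fixed[OF \<Phi> ret F s \<theta>]) (use AE_\<theta> in \<open>simp_all add: A_def\<close>)
  define g where "g r = \<bar>r - s\<bar> powr p" for r
  have gm: "g \<in> borel_measurable borel" unfolding g_def by measurable
  have gi: "integrable (\<Phi> \<alpha>) (\<lambda>z. g (D pN z))"
  proof (rule B.integrable_const_bound[where B="pi powr p"])
    show "AE z in \<Phi> \<alpha>. norm (g (D pN z)) \<le> pi powr p"
    proof (rule AE_I2)
      fix z assume "z \<in> space (\<Phi> \<alpha>)"
      then have "z \<in> Z" using Z.PD(3)[OF \<beta>] by simp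
      then have "\<bar>D pN z - s\<bar> \<le> pi" using Z.D_N_le[of z] Z.nonneg[of pN z] s by linarith
      then show "norm (g (D pN z)) \<le> pi powr p" using p by (auto simp: g_def intro!: powr_mono2)
    qed
    show "(\<lambda>z. g (D pN z)) \<in> borel_measurable (\<Phi> \<alpha>)"
      using measurable_compose[OF Z.dist_measurable[OF poles_in_Z(1)] gm] \<beta> by simp
  qed
  define \<rho> where "\<rho> z = (MIN w\<in>A. D w z)" for z
  note low = Z.W_finite_support_lower[OF \<theta> AE_\<theta> A \<beta>, folded \<rho>_def]
  \<comment> \<open>Sliding moves a point exactly by its height difference to \<open>s\<close>, and
    the law of heights is the same for \<open>\<alpha>\<close> and
    \<open>\<Phi> \<alpha>\<close>.\<close>
  have W_le: "(\<integral>z. \<rho> z powr p \<partial>\<Phi> \<alpha>) \<le> (\<integral>z. g (D pN z) \<partial>\<Phi> \<alpha>)"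
  proof -
    have "(\<integral>z. \<rho> z powr p \<partial>\<Phi> \<alpha>) \<le> Z.W (\<Phi> \<theta>) (\<Phi> \<alpha>) powr p" unfolding \<Phi>\<theta> by (rule low)
    also have "\<dots> = Z.W \<theta> \<alpha> powr p" using Z.pole_fixingD(3)[OF \<Phi> \<theta> \<alpha>(1)] by simp
    also have "\<dots> \<le> (\<integral>z. D (f z) z powr p \<partial>\<alpha>)"
      using Z.W_upper[OF A.prob_space_axioms f, of "\<lambda>z. z"] \<alpha>(1) by (simp add: Z.distr_P_id \<theta>_def)
    also have "\<dots> = (\<integral>z. g (D pN z) \<partial>\<alpha>)"
    proof (rule integral_cong_AE)
      show "(\<lambda>z. D (f z) z powr p) \<in> borel_measurable \<alpha>"
        using f \<alpha>(1) by (intro powr_real_measurable Z.dist_measurable_Pair) auto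
      show "(\<lambda>z. g (D pN z)) \<in> borel_measurable \<alpha>"
        using measurable_compose[OF Z.dist_measurable[OF poles_in_Z(1)] gm] \<alpha>(1) by simp
      show "AE z in \<alpha>. D (f z) z powr p = g (D pN z)"
        using \<alpha>(2)
      proof eventually_elim
        case (elim z)
        have "D (pt (xc z) s) (pt (xc z) (D pN z)) = \<bar>s - D pN z\<bar>"
          using gp[OF elim] F T s by (intro D_pt_same) auto
        then show ?case using elim gp(4)[OF elim] by (simp add: f_def g_def abs_minus_commute)
      qed
    qed
    also have "\<dots> = (\<integral>z. g (D pN z) \<partial>\<Phi> \<alpha>)" by (rule Z.height_integral[OF \<Phi> \<alpha>(1) gm, symmetric])
    finally show ?thesis .
  qed
  have \<rho>_ex: "\<exists>x\<in>F. \<rho> z = D (pt x s) z" for z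
  proof -
    have "\<rho> z \<in> (\<lambda>w. D w z) ` A" unfolding \<rho>_def using A by (intro Min_in) auto
    then show ?thesis by (auto simp: A_def)
  qed
  have g_le: "g (D pN z) \<le> \<rho> z powr p" if z: "z \<in> Z" for z
  proof -
    obtain x where x: "x \<in> F" "\<rho> z = D (pt x s) z" using \<rho>_ex by blast
    have "\<bar>D pN z - s\<bar> \<le> \<rho> z"
      using D_ge_height_diff[OF z, of "pt x s"] x F s by (auto simp: D_poles)
    then show ?thesis using p by (auto simp: g_def intro!: powr_mono2)
  qed
  \<comment> \<open>Pointwise \<open>g (D pN z)\<close> is the smaller quantity, yet its integral is
    not smaller.\<close>
  have "AE z in \<Phi> \<alpha>. g (D pN z) = \<rho> z powr p"
    using gi low(1) W_le g_le Z.PD(3)[OF \<beta>] by (intro B.integral_eq_AE_eq AE_I2) auto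
  moreover have "AE z in \<alpha>. D pN z \<in> T" using \<alpha>(2) by eventually_elim (rule gp(3))
  then have "AE z in \<Phi> \<alpha>. D pN z \<in> T" using Z.height_AE[OF \<Phi> \<alpha>(1), of T] borel_closed[OF finite_imp_closed[OF T(1)]] by simp
  ultimately show ?thesis
    using AE_space
  proof eventually_elim
    case (elim z)
    then have z: "z \<in> Z" using Z.PD(3)[OF \<beta>] by simp
    obtain x where x: "x \<in> F" "\<rho> z = D (pt x s) z" using \<rho>_ex by blast
    have "\<bar>D pN z - s\<bar> = D (pt x s) z"
      by (rule Z.powr_p_cancel[OF abs_ge_zero Z.nonneg]) (use elim(1) in \<open>simp add: g_def x(2)\<close>)
    then have "z = pt x (D pN z)"
      using z elim(2) T x F s by (intro D_meridian_eq[OF z _ _ _ s]) auto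
    then show ?case using x elim(2) by (force simp: grid_def)
  qed
qed

text \<open>Level sets of the projection to the meridian of \<open>x0\<close> are cut out by
  bisectors and so keep their measure; by the choice of \<open>x0\<close> the projection is
  injective on the grid.\<close>

lemma grid_measures_fixed:
  assumes \<Phi>: "Z.pole_fixing \<Phi>" and ret: "\<And>z. z \<in> Z \<Longrightarrow> \<Phi> (return Z.B z) = return Z.B z"
    and F: "finite F" "F \<subseteq> X" and T: "finite T" "T \<subseteq> {0<..<pi}" "pi / 2 \<notin> T"
    and x0: "x0 \<in> X" "inj_on (\<lambda>(x, t). tan t * cos (d x0 x)) (F \<times> T)"
    and \<alpha>: "\<alpha> \<in> Z.P" "AE z in \<alpha>. z \<in> grid F T"
  shows "\<Phi> \<alpha> = \<alpha>"
proof -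
  note \<beta> = Z.pole_fixingD(2)[OF \<Phi> \<alpha>(1)]
  note gp = grid_props[OF F(2) T(2)]
  let ?G = "grid F T"
  have AE_\<beta>: "AE z in \<Phi> \<alpha>. z \<in> ?G" by (rule grid_invariant[OF \<Phi> ret F T(1,2) \<alpha>])
  have G: "finite ?G" "?G \<subseteq> Z" using F T gp by (auto simp: grid_def)
  define k where "k z = sin (D pN z) * cos (d x0 (xc z))" for z
  \<comment> \<open>The cotangent of the projected height, that is the reciprocal of
    \<open>tan t * cos (d x0 x)\<close>. Its denominator \<open>k z\<close> is positive on the grid,
    so inequalities for \<open>R\<close> can be multiplied out.\<close>
  define R where "R z = cos (D pN z) / k z" for z
  have k_pos: "0 < k z" if "z \<in> ?G" for z
    using gp(2,3)[OF that] F T x0 cos_d_pos[of x0 "xc z"] by (auto simp: k_def intro!: mult_pos_pos sin_gt_zero)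
  have cos_ne: "cos (D pN z) \<noteq> 0" if "z \<in> ?G" for z
  proof
    assume "cos (D pN z) = 0"
    then have "cos (D pN z) = cos (pi / 2)" by simp
    then have "D pN z = pi / 2" by (rule cos_inj_pi[rotated 4]) (use gp(3)[OF that] T(2) in auto)
    then show False using gp(3)[OF that] T(3) by metis
  qed
  have inj: "inj_on R ?G"
  proof (rule inj_onI)
    fix z w assume zw: "z \<in> ?G" "w \<in> ?G" "R z = R w"
    have "tan (D pN v) * cos (d x0 (xc v)) = 1 / R v" for v by (simp add: R_def k_def tan_def)
    then have "tan (D pN z) * cos (d x0 (xc z)) = tan (D pN w) * cos (d x0 (xc w))" using zw by simp
    then have "(xc z, D pN z) = (xc w, D pN w)"
      using inj_onD[OF x0(2), of "(xc z, D pN z)" "(xc w, D pN w)"] gp zw by auto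
    then show "z = w" using gp(4)[OF zw(1)] gp(4)[OF zw(2)] by simp
  qed
  have level_transfer: "measure \<alpha> {z \<in> ?G. Q z} = measure (\<Phi> \<alpha>) {z \<in> ?G. Q z}"
    if PQ: "\<And>z. z \<in> ?G \<Longrightarrow> Q z \<longleftrightarrow> D a z powr p - D b z powr p > 0" and ab: "a \<in> Z" "b \<in> Z"
      and eq: "measure (\<Phi> \<alpha>) {v \<in> Z. D a v powr p - D b v powr p > 0} = measure \<alpha> {v \<in> Z. D a v powr p - D b v powr p > 0}"
    for a b Q
  proof -
    let ?E = "{v \<in> Z. D a v powr p - D b v powr p > 0}"
    have um: "(\<lambda>v. D a v powr p - D b v powr p) \<in> borel_measurable Z.B"
      using Z.dist_measurable[OF ab(1)] Z.dist_measurable[OF ab(2)] by measurable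
    have Eq: "(\<lambda>v. D a v powr p - D b v powr p) -` {0<..} \<inter> space Z.B = ?E" by auto
    have E: "?E \<in> sets Z.B" unfolding Eq[symmetric] by (rule measurable_sets[OF um greaterThan_borel])
    have H: "{z \<in> ?G. Q z} \<in> sets Z.B" using G by (intro Z.finite_sets) auto
    have "measure \<mu> {z \<in> ?G. Q z} = measure \<mu> ?E" if \<mu>: "\<mu> \<in> Z.P" "AE z in \<mu>. z \<in> ?G" for \<mu>
    proof (rule finite_measure.finite_measure_eq_AE[OF Z.PD(4)[OF \<mu>(1)]])
      show "AE z in \<mu>. (z \<in> {z \<in> ?G. Q z}) = (z \<in> ?E)"
        using \<mu>(2) by eventually_elim (use PQ G in auto)
    qed (use E H in \<open>simp_all only: Z.PD(2)[OF \<mu>(1)]\<close>)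
    then show ?thesis using eq \<alpha> \<beta> AE_\<beta> by simp
  qed
  \<comment> \<open>Bisectors compare distances, invariant levels compare \<open>p\<close>-th
    powers; at level \<open>0\<close> the two agree.\<close>
  have lt_iff: "D a z < D b z \<longleftrightarrow> D b z powr p - D a z powr p > 0" for a b z
    using p powr_less_mono2[of p "D a z" "D b z"] powr_mono2[of p "D b z" "D a z"] by force
  \<comment> \<open>The point at height \<open>pi - 2 * arctan c\<close> is the one from
    \<open>bisector\<close>; for \<open>c \<ge> 0\<close> this height lies between \<open>0\<close>
    and \<open>pi\<close>.\<close>
  have less: "measure \<alpha> {z \<in> ?G. R z < c} = measure (\<Phi> \<alpha>) {z \<in> ?G. R z < c}" if c: "0 \<le> c" for c
  proof (rule level_transfer[of "\<lambda>z. R z < c" pN "pt x0 (pi - 2 * arctan c)"])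
    have a: "0 \<le> arctan c" "arctan c < pi / 2" using c arctan_ubound by auto
    then show b: "pt x0 (pi - 2 * arctan c) \<in> Z" using x0 by simp
    show "measure (\<Phi> \<alpha>) {v \<in> Z. D pN v powr p - D (pt x0 (pi - 2 * arctan c)) v powr p > 0} =
        measure \<alpha> {v \<in> Z. D pN v powr p - D (pt x0 (pi - 2 * arctan c)) v powr p > 0}"
      by (rule Z.level_sets_invariant[OF \<Phi> ret b \<alpha>(1)])
    fix z assume z: "z \<in> ?G"
    have zz: "xc z \<in> X" "0 < D pN z" "D pN z < pi" using gp(2,3)[OF z] F T by auto
    have "R z < c \<longleftrightarrow> cos (D pN z) < c * k z" using k_pos[OF z] by (simp add: R_def divide_less_eq)
    also have "\<dots> \<longleftrightarrow> D (pt x0 (pi - 2 * arctan c)) z < D pN z"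
      using bisector(1)[OF x0(1) zz c] unfolding gp(4)[OF z, symmetric] k_def by blast
    also have "\<dots> \<longleftrightarrow> D pN z powr p - D (pt x0 (pi - 2 * arctan c)) z powr p > 0" by (rule lt_iff)
    finally show "R z < c \<longleftrightarrow> D pN z powr p - D (pt x0 (pi - 2 * arctan c)) z powr p > 0" .
  qed (rule poles_in_Z)
  \<comment> \<open>For negative \<open>c\<close> that height would exceed \<open>pi\<close>.
    Bisectors with \<open>pS\<close> are used instead, and exchanging the poles gives their
    invariance.\<close>
  interpret sw: bipolar Z D p pS pN pi by (rule Z.swap)
  have sw: "sw.pole_fixing \<Phi>" using \<Phi> by (auto simp: sw.pole_fixing_def Z.pole_fixing_def)
  have greater: "measure \<alpha> {z \<in> ?G. R z > c} = measure (\<Phi> \<alpha>) {z \<in> ?G. R z > c}" if c: "c \<le> 0" for c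
  proof (rule level_transfer[of "\<lambda>z. R z > c" pS "pt x0 (- 2 * arctan c)"])
    have a: "arctan c \<le> 0" "- (pi / 2) < arctan c" using c arctan_lbound by auto
    then show b: "pt x0 (- 2 * arctan c) \<in> Z" using x0 by simp
    show "measure (\<Phi> \<alpha>) {v \<in> Z. D pS v powr p - D (pt x0 (- 2 * arctan c)) v powr p > 0} =
        measure \<alpha> {v \<in> Z. D pS v powr p - D (pt x0 (- 2 * arctan c)) v powr p > 0}"
      by (rule sw.level_sets_invariant[OF sw ret b \<alpha>(1)])
    fix z assume z: "z \<in> ?G"
    have zz: "xc z \<in> X" "0 < D pN z" "D pN z < pi" using gp(2,3)[OF z] F T by auto
    have "R z > c \<longleftrightarrow> cos (D pN z) > c * k z" using k_pos[OF z] by (simp add: R_def less_divide_eq)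
    also have "\<dots> \<longleftrightarrow> D (pt x0 (- 2 * arctan c)) z < D pS z"
      using bisector(2)[OF x0(1) zz c] unfolding gp(4)[OF z, symmetric] k_def by blast
    also have "\<dots> \<longleftrightarrow> D pS z powr p - D (pt x0 (- 2 * arctan c)) z powr p > 0" by (rule lt_iff)
    finally show "R z > c \<longleftrightarrow> D pS z powr p - D (pt x0 (- 2 * arctan c)) z powr p > 0" .
  qed (rule poles_in_Z)
  show ?thesis
    by (rule Z.eqI_injective_levels[OF \<alpha> \<beta> AE_\<beta> G inj less greater, symmetric])
qed

section \<open>Density\<close>

text \<open>Points are moved along their meridians to avoid the poles and the height
  \<open>pi / 2\<close>.\<close>

lemma regular_points_dense:
  assumes z: "z \<in> Z" and e: "0 < e"
  shows "\<exists>w\<in>{pt x t |x t. x \<in> X \<and> 0 < t \<and> t < pi \<and> t \<noteq> pi / 2}. D w z < e"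
proof -
  obtain x t where x: "x \<in> X" "0 \<le> t" "t \<le> pi" "z = pt x t" using z by (rule Z_cases)
  define r where "r = min e (pi / 4)"
  have r: "0 < r" "r \<le> e" "r \<le> pi / 4" using e by (auto simp: r_def)
  \<comment> \<open>The shift goes away from the nearer end of the half interval that contains
    \<open>t\<close>; as \<open>r \<le> pi / 4\<close>, it does not reach the other end.\<close>
  define s where "s = (if t < pi / 2 then t + (if t \<le> pi / 4 then r / 2 else - r / 2) else
    (if t \<le> 3 * pi / 4 then t + r / 2 else t - r / 2))"
  have "0 < s" "s < pi" "s \<noteq> pi / 2" "\<bar>s - t\<bar> = r / 2" using r x by (auto simp: s_def)
  then show ?thesis
    using x r D_pt_same[of x s t] by (intro bexI[of _ "pt x s"]) auto
qed

text \<open>Finitely supported approximations at regular points are fixed, so \<open>\<mu>\<close>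
  and its image are equally close to each of them.\<close>

lemma rigid:
  assumes H: "\<And>S T. \<lbrakk>finite S; S \<noteq> {}; S \<subseteq> X;
                 finite T; T \<noteq> {}; T \<subseteq> {0<..<pi / 2} \<union> {pi / 2<..<pi}\<rbrakk> \<Longrightarrow>
           \<exists>x\<^sub>0\<in>X. inj_on (\<lambda>(x, t). tan t * cos (d x\<^sub>0 x)) (S \<times> T)"
  shows "isometrically_rigid p Z D"
proof (rule Z.rigid_if_returns_determine[OF flip_isometry flip_poles])
  fix \<Phi> \<mu> assume \<Phi>: "Z.pole_fixing \<Phi>" and ret: "\<And>z. z \<in> Z \<Longrightarrow> \<Phi> (return Z.B z) = return Z.B z"
    and \<mu>: "\<mu> \<in> Z.P"
  let ?G = "{pt x t |x t. x \<in> X \<and> 0 < t \<and> t < pi \<and> t \<noteq> pi / 2}"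
  note \<Phi>D = Z.pole_fixingD[OF \<Phi>]
  have GZ: "?G \<subseteq> Z" by auto
  have "\<exists>\<nu>\<in>Z.P. Z.W (\<Phi> \<mu>) \<nu> \<le> e \<and> Z.W \<mu> \<nu> \<le> e" if e: "0 < e" for e
  proof -
    obtain \<nu> A where \<nu>: "\<nu> \<in> Z.P" "finite A" "A \<subseteq> ?G" "AE z in \<nu>. z \<in> A" "Z.W \<mu> \<nu> \<le> e"
      by (rule Z.finite_support_approx[OF \<mu> GZ regular_points_dense e])
    \<comment> \<open>The support is in general no product, but it is contained in the grid spanned
      by its coordinates.\<close>
    define F where "F = xc ` A"
    define T where "T = D pN ` A"
    have A: "xc z \<in> X" "0 < D pN z" "D pN z < pi" "D pN z \<noteq> pi / 2" "z = pt (xc z) (D pN z)" if "z \<in> A" for z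
      using \<nu>(3) that by (auto simp: xc_pt D_poles)
    interpret prob_space \<nu> using Z.PD[OF \<nu>(1)] by simp
    have "A \<noteq> {}" using \<nu>(4) AE_False by auto
    have F: "finite F" "F \<noteq> {}" "F \<subseteq> X" using \<nu>(2) A \<open>A \<noteq> {}\<close> by (auto simp: F_def)
    have T: "finite T" "T \<noteq> {}" "T \<subseteq> {0<..<pi / 2} \<union> {pi / 2<..<pi}"
      using \<nu>(2) A \<open>A \<noteq> {}\<close> by (force simp: T_def)+
    have T': "T \<subseteq> {0<..<pi}" "pi / 2 \<notin> T" using T(3) by force+
    obtain x0 where x0: "x0 \<in> X" "inj_on (\<lambda>(x, t). tan t * cos (d x0 x)) (F \<times> T)"
      using H[OF F T] by blast
    have "A \<subseteq> grid F T"
    proof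
      fix z assume "z \<in> A"
      then show "z \<in> grid F T" using A(5)[of z] unfolding grid_def F_def T_def by (intro image_eqI[of _ _ "(xc z, D pN z)"]) auto
    qed
    then have AE_grid: "AE z in \<nu>. z \<in> grid F T" using \<nu>(4) by (auto elim: eventually_mono)
    have "\<Phi> \<nu> = \<nu>"
      by (rule grid_measures_fixed[OF \<Phi> ret F(1,3) T(1) T' x0 \<nu>(1) AE_grid])
    then have "Z.W (\<Phi> \<mu>) \<nu> \<le> e" using \<Phi>D(3)[OF \<mu> \<nu>(1)] \<nu>(5) by simp
    then show ?thesis using \<nu> by blast
  qed
  then show "\<Phi> \<mu> = \<mu>" by (rule Z.P_eqI_close[OF \<Phi>D(2)[OF \<mu>] \<mu>])
qed

end

theorem theorem6:
  fixes X :: "'a set" and d :: "'a \<Rightarrow> 'a \<Rightarrow> real" and p :: real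
  assumes "Metric_space X d"
    and "compact_space (Metric_space.mtopology X d)"
    and "mdiam X d < pi / 2"
    and "\<And>S T. \<lbrakk>finite S; S \<noteq> {}; S \<subseteq> X;
                 finite T; T \<noteq> {}; T \<subseteq> {0<..<pi / 2} \<union> {pi / 2<..<pi}\<rbrakk> \<Longrightarrow>
           \<exists>x\<^sub>0\<in>X. inj_on (\<lambda>(x, t). tan t * cos (d x\<^sub>0 x)) (S \<times> T)"
    and "p > 1"
  shows "isometrically_rigid p (susp X) (susp_dist X d)"
proof (cases "X = {}")
  \<comment> \<open>The empty space carries no probability measure, so the identity satisfies the
    claim vacuously.\<close>
  case True
  then have "susp X = {}" by (simp add: susp_def quotient_def)
  then have "prob_moment p (susp X) (susp_dist X d) = {}" "is_isometry (susp X) (susp_dist X d) id"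
    by (simp_all add: prob_moment_def is_isometry_def)
  then show ?thesis by (auto simp: isometrically_rigid_def)
next
  case False
  interpret suspension_wasserstein X d p
    using assms(1-3,5) False
    by (simp add: suspension_wasserstein_def suspension_wasserstein_axioms_def suspension_def suspension_axioms_def)
  show ?thesis by (rule rigid[OF assms(4)])
qed

end
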